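(* In the setting described in the context, let $\alpha_1,\beta_1,\beta_2\in\mathbb{R}$ be such that $\alpha_1>\tfrac12\|w\|_{L^\infty(\Omega)}$ and the matrix $\beta_1T+\beta_2N$ is positive definite. Then the local solver is well-posed: for every element $K\in\Omega_h$, given $(\hat u_h,\hat p_h,\hat b_h,\hat r_h)\in M_h\times P_h\times\Lambda_h\times\Gamma_h$ and $f,g\in[L^2(\Omega)]^d$, there exists a unique $(L_h,u_h,p_h,J_h,b_h,r_h)\in G_h(K)\times V_h(K)\times Q_h(K)\times H_h(K)\times C_h(K)\times S_h(K)$ satisfying the local equations (L1)-(L6) on $K$.
   Context: **Domain and mesh.** $\Omega\subset\mathbb{R}^d$, $d\in\{2,3\}$, is a bounded, simply connected (polygonal/polyhedral) Lipschitz domain whose boundary has one component, triangulated by a conforming shape-regular mesh $\Omega_h$ of $d$-simplices $K$. $\mathcal{E}_h$ is the set of all facets ($(d-1)$-simplices) of the mesh. $(\cdot,\cdot)_K$ and $\langle\cdot,\cdot\rangle_{\partial K}$ are $L^2$ inner products on $K$ and $\partial K$ (componentwise for vectors/matrices). $n$ is the outward unit normal on $\partial K$, $N=n\otimes n$, $T=I-N$. **Conventions.** $(\nabla u)_{ij}=\partial u_i/\partial x_j$, $(\nabla\cdot L)_i=\sum_j\partial L_{ij}/\partial x_j$, $(a\otimes b)_{ij}=a_ib_j$. For $d=3$, curl and cross product are the usual ones. For $d=2$: $\nabla\times b=\partial_1b_2-\partial_2b_1$ for vectors, $\nabla\times a=(\partial_2a,-\partial_1a)$ for scalars, $a\times b=a_1b_2-a_2b_1$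 for two vectors, and $a\times s=(a_2s,-a_1s)$ for a vector $a$ and a scalar $s$. **Data.** $\mathrm{Re},\mathrm{Rm},\kappa>0$ are constants; the prescribed fields are $d\in[W^{1,\infty}(\Omega)]^d$ (magnetic field; same letter as the dimension) and $w\in H(\mathrm{div},\Omega)$, $w|_K\in[W^{1,\infty}(K)]^d$ for all $K\in\Omega_h$, $\nabla\cdot w=0$; $m:=w\cdot n$. **Spaces.** Fix an integer $k\ge1$; $\tilde d=3$ if $d=3$, $\tilde d=1$ if $d=2$. $\mathcal P_j(\Omega_h)$ (resp. $\mathcal P_j(\mathcal E_h)$) denotes functions that are polynomials of degree at most $j$ on each element (resp. facet), with no continuity imposed; $\mathcal C(\mathcal E_h)$ denotes the continuous functions on the mesh skeleton $\bigcup_{e\in\mathcal E_h}e$. Set $G_h=[\mathcal P_k(\Omega_h)]^{d\times d}$, $V_h=C_h=[\mathcal P_k(\Omega_h)]^d$, $H_h=[\mathcal P_k(\Omega_h)]^{\tilde d}$, $Q_h=S_h=\mathcal P_{k-1}(\Omega_h)$, $M_h=\Lambda_h=[\mathcal P_k(\mathcal E_h)\cap\mathcal C(\mathcal E_h)]^d$, $P_h=\Gamma_h=\mathcal P_k(\mathcal E_h)$. $G_h(K)$, $V_h(K)$, etc. denote restrictions to $K$. **Numerical fluxes** on $\partial K$: $\hat F^1=-\hat u_h\otimes n$; $\hat F^2=-L_hn+m\,u_h+\hat p_h n+\tfrac12\kappa\,d\times(n\times(b_h+\hat b_h))+\alpha_1(u_h-\hat u_h)$; $\hat F^3=u_h\cdot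 n$; $\hat F^4=-n\times\hat b_h$; $\hat F^5=n\times J_h+\hat r_hn-\tfrac12\kappa\,n\times((u_h+\hat u_h)\times d)+(\beta_1T+\beta_2N)(b_h-\hat b_h)$; $\hat F^6=b_h\cdot n$. **Local equations** on $K$, for all $(G,v,q,H,c,s)\in G_h(K)\times V_h(K)\times Q_h(K)\times H_h(K)\times C_h(K)\times S_h(K)$: (L1) $\mathrm{Re}(L_h,G)_K+(u_h,\nabla\cdot G)_K+\langle\hat F^1,G\rangle_{\partial K}=0$; (L2) $(L_h,\nabla v)_K-(p_h,\nabla\cdot v)_K-(u_h\otimes w,\nabla v)_K+\kappa(b_h,\nabla\times(v\times d))_K+\langle\hat F^2,v\rangle_{\partial K}=(g,v)_K$; (L3) $-(u_h,\nabla q)_K+\langle\hat F^3,q\rangle_{\partial K}=0$; (L4) $\frac{\mathrm{Rm}}{\kappa}(J_h,H)_K-(b_h,\nabla\times H)_K+\langle\hat F^4,H\rangle_{\partial K}=0$; (L5) $(J_h,\nabla\times c)_K-(r_h,\nabla\cdot c)_K-\kappa(u_h,d\times(\nabla\times c))_K+\langle\hat F^5,c\rangle_{\partial K}=(f,c)_K$; (L6) $-(b_h,\nabla s)_K+\langle\hat F^6,s\rangle_{\partial K}=0$. *)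

theory Defs
  imports "HOL-Analysis.Analysis" "HOL-Probability.Essential_Supremum"
begin

section \<open>Cross products and curls in two and three dimensions\<close>

text \<open>
  The spatial dimension is \<open>CARD('n)\<close>, and \<open>'m\<close> indexes the components of the current density
  (three components in space, one in the plane).  A curl is given as a function of the Jacobian
  matrix, whose entry \<open>i\<close>, \<open>j\<close> is the \<open>j\<close>-th partial derivative of the \<open>i\<close>-th component.
\<close>

record ('n, 'm) vector_calculus =
  cross_v :: "real^'n \<Rightarrow> real^'n \<Rightarrow> real^'m"
  cross_s :: "real^'n \<Rightarrow> real^'m \<Rightarrow> real^'n"
  curl_v :: "real^'n^'n \<Rightarrow> real^'m"
  curl_s :: "real^'n^'m \<Rightarrow> real^'n"

definition calculus2 :: "(2, 1) vector_calculus" where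
  "calculus2 =
    \<lparr>cross_v = (\<lambda>a b. vector [a$1 * b$2 - a$2 * b$1]),
     cross_s = (\<lambda>a s. vector [a$2 * s$1, - (a$1 * s$1)]),
     curl_v = (\<lambda>A. vector [A$2$1 - A$1$2]),
     curl_s = (\<lambda>A. vector [A$1$2, - A$1$1])\<rparr>"

definition curl3 :: "real^3^3 \<Rightarrow> real^3" where
  "curl3 A = vector [A$3$2 - A$2$3, A$1$3 - A$3$1, A$2$1 - A$1$2]"

definition calculus3 :: "(3, 3) vector_calculus" where
  "calculus3 = \<lparr>cross_v = cross3, cross_s = cross3, curl_v = curl3, curl_s = curl3\<rparr>"

definition outer :: "real^'m \<Rightarrow> real^'n \<Rightarrow> real^'n^'m" where
  "outer a b = (\<chi> i j. a$i * b$j)"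

definition positive_definite :: "real^'n^'n \<Rightarrow> bool" where
  "positive_definite A \<longleftrightarrow> (\<forall>x. x \<noteq> 0 \<longrightarrow> x \<bullet> (A *v x) > 0)"


section \<open>Domain and mesh\<close>

definition lipschitz_domain :: "(real^'n) set \<Rightarrow> bool" where
  "lipschitz_domain \<Omega> \<longleftrightarrow> open \<Omega> \<and> connected \<Omega> \<and> \<Omega> \<noteq> {} \<and>
    (\<forall>x\<in>frontier \<Omega>. \<exists>U e C \<phi>. open U \<and> x \<in> U \<and> norm e = 1 \<and>
       C-lipschitz_on UNIV (\<phi> :: real^'n \<Rightarrow> real) \<and>
       \<Omega> \<inter> U = {y\<in>U. \<phi> (y - (y \<bullet> e) *\<^sub>R e) < y \<bullet> e})"

definition inradius :: "(real^'n) set \<Rightarrow> real" where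
  "inradius K = Sup {r. \<exists>x. cball x r \<subseteq> K}"

text \<open>The clause \<open>\<Union>\<T> = closure \<Omega>\<close> makes \<open>\<Omega>\<close> polygonal/polyhedral; \<^const>\<open>triangulation\<close>
  expresses that the mesh is conforming; \<open>\<sigma>\<close> is the shape-regularity constant.\<close>

definition simplicial_mesh :: "real \<Rightarrow> (real^'n) set \<Rightarrow> (real^'n) set set \<Rightarrow> bool" where
  "simplicial_mesh \<sigma> \<Omega> \<T> \<longleftrightarrow> triangulation \<T> \<and> \<Union>\<T> = closure \<Omega> \<and>
    (\<forall>K\<in>\<T>. int CARD('n) simplex K \<and> diameter K \<le> \<sigma> * inradius K)"

definition facets :: "(real^'n) set set \<Rightarrow> (real^'n) set set" where
  "facets \<T> = {F. \<exists>K\<in>\<T>. F facet_of K}"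

definition normal :: "(real^'n) set \<Rightarrow> (real^'n) set \<Rightarrow> real^'n" where
  "normal K F = (THE n. norm n = 1 \<and> (\<forall>x\<in>F. \<forall>y\<in>K. n \<bullet> (y - x) \<le> 0))"

text \<open>
  Surface measure on a flat facet \<open>F\<close> with unit normal \<open>n\<close>: Lebesgue measure on the cylinder of
  height one erected over \<open>F\<close> is the product of the \<open>(d-1)\<close>-dimensional measure on \<open>F\<close> and the
  length on the unit interval, so its image under the orthogonal projection onto the
  hyperplane of \<open>F\<close> is the \<open>(d-1)\<close>-dimensional measure on \<open>F\<close>.
\<close>

definition facet_measure :: "real^'n \<Rightarrow> (real^'n) set \<Rightarrow> (real^'n) measure" where
  "facet_measure n F =
    distr (restrict_space lborel {x + t *\<^sub>R n | x t. x \<in> F \<and> 0 \<le> t \<and> t \<le> 1})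
      (restrict_space borel F)
      (\<lambda>y. y - ((y - (SOME a. a \<in> F)) \<bullet> n) *\<^sub>R n)"

definition ip :: "(real^'n) set \<Rightarrow> (real^'n \<Rightarrow> 'b::euclidean_space) \<Rightarrow> (real^'n \<Rightarrow> 'b) \<Rightarrow> real" where
  "ip K a b = (LINT x|lebesgue_on K. a x \<bullet> b x)"

text \<open>The first argument of the boundary pairing may take different values from different facets
  (as the normal does), hence it receives the facet as an argument.\<close>

definition bip :: "(real^'n) set \<Rightarrow> ((real^'n) set \<Rightarrow> real^'n \<Rightarrow> 'b::euclidean_space) \<Rightarrow>
    (real^'n \<Rightarrow> 'b) \<Rightarrow> real" where
  "bip K a b = (\<Sum>F | F facet_of K. LINT x|facet_measure (normal K F) F. a F x \<bullet> b x)"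


section \<open>Lebesgue and Sobolev spaces\<close>

definition L2 :: "(real^'n) set \<Rightarrow> (real^'n \<Rightarrow> 'b::euclidean_space) set" where
  "L2 U = {f. f \<in> borel_measurable (lebesgue_on U) \<and>
     integrable (lebesgue_on U) (\<lambda>x. (norm (f x))\<^sup>2)}"

definition Linf :: "(real^'n) set \<Rightarrow> (real^'n \<Rightarrow> 'b::euclidean_space) set" where
  "Linf U = {f. f \<in> borel_measurable (lebesgue_on U) \<and>
     (\<exists>C. AE x in lebesgue_on U. norm (f x) \<le> C)}"

definition Linf_norm :: "(real^'n) set \<Rightarrow> (real^'n \<Rightarrow> 'b::euclidean_space) \<Rightarrow> ereal" where
  "Linf_norm U f = esssup (lebesgue_on U) (\<lambda>x. ereal (norm (f x)))"

text \<open>\<open>\<phi>\<close> is continuously differentiable with compact support in \<open>U\<close>, and \<open>\<psi>\<close> is its gradient.\<close>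

definition test_function :: "(real^'n) set \<Rightarrow> (real^'n \<Rightarrow> real) \<Rightarrow> (real^'n \<Rightarrow> real^'n) \<Rightarrow> bool" where
  "test_function U \<phi> \<psi> \<longleftrightarrow> (\<forall>x. GDERIV \<phi> x :> \<psi> x) \<and> continuous_on UNIV \<psi> \<and>
     compact (closure {x. \<phi> x \<noteq> 0}) \<and> closure {x. \<phi> x \<noteq> 0} \<subseteq> U"

definition weak_divergence :: "(real^'n) set \<Rightarrow> (real^'n \<Rightarrow> real^'n) \<Rightarrow> (real^'n \<Rightarrow> real) \<Rightarrow> bool" where
  "weak_divergence U f q \<longleftrightarrow> (\<forall>\<phi> \<psi>. test_function U \<phi> \<psi> \<longrightarrow>
     (LINT x|lebesgue_on U. f x \<bullet> \<psi> x) = - (LINT x|lebesgue_on U. q x * \<phi> x))"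

definition Hdiv :: "(real^'n) set \<Rightarrow> (real^'n \<Rightarrow> real^'n) set" where
  "Hdiv U = {f \<in> L2 U. \<exists>q \<in> L2 U. weak_divergence U f q}"

definition weak_jacobian :: "(real^'n) set \<Rightarrow> (real^'n \<Rightarrow> real^'m) \<Rightarrow> (real^'n \<Rightarrow> real^'n^'m) \<Rightarrow> bool" where
  "weak_jacobian U f D \<longleftrightarrow> (\<forall>\<phi> \<psi> i j. test_function U \<phi> \<psi> \<longrightarrow>
     (LINT x|lebesgue_on U. f x $ i * \<psi> x $ j) = - (LINT x|lebesgue_on U. D x $ i $ j * \<phi> x))"

text \<open>An element of \<open>W^{1,\<infinity>}\<close> on an open set is identified with its continuous representative.  On the
  interior of a simplex the representative is Lipschitz, and the boundary values that enter the
  numerical fluxes are its limits from inside (\<open>trace_from\<close>).\<close>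

definition W1inf :: "(real^'n) set \<Rightarrow> (real^'n \<Rightarrow> real^'m) set" where
  "W1inf U = {f \<in> Linf U. continuous_on U f \<and> (\<exists>D \<in> Linf U. weak_jacobian U f D)}"

definition trace_from :: "(real^'n) set \<Rightarrow> (real^'n \<Rightarrow> real^'m) \<Rightarrow> real^'n \<Rightarrow> real^'m" where
  "trace_from K f x = Lim (at x within interior K) f"

text \<open>The weak Jacobian of a \<open>W^{1,\<infinity>}\<close> function is determined up to null sets.\<close>

definition weak_jac :: "(real^'n) set \<Rightarrow> (real^'n \<Rightarrow> real^'m) \<Rightarrow> real^'n \<Rightarrow> real^'n^'m" where
  "weak_jac U f = (SOME D. D \<in> Linf U \<and> weak_jacobian U f D)"


section \<open>Classical derivatives of polynomial fields on a closed simplex\<close>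

definition jac :: "(real^'n) set \<Rightarrow> (real^'n \<Rightarrow> real^'m) \<Rightarrow> real^'n \<Rightarrow> real^'n^'m" where
  "jac K u x = jacobian u (at x within K)"

definition grad :: "(real^'n) set \<Rightarrow> (real^'n \<Rightarrow> real) \<Rightarrow> real^'n \<Rightarrow> real^'n" where
  "grad K q x = (\<chi> j. frechet_derivative q (at x within K) (axis j 1))"

definition div_v :: "(real^'n) set \<Rightarrow> (real^'n \<Rightarrow> real^'n) \<Rightarrow> real^'n \<Rightarrow> real" where
  "div_v K u x = (\<Sum>j\<in>UNIV. jac K u x $ j $ j)"

definition div_m :: "(real^'n) set \<Rightarrow> (real^'n \<Rightarrow> real^'n^'n) \<Rightarrow> real^'n \<Rightarrow> real^'n" where
  "div_m K G x = (\<chi> i. div_v K (\<lambda>y. G y $ i) x)"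


section \<open>Discrete spaces\<close>

text \<open>Polynomials of total degree at most \<open>k\<close>, as functions on \<open>S\<close>
  (extended by \<^const>\<open>undefined\<close>, so that functions equal on \<open>S\<close> are equal).\<close>

definition poly_s :: "nat \<Rightarrow> (real^'n) set \<Rightarrow> (real^'n \<Rightarrow> real) set" where
  "poly_s k S = {f. \<exists>c :: ('n \<Rightarrow> nat) \<Rightarrow> real.
     f = (\<lambda>x\<in>S. \<Sum>a | sum a UNIV \<le> k. c a * (\<Prod>i\<in>UNIV. (x $ i) ^ a i))}"

definition poly_v :: "nat \<Rightarrow> (real^'n) set \<Rightarrow> (real^'n \<Rightarrow> real^'m) set" where
  "poly_v k S = {f \<in> extensional S. \<forall>i. (\<lambda>x\<in>S. f x $ i) \<in> poly_s k S}"

definition poly_m :: "nat \<Rightarrow> (real^'n) set \<Rightarrow> (real^'n \<Rightarrow> real^'l^'m) set" where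
  "poly_m k S = {f \<in> extensional S. \<forall>i j. (\<lambda>x\<in>S. f x $ i $ j) \<in> poly_s k S}"

text \<open>\<open>M\<^sub>h = \<Lambda>\<^sub>h\<close> consists of functions on the mesh skeleton.  A member of \<open>P\<^sub>h = \<Gamma>\<^sub>h\<close> may take several
  values where facets meet; it is a family of functions indexed by the facets.\<close>

definition M_space :: "nat \<Rightarrow> (real^'n) set set \<Rightarrow> (real^'n \<Rightarrow> real^'n) set" where
  "M_space k \<T> = {\<mu>. continuous_on (\<Union>(facets \<T>)) \<mu> \<and>
     (\<forall>F\<in>facets \<T>. restrict \<mu> F \<in> poly_v k F)}"

definition P_space :: "nat \<Rightarrow> (real^'n) set set \<Rightarrow> ((real^'n) set \<Rightarrow> real^'n \<Rightarrow> real) set" where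
  "P_space k \<T> = {\<pi>. \<forall>F\<in>facets \<T>. \<pi> F \<in> poly_s k F}"


section \<open>Numerical fluxes and the local solver\<close>

definition penalty :: "real \<Rightarrow> real \<Rightarrow> real^'n \<Rightarrow> real^'n^'n" where
  "penalty \<beta>1 \<beta>2 n = \<beta>1 *\<^sub>R (mat 1 - outer n n) + \<beta>2 *\<^sub>R outer n n"

definition flux1 where
  "flux1 K uh F x = - outer (uh x) (normal K F)"

definition flux2 where
  "flux2 \<C> \<kappa> d w \<alpha>1 K uh ph bh L u b F x =
    (let n = normal K F; d' = trace_from K d x; m = trace_from K w x \<bullet> n in
      - (L x *v n) + m *\<^sub>R u x + ph F x *\<^sub>R n
      + (\<kappa> / 2) *\<^sub>R cross_s \<C> d' (cross_v \<C> n (b x + bh x)) + \<alpha>1 *\<^sub>R (u x - uh x))"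

definition flux3 where
  "flux3 K u F x = u x \<bullet> normal K F"

definition flux4 where
  "flux4 \<C> K bh F x = - cross_v \<C> (normal K F) (bh x)"

definition flux5 where
  "flux5 \<C> \<kappa> d \<beta>1 \<beta>2 K uh bh rh u J b F x =
    (let n = normal K F; d' = trace_from K d x in
      cross_s \<C> n (J x) + rh F x *\<^sub>R n
      - (\<kappa> / 2) *\<^sub>R cross_s \<C> n (cross_v \<C> (u x + uh x) d')
      + penalty \<beta>1 \<beta>2 n *v (b x - bh x))"

definition flux6 where
  "flux6 K b F x = b x \<bullet> normal K F"

text \<open>The magnetic field \<open>d\<close> is only weakly differentiable, so the curl of \<open>v \<times> d\<close> in the second
  equation is taken in the weak sense.\<close>

definition local_solutions ::
  "('n, 'm) vector_calculus \<Rightarrow> nat \<Rightarrow> real \<Rightarrow> real \<Rightarrow> real \<Rightarrow>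
   (real^'n \<Rightarrow> real^'n) \<Rightarrow> (real^'n \<Rightarrow> real^'n) \<Rightarrow> real \<Rightarrow> real \<Rightarrow> real \<Rightarrow> (real^'n) set \<Rightarrow>
   (real^'n \<Rightarrow> real^'n) \<Rightarrow> ((real^'n) set \<Rightarrow> real^'n \<Rightarrow> real) \<Rightarrow>
   (real^'n \<Rightarrow> real^'n) \<Rightarrow> ((real^'n) set \<Rightarrow> real^'n \<Rightarrow> real) \<Rightarrow>
   (real^'n \<Rightarrow> real^'n) \<Rightarrow> (real^'n \<Rightarrow> real^'n) \<Rightarrow>
   ((real^'n \<Rightarrow> real^'n^'n) \<times> (real^'n \<Rightarrow> real^'n) \<times> (real^'n \<Rightarrow> real) \<times>
    (real^'n \<Rightarrow> real^'m) \<times> (real^'n \<Rightarrow> real^'n) \<times> (real^'n \<Rightarrow> real)) set" where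
  "local_solutions \<C> k Rey Rem \<kappa> d w \<alpha>1 \<beta>1 \<beta>2 K uh ph bh rh f g =
    {(L, u, p, J, b, r).
      L \<in> poly_m k K \<and> u \<in> poly_v k K \<and> p \<in> poly_s (k - 1) K \<and>
      J \<in> poly_v k K \<and> b \<in> poly_v k K \<and> r \<in> poly_s (k - 1) K \<and>
      (\<forall>G \<in> poly_m k K.
        Rey * ip K L G + ip K u (div_m K G) + bip K (flux1 K uh) G = 0) \<and>
      (\<forall>v \<in> poly_v k K.
        ip K L (jac K v) - ip K p (div_v K v) - ip K (\<lambda>x. outer (u x) (w x)) (jac K v)
        + \<kappa> * ip K b (\<lambda>x. curl_s \<C> (weak_jac (interior K) (\<lambda>y. cross_v \<C> (v y) (d y)) x))
        + bip K (flux2 \<C> \<kappa> d w \<alpha>1 K uh ph bh L u b) v = ip K g v) \<and>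
      (\<forall>q \<in> poly_s (k - 1) K.
        - ip K u (grad K q) + bip K (flux3 K u) q = 0) \<and>
      (\<forall>H \<in> poly_v k K.
        Rem / \<kappa> * ip K J H - ip K b (\<lambda>x. curl_s \<C> (jac K H x))
        + bip K (flux4 \<C> K bh) H = 0) \<and>
      (\<forall>c \<in> poly_v k K.
        ip K J (\<lambda>x. curl_v \<C> (jac K c x)) - ip K r (div_v K c)
        - \<kappa> * ip K u (\<lambda>x. cross_s \<C> (d x) (curl_v \<C> (jac K c x)))
        + bip K (flux5 \<C> \<kappa> d \<beta>1 \<beta>2 K uh bh rh u J b) c = ip K f c) \<and>
      (\<forall>s \<in> poly_s (k - 1) K.
        - ip K b (grad K s) + bip K (flux6 K b) s = 0)}"

definition standing_assumptions ::
  "(real^'n) set \<Rightarrow> real \<Rightarrow> (real^'n) set set \<Rightarrow> nat \<Rightarrow> real \<Rightarrow> real \<Rightarrow> real \<Rightarrow>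
   (real^'n \<Rightarrow> real^'n) \<Rightarrow> (real^'n \<Rightarrow> real^'n) \<Rightarrow> bool" where
  "standing_assumptions \<Omega> \<sigma> \<T> k Rey Rem \<kappa> d w \<longleftrightarrow>
    lipschitz_domain \<Omega> \<and> bounded \<Omega> \<and> simply_connected \<Omega> \<and> connected (frontier \<Omega>) \<and>
    simplicial_mesh \<sigma> \<Omega> \<T> \<and> k \<ge> 1 \<and> Rey > 0 \<and> Rem > 0 \<and> \<kappa> > 0 \<and>
    d \<in> W1inf \<Omega> \<and>
    w \<in> Hdiv \<Omega> \<and> (\<forall>K\<in>\<T>. w \<in> W1inf (interior K)) \<and> weak_divergence \<Omega> w (\<lambda>_. 0)"

end

theory Submission
  imports Defs
begin

text \<open>
  The local equations are a linear system on a finite-dimensional space with equally many equations and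
  unknowns, so it suffices to exclude nontrivial solutions for vanishing data.  Testing with the solution
  itself and integrating by parts, all mixed terms cancel and there remains
  \<open>Re (L, L) + Rm/\<kappa> (J, J) + \<langle>(\<alpha>1 + m/2) u, u\<rangle> + \<langle>(\<beta>1 T + \<beta>2 N) b, b\<rangle> = 0\<close>, hence \<open>L = 0\<close>, \<open>J = 0\<close>,
  and \<open>u = b = 0\<close> on the boundary.  Equation (L1) then gives \<open>\<nabla>u = 0\<close>; equations (L4) and (L6) make \<open>b\<close> curl-
  and divergence-free, and \<open>|\<nabla>b|\<^sup>2 - |\<nabla>\<times>b|\<^sup>2 - (\<nabla>\<cdot>b)\<^sup>2\<close> is a divergence, so \<open>\<nabla>b = 0\<close> too.
  Finally \<open>p\<close> and \<open>r\<close> vanish because the divergence maps vector polynomials onto the polynomials of one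
  degree less.

  As \<open>d\<close> and \<open>w\<close> are only \<open>W\<^sup>1\<^sup>,\<^sup>\<infinity>\<close>, the integrations by parts need the divergence theorem for weakly
  differentiable fields.  It follows by inserting into the weak formulation test functions that are cut off
  in a layer along the facets, whose gradients concentrate on the boundary as the layer shrinks.
\<close>

section \<open>Finite linear systems\<close>

text \<open>Positivity on the diagonal is a matter of halves. Since w is divergence-free, the
  convective volume term contributes minus one half of the pairing of m u with u, the flux
  contributes all of it, and |m| < 2 \<alpha>1 makes the remaining coefficient positive. In the
  magnetic coupling, integrating the weak curl by parts leaves a boundary term of weight \<kappa>,
  which the two halves in the second and fifth flux absorb exactly. Two features shape the
  development. Polynomials are functions on the whole space of which only the values on K count, so
  existence runs over a spanning family pruned to one that is independent on K. And test functions
  of the weak formulation vanish near the boundary, while the fluxes need boundary values of d and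
  w; for this, \<open>W1inf\<close> functions are shown to be Lipschitz on the convex interior of K,
  which extends them continuously to K and identifies \<open>trace_from\<close> with the extension.
  On the facets u and b are known to vanish only almost everywhere, and this is always consumed
  under a boundary integral.\<close>

lemma square_system_solvable:
  fixes B :: "'i \<Rightarrow> 'j \<Rightarrow> real"
  assumes "finite I" "finite J" "card I = card J"
    and "\<And>z. (\<forall>i\<in>I. (\<Sum>j\<in>J. B i j * z j) = 0) \<Longrightarrow> \<forall>j\<in>J. z j = 0"
  shows "\<exists>z. \<forall>i\<in>I. (\<Sum>j\<in>J. B i j * z j) = l i"
  using assms
proof (induction "card J" arbitrary: I J B l)
  case 0
  then show ?case by auto
next
  case (Suc n)
  obtain j0 where j0: "j0 \<in> J" using Suc.hyps(2) by fastforce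
  have split: "(\<Sum>j\<in>J. B i j * z j) = B i j0 * z j0 + (\<Sum>j\<in>J - {j0}. B i j * z j)" for i z
    using Suc.prems j0 by (simp add: sum.remove)
  \<comment> \<open>If column j0 vanished in every row, the unit vector at j0 would be a nonzero
    kernel vector; so a pivot exists.\<close>
  obtain i0 where i0: "i0 \<in> I" "B i0 j0 \<noteq> 0"
  proof (rule ccontr)
    assume *: "\<not> thesis"
    then have "\<forall>i\<in>I. B i j0 = 0" using that by blast
    then have "\<forall>i\<in>I. (\<Sum>j\<in>J. B i j * (if j = j0 then 1 else 0)) = 0" by (simp add: split)
    then show False using Suc.prems(4) j0 by fastforce
  qed
  \<comment> \<open>Schur complement of the pivot: the system left after row i0 has eliminated the
    unknown j0.\<close>
  define B' where "B' i j = B i j - B i j0 * B i0 j / B i0 j0" for i j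
  \<comment> \<open>Back substitution. The value given to j0 makes row i0 equal to t; the other rows
    see t only through the multiplier of row i0. It is used with t = 0 for the kernel and t =
    \<open>l i0\<close> for the solution.\<close>
  have ext: "(\<Sum>j\<in>J. B i j * (if j = j0 then (t - (\<Sum>j\<in>J - {j0}. B i0 j * z j)) / B i0 j0 else z j))
      = B i j0 / B i0 j0 * t + (\<Sum>j\<in>J - {j0}. B' i j * z j)" for i t z
  proof -
    have "(\<Sum>j\<in>J - {j0}. B' i j * z j)
        = (\<Sum>j\<in>J - {j0}. B i j * z j) - (B i j0 / B i0 j0) * (\<Sum>j\<in>J - {j0}. B i0 j * z j)"
      by (simp add: B'_def left_diff_distrib sum_subtractf sum_distrib_left mult.assoc)
    then show ?thesis
      by (simp add: split right_diff_distrib diff_divide_distrib)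
  qed
  have B'0: "B' i0 j = 0" for j using i0 by (simp add: B'_def)
  have "\<exists>z. \<forall>i\<in>I - {i0}. (\<Sum>j\<in>J - {j0}. B' i j * z j) = l i - B i j0 / B i0 j0 * l i0"
  proof (rule Suc.hyps(1))
    show "n = card (J - {j0})" using Suc j0 by simp
    show "card (I - {i0}) = card (J - {j0})" using Suc j0 i0 by simp
    fix z assume z: "\<forall>i\<in>I - {i0}. (\<Sum>j\<in>J - {j0}. B' i j * z j) = 0"
    let ?z = "\<lambda>j. if j = j0 then (0 - (\<Sum>j\<in>J - {j0}. B i0 j * z j)) / B i0 j0 else z j"
    have "\<forall>i\<in>I. (\<Sum>j\<in>J. B i j * ?z j) = 0"
    proof
      fix i assume i: "i \<in> I"
      show "(\<Sum>j\<in>J. B i j * ?z j) = 0"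
        unfolding ext using z i by (cases "i = i0") (simp_all add: B'0)
    qed
    from Suc.prems(4)[OF this] show "\<forall>j\<in>J - {j0}. z j = 0" by (metis (no_types, lifting) Diff_iff singletonI)
  qed (use Suc in auto)
  then obtain z where z: "\<forall>i\<in>I - {i0}. (\<Sum>j\<in>J - {j0}. B' i j * z j) = l i - B i j0 / B i0 j0 * l i0"
    by blast
  let ?z = "\<lambda>j. if j = j0 then (l i0 - (\<Sum>j\<in>J - {j0}. B i0 j * z j)) / B i0 j0 else z j"
  have "\<forall>i\<in>I. (\<Sum>j\<in>J. B i j * ?z j) = l i"
  proof
    fix i assume i: "i \<in> I"
    show "(\<Sum>j\<in>J. B i j * ?z j) = l i"
      unfolding ext using z i i0 by (cases "i = i0") (simp_all add: B'0)
  qed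
  then show ?case by (rule exI[where x = ?z])
qed

text \<open>Greedy pruning. Spanning and independence both refer to the values on S, which is what
  later turns injectivity of the form on S into a trivial kernel of its matrix.\<close>

lemma independent_subfamily:
  fixes \<phi> :: "'i \<Rightarrow> 'x \<Rightarrow> 'v::real_vector"
  assumes "finite I"
  shows "\<exists>M\<subseteq>I. (\<forall>c. \<exists>c'. \<forall>x\<in>S. (\<Sum>i\<in>I. c i *\<^sub>R \<phi> i x) = (\<Sum>i\<in>M. c' i *\<^sub>R \<phi> i x)) \<and>
    (\<forall>c. (\<forall>x\<in>S. (\<Sum>i\<in>M. c i *\<^sub>R \<phi> i x) = 0) \<longrightarrow> (\<forall>i\<in>M. c i = 0))"
  using assms
proof (induction I rule: finite_induct)
  case empty
  then show ?case by auto
next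
  case (insert j I)
  obtain M where M: "M \<subseteq> I"
    and sp: "\<And>c. \<exists>c'. \<forall>x\<in>S. (\<Sum>i\<in>I. c i *\<^sub>R \<phi> i x) = (\<Sum>i\<in>M. c' i *\<^sub>R \<phi> i x)"
    and ind: "\<And>c. \<forall>x\<in>S. (\<Sum>i\<in>M. c i *\<^sub>R \<phi> i x) = 0 \<Longrightarrow> \<forall>i\<in>M. c i = 0"
    using insert.IH by blast
  have fM: "finite M" "j \<notin> M" using M insert.hyps finite_subset by auto
  show ?case
  proof (cases "\<exists>d. \<forall>x\<in>S. \<phi> j x = (\<Sum>i\<in>M. d i *\<^sub>R \<phi> i x)")
    case True
    then obtain d where d: "\<forall>x\<in>S. \<phi> j x = (\<Sum>i\<in>M. d i *\<^sub>R \<phi> i x)" by blast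
    have "\<exists>c'. \<forall>x\<in>S. (\<Sum>i\<in>insert j I. c i *\<^sub>R \<phi> i x) = (\<Sum>i\<in>M. c' i *\<^sub>R \<phi> i x)" for c
    proof -
      obtain c' where c': "\<forall>x\<in>S. (\<Sum>i\<in>I. c i *\<^sub>R \<phi> i x) = (\<Sum>i\<in>M. c' i *\<^sub>R \<phi> i x)"
        using sp by blast
      have "\<forall>x\<in>S. (\<Sum>i\<in>insert j I. c i *\<^sub>R \<phi> i x) = (\<Sum>i\<in>M. (c j * d i + c' i) *\<^sub>R \<phi> i x)"
        using insert.hyps c' d by (simp add: scaleR_add_left sum.distrib scaleR_right.sum)
      then show ?thesis by (intro exI[where x = "\<lambda>i. c j * d i + c' i"])
    qed
    then show ?thesis using M ind by (intro exI[of _ M]) auto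
  next
    case False
    have "\<exists>c'. \<forall>x\<in>S. (\<Sum>i\<in>insert j I. c i *\<^sub>R \<phi> i x) = (\<Sum>i\<in>insert j M. c' i *\<^sub>R \<phi> i x)" for c
    proof -
      obtain c' where c': "\<forall>x\<in>S. (\<Sum>i\<in>I. c i *\<^sub>R \<phi> i x) = (\<Sum>i\<in>M. c' i *\<^sub>R \<phi> i x)"
        using sp by blast
      have "(\<Sum>i\<in>M. (c'(j := c j)) i *\<^sub>R \<phi> i x) = (\<Sum>i\<in>M. c' i *\<^sub>R \<phi> i x)" for x
        using fM by (intro sum.cong) auto
      then have "\<forall>x\<in>S. (\<Sum>i\<in>insert j I. c i *\<^sub>R \<phi> i x) = (\<Sum>i\<in>insert j M. (c'(j := c j)) i *\<^sub>R \<phi> i x)"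
        using insert.hyps c' fM by simp
      then show ?thesis by (intro exI[where x = "c'(j := c j)"])
    qed
    moreover have "\<forall>i\<in>insert j M. c i = 0"
      if c: "\<forall>x\<in>S. (\<Sum>i\<in>insert j M. c i *\<^sub>R \<phi> i x) = 0" for c
    proof (cases "c j = 0")
      case True
      then show ?thesis using c fM ind[of c] by simp
    next
      case neq: False
      \<comment> \<open>Dividing the relation by the nonzero coefficient of j expresses this
        function through M, against the case assumption.\<close>
      have "\<phi> j x = (\<Sum>i\<in>M. (- c i / c j) *\<^sub>R \<phi> i x)" if "x \<in> S" for x
      proof -
        have "c j *\<^sub>R \<phi> j x = - (\<Sum>i\<in>M. c i *\<^sub>R \<phi> i x)"
          using c that fM by (simp add: eq_neg_iff_add_eq_0)
        then have "\<phi> j x = inverse (c j) *\<^sub>R - (\<Sum>i\<in>M. c i *\<^sub>R \<phi> i x)"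
          using neq by (metis scaleR_one scaleR_scaleR left_inverse)
        also have "\<dots> = (\<Sum>i\<in>M. (- c i / c j) *\<^sub>R \<phi> i x)"
          by (simp add: scaleR_right.sum sum_negf divide_inverse mult.commute)
        finally show ?thesis .
      qed
      then have "\<exists>d. \<forall>x\<in>S. \<phi> j x = (\<Sum>i\<in>M. d i *\<^sub>R \<phi> i x)"
        by (intro exI[where x = "\<lambda>i. - c i / c j"] ballI)
      then show ?thesis using False by contradiction
    qed
    ultimately show ?thesis using M by (intro exI[of _ "insert j M"]) auto
  qed
qed

text \<open>The functions need not be linearly independent, and only their values on \<open>S\<close> matter.\<close>

lemma galerkin_solvable:
  fixes X :: "('x \<Rightarrow> 'v::real_vector) set" and B :: "('x \<Rightarrow> 'v) \<Rightarrow> ('x \<Rightarrow> 'v) \<Rightarrow> real"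
  assumes fin: "finite I" and X: "X = range (\<lambda>c x. \<Sum>i\<in>I. c i *\<^sub>R \<phi> i x)"
    and B1: "\<And>Z Z' Y s. Z \<in> X \<Longrightarrow> Z' \<in> X \<Longrightarrow> Y \<in> X \<Longrightarrow> B (\<lambda>x. Z x + s *\<^sub>R Z' x) Y = B Z Y + s * B Z' Y"
    and B2: "\<And>Z Y Y' s. Z \<in> X \<Longrightarrow> Y \<in> X \<Longrightarrow> Y' \<in> X \<Longrightarrow> B Z (\<lambda>x. Y x + s *\<^sub>R Y' x) = B Z Y + s * B Z Y'"
    and l: "\<And>Y Y' s. Y \<in> X \<Longrightarrow> Y' \<in> X \<Longrightarrow> l (\<lambda>x. Y x + s *\<^sub>R Y' x) = l Y + s * l Y'"
    and congB: "\<And>Z Y Y'. Z \<in> X \<Longrightarrow> Y \<in> X \<Longrightarrow> Y' \<in> X \<Longrightarrow> (\<And>x. x \<in> S \<Longrightarrow> Y x = Y' x) \<Longrightarrow> B Z Y = B Z Y'"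
    and congl: "\<And>Y Y'. Y \<in> X \<Longrightarrow> Y' \<in> X \<Longrightarrow> (\<And>x. x \<in> S \<Longrightarrow> Y x = Y' x) \<Longrightarrow> l Y = l Y'"
    and inj: "\<And>Z. Z \<in> X \<Longrightarrow> (\<And>Y. Y \<in> X \<Longrightarrow> B Z Y = 0) \<Longrightarrow> (\<And>x. x \<in> S \<Longrightarrow> Z x = 0)"
  shows "\<exists>Z\<in>X. \<forall>Y\<in>X. B Z Y = l Y"
proof -
  define f where "f M c = (\<lambda>x. \<Sum>i\<in>M. c i *\<^sub>R \<phi> i x)" for M c
  have fX: "f M c \<in> X" if "M \<subseteq> I" for M c
  proof -
    have "f M c = (\<lambda>x. \<Sum>i\<in>I. (if i \<in> M then c i else 0) *\<^sub>R \<phi> i x)"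
      unfolding f_def using that fin
      by (intro ext sum.mono_neutral_cong_left) auto
    then show ?thesis
      unfolding X by (intro image_eqI[where x = "\<lambda>i. if i \<in> M then c i else 0"]) auto
  qed
  have \<phi>X: "\<phi> i \<in> X" if "i \<in> I" for i
    using fX[of "{i}" "\<lambda>_. 1"] that by (simp add: f_def)
  have f_insert: "f (insert i M) c = (\<lambda>x. f M c x + c i *\<^sub>R \<phi> i x)" if "finite M" "i \<notin> M" for i M c
    using that by (simp add: f_def add.commute)
  have zero: "(\<lambda>x. 0) \<in> X" using fX[of "{}"] by (simp add: f_def)
  have B10: "B (\<lambda>x. 0) Y = 0" if "Y \<in> X" for Y using B1[OF zero zero that, of 1] by simp
  have B20: "B Z (\<lambda>x. 0) = 0" if "Z \<in> X" for Z using B2[OF that zero zero, of 1] by simp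
  have l0: "l (\<lambda>x. 0) = 0" using l[OF zero zero, of 1] by simp
  have sum1: "B (f M c) Y = (\<Sum>i\<in>M. B (\<phi> i) Y * c i)" if "M \<subseteq> I" "Y \<in> X" for M c Y
  proof -
    have "finite M" using that fin finite_subset by blast
    then show ?thesis using that
    proof (induction M rule: finite_induct)
      case empty then show ?case by (simp add: f_def B10)
    next
      case (insert i M)
      then show ?case by (simp add: f_insert B1 fX \<phi>X)
    qed
  qed
  have sum2: "B Z (f M c) = (\<Sum>i\<in>M. c i * B Z (\<phi> i))" if "M \<subseteq> I" "Z \<in> X" for M c Z
  proof -
    have "finite M" using that fin finite_subset by blast
    then show ?thesis using that
    proof (induction M rule: finite_induct)
      case empty then show ?case by (simp add: f_def B20)
    next
      case (insert i M)
      then show ?case by (simp add: f_insert B2 fX \<phi>X)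
    qed
  qed
  have suml: "l (f M c) = (\<Sum>i\<in>M. c i * l (\<phi> i))" if "M \<subseteq> I" for M c
  proof -
    have "finite M" using that fin finite_subset by blast
    then show ?thesis using that
    proof (induction M rule: finite_induct)
      case empty then show ?case by (simp add: f_def l0)
    next
      case (insert i M)
      then show ?case by (simp add: f_insert l fX \<phi>X)
    qed
  qed
  obtain M where M: "M \<subseteq> I"
    and sp: "\<And>c. \<exists>c'. \<forall>x\<in>S. (\<Sum>i\<in>I. c i *\<^sub>R \<phi> i x) = (\<Sum>i\<in>M. c' i *\<^sub>R \<phi> i x)"
    and ind: "\<And>c. \<forall>x\<in>S. (\<Sum>i\<in>M. c i *\<^sub>R \<phi> i x) = 0 \<Longrightarrow> \<forall>i\<in>M. c i = 0"
    using independent_subfamily[OF fin, of S \<phi>] by blast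
  have finM: "finite M" using M fin finite_subset by blast
  have rep: "\<exists>c. \<forall>x\<in>S. Y x = f M c x" if "Y \<in> X" for Y
    using that sp unfolding X f_def by fastforce
  \<comment> \<open>The form sees a test function only through its values on S, so every test
    function may be replaced by a combination of the pruned family.\<close>
  have test: "B Z Y = (\<Sum>i\<in>M. c i * B Z (\<phi> i))" if "Z \<in> X" "Y \<in> X" "\<forall>x\<in>S. Y x = f M c x" for Z Y c
    using congB[OF that(1,2) fX[OF M]] that(3) sum2[OF M that(1)] by simp
  \<comment> \<open>Rows are tests and columns are unknowns, both indexed by M. A kernel vector
    gives a function that vanishes on S by \<open>inj\<close>, hence has zero coefficients by
    independence.\<close>
  have "\<exists>z. \<forall>i\<in>M. (\<Sum>j\<in>M. B (\<phi> j) (\<phi> i) * z j) = l (\<phi> i)"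
  proof (rule square_system_solvable[OF finM finM refl])
    fix z assume "\<forall>i\<in>M. (\<Sum>j\<in>M. B (\<phi> j) (\<phi> i) * z j) = 0"
    then have z: "\<forall>i\<in>M. B (f M z) (\<phi> i) = 0" using sum1[OF M \<phi>X] M by auto
    have "B (f M z) Y = 0" if Y: "Y \<in> X" for Y
    proof -
      obtain c where "\<forall>x\<in>S. Y x = f M c x" using rep[OF Y] by blast
      from test[OF fX[OF M] Y this] show ?thesis using z by simp
    qed
    from inj[OF fX[OF M] this] ind show "\<forall>j\<in>M. z j = 0" unfolding f_def by blast
  qed
  then obtain z where z: "\<forall>i\<in>M. (\<Sum>j\<in>M. B (\<phi> j) (\<phi> i) * z j) = l (\<phi> i)" by blast
  have "B (f M z) Y = l Y" if Y: "Y \<in> X" for Y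
  proof -
    obtain c where c: "\<forall>x\<in>S. Y x = f M c x" using rep[OF Y] by blast
    have "B (f M z) (\<phi> i) = l (\<phi> i)" if "i \<in> M" for i
      using that z sum1[OF M \<phi>X] M by auto
    then have "B (f M z) Y = (\<Sum>i\<in>M. c i * l (\<phi> i))"
      using test[OF fX[OF M] Y c] by simp
    also have "\<dots> = l Y" using congl[OF Y fX[OF M]] c suml[OF M] by simp
    finally show ?thesis .
  qed
  then show ?thesis using fX[OF M] by blast
qed

section \<open>Polynomials in several variables\<close>

definition mpow :: "('n::finite \<Rightarrow> nat) \<Rightarrow> real^'n \<Rightarrow> real" where
  "mpow a x = (\<Prod>i\<in>UNIV. (x $ i) ^ a i)"

text \<open>Polynomials on the whole space. The discrete spaces are their restrictions
  (\<open>poly_s_restrict\<close>), and differentiation takes place before restricting.\<close>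

definition polys :: "nat \<Rightarrow> (real^'n::finite \<Rightarrow> real) set" where
  "polys k = range (\<lambda>c x. \<Sum>a | sum a UNIV \<le> k. c a * mpow a x)"

definition pd :: "(real^'n \<Rightarrow> real) \<Rightarrow> 'n \<Rightarrow> real^'n \<Rightarrow> real" where
  "pd f j x = frechet_derivative f (at x) (axis j 1)"

lemma finite_multiindices: "finite {a :: 'n::finite \<Rightarrow> nat. sum a UNIV \<le> k}"
proof (rule finite_subset)
  show "{a :: 'n \<Rightarrow> nat. sum a UNIV \<le> k} \<subseteq> PiE UNIV (\<lambda>_. {..k})"
    by (auto simp: PiE_def) (metis UNIV_I finite_class.finite_UNIV member_le_sum order_trans zero_le)
qed (simp add: finite_PiE)

lemma mpow_polys:
  assumes "sum a UNIV \<le> k" shows "mpow a \<in> polys k"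
proof -
  have "mpow a = (\<lambda>x. \<Sum>b | sum b UNIV \<le> k. (if b = a then 1 else 0) * mpow b x)"
  proof
    fix x
    have "(\<Sum>b | sum b UNIV \<le> k. (if b = a then 1 else 0) * mpow b x)
        = (\<Sum>b | sum b UNIV \<le> k. if b = a then mpow b x else 0)"
      by (intro sum.cong) auto
    then show "mpow a x = (\<Sum>b | sum b UNIV \<le> k. (if b = a then 1 else 0) * mpow b x)"
      using assms by (simp add: finite_multiindices)
  qed
  then show ?thesis unfolding polys_def by (intro image_eqI[where x = "\<lambda>b. if b = a then 1 else 0"]) auto
qed

lemma polys_lin:
  assumes "f \<in> polys k" "g \<in> polys k" shows "(\<lambda>x. f x + s * g x) \<in> polys k"
proof -
  from assms obtain c d where "f = (\<lambda>x. \<Sum>a | sum a UNIV \<le> k. c a * mpow a x)"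
    "g = (\<lambda>x. \<Sum>a | sum a UNIV \<le> k. d a * mpow a x)" unfolding polys_def by auto
  then have "(\<lambda>x. f x + s * g x) = (\<lambda>x. \<Sum>a | sum a UNIV \<le> k. (c a + s * d a) * mpow a x)"
    by (simp add: sum_distrib_left distrib_right sum.distrib mult.assoc)
  then show ?thesis unfolding polys_def by (intro image_eqI[where x = "\<lambda>a. c a + s * d a"]) auto
qed

lemma polys_zero: "(\<lambda>x. 0) \<in> polys k"
  unfolding polys_def by (intro image_eqI[where x = "\<lambda>a. 0"]) auto

lemma polys_scale: "f \<in> polys k \<Longrightarrow> (\<lambda>x. s * f x) \<in> polys k"
  using polys_lin[OF polys_zero, of f k s] by simp

lemma polys_add: "f \<in> polys k \<Longrightarrow> g \<in> polys k \<Longrightarrow> (\<lambda>x. f x + g x) \<in> polys k"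
  using polys_lin[of f k g 1] by simp

lemma polys_sum: "(\<And>i. i \<in> A \<Longrightarrow> f i \<in> polys k) \<Longrightarrow> (\<lambda>x. \<Sum>i\<in>A. f i x) \<in> polys k"
proof (induction A rule: infinite_finite_induct)
  case (insert i A)
  then have "(\<lambda>x. f i x + (\<Sum>i\<in>A. f i x)) \<in> polys k" by (intro polys_add) auto
  then show ?case using insert.hyps by simp
qed (simp_all add: polys_zero)

lemma polys_induct [consumes 1, case_names mpow lin]:
  assumes "f \<in> polys k"
    and "\<And>a. sum a UNIV \<le> k \<Longrightarrow> Q (mpow a)"
    and "\<And>f g s. f \<in> polys k \<Longrightarrow> g \<in> polys k \<Longrightarrow> Q f \<Longrightarrow> Q g \<Longrightarrow> Q (\<lambda>x. f x + s * g x)"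
  shows "Q f"
proof -
  \<comment> \<open>The zero function is the constant monomial minus itself, so the linear case
    already covers the empty sum.\<close>
  have z: "Q (\<lambda>x. 0)"
    using assms(3)[OF mpow_polys mpow_polys assms(2) assms(2), of "\<lambda>_. 0" "\<lambda>_. 0" "-1"] by simp
  have "(\<lambda>x. \<Sum>a\<in>A. c a * mpow a x) \<in> polys k \<and> Q (\<lambda>x. \<Sum>a\<in>A. c a * mpow a x)"
    if "finite A" "A \<subseteq> {a. sum a UNIV \<le> k}" for A c
    using that
  proof (induction A rule: finite_induct)
    case empty then show ?case by (simp add: z polys_zero)
  next
    case (insert a A)
    have "(\<lambda>x. \<Sum>a\<in>insert a A. c a * mpow a x) = (\<lambda>x. (\<Sum>a\<in>A. c a * mpow a x) + c a * mpow a x)"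
      using insert.hyps by (simp add: add.commute)
    then show ?case using insert by (auto intro!: assms(3) polys_lin assms(2) mpow_polys)
  qed
  from this[OF finite_multiindices order_refl] show ?thesis using assms(1) unfolding polys_def by auto
qed

lemma polys_le: "f \<in> polys k \<Longrightarrow> k \<le> l \<Longrightarrow> f \<in> polys l"
  by (induction rule: polys_induct) (auto intro!: mpow_polys polys_lin)

lemma polys_nth: "(\<lambda>x. x $ i) \<in> polys 1"
proof -
  have "mpow (\<lambda>j. if j = i then 1 else 0) = (\<lambda>x. x $ i)"
    by (simp add: mpow_def fun_eq_iff if_distrib[of "\<lambda>n. _ ^ n"] cong: if_cong)
  then show ?thesis using mpow_polys[of "\<lambda>j. if j = i then 1 else 0" 1] by simp
qed

lemma polys_mult: "f \<in> polys k \<Longrightarrow> g \<in> polys l \<Longrightarrow> (\<lambda>x. f x * g x) \<in> polys (k + l)"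
proof (induction rule: polys_induct)
  case (mpow a)
  from mpow(2) show ?case
  proof (induction rule: polys_induct)
    case (mpow b)
    have "(\<lambda>x. mpow a x * mpow b x) = mpow (\<lambda>i. a i + b i)"
      by (simp add: mpow_def fun_eq_iff power_add prod.distrib)
    then show ?case using mpow \<open>sum a UNIV \<le> k\<close> by (auto intro!: mpow_polys simp: sum.distrib)
  next
    case (lin f g s)
    then show ?case using polys_lin[OF lin(3,4), of s] by (simp add: algebra_simps)
  qed
next
  case (lin f1 f2 s)
  then show ?case using polys_lin[OF lin(3)[OF lin(5)] lin(4)[OF lin(5)], of s] by (simp add: algebra_simps)
qed

text \<open>The truncated exponent at \<open>a j = 0\<close> is harmless, because the factor
  \<open>a j\<close> in front is zero there.\<close>

lemma mpow_has_derivative: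
  "(mpow a has_derivative (\<lambda>h. \<Sum>j\<in>UNIV. h $ j * (real (a j) * mpow (a(j := a j - 1)) x))) (at x within S)"
proof -
  have "(mpow a has_derivative (\<lambda>h. \<Sum>j\<in>UNIV. (real (a j) * (x $ j) ^ (a j - 1) * h $ j) * (\<Prod>i\<in>UNIV - {j}. (x $ i) ^ a i)))
    (at x within S)"
    unfolding mpow_def[abs_def]
    by (rule has_derivative_prod) (auto intro!: derivative_eq_intros bounded_linear.has_derivative[OF bounded_linear_vec_nth] simp: fun_eq_iff)
  moreover have "mpow (a(j := a j - 1)) x = (x $ j) ^ (a j - 1) * (\<Prod>i\<in>UNIV - {j}. (x $ i) ^ a i)" for j
    unfolding mpow_def by (subst prod.remove[of _ j]) (auto intro!: prod.cong)
  ultimately show ?thesis by (simp add: mult_ac)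
qed

lemma pd_eqI:
  assumes "(f has_derivative (\<lambda>h. \<Sum>j\<in>UNIV. h $ j * D j)) (at x)"
  shows "pd f j x = D j"
  unfolding pd_def frechet_derivative_at[OF assms, symmetric]
proof -
  have "(\<Sum>i\<in>UNIV. axis j 1 $ i * D i) = (\<Sum>i\<in>UNIV. if i = j then D i else 0)"
    by (intro sum.cong) (auto simp: axis_def)
  then show "(\<Sum>i\<in>UNIV. axis j 1 $ i * D i) = D j" by simp
qed

lemma pd_mpow: "pd (mpow a) j = (\<lambda>x. real (a j) * mpow (a(j := a j - 1)) x)"
  by (rule ext, rule pd_eqI, rule mpow_has_derivative)

lemma polys_has_derivative:
  "f \<in> polys k \<Longrightarrow> (f has_derivative (\<lambda>h. \<Sum>j\<in>UNIV. h $ j * pd f j x)) (at x within S)"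
proof (induction arbitrary: x S rule: polys_induct)
  case (mpow a)
  show ?case unfolding pd_mpow by (rule mpow_has_derivative)
next
  case (lin f g s)
  have *: "((\<lambda>x. f x + s * g x) has_derivative (\<lambda>h. \<Sum>j\<in>UNIV. h $ j * (pd f j x + s * pd g j x))) (at x within S)" for x S
    by (rule has_derivative_eq_rhs[OF has_derivative_add[OF lin(3) has_derivative_mult_right[OF lin(4)]]])
      (simp add: fun_eq_iff sum_distrib_left sum.distrib distrib_left mult_ac)
  have "pd (\<lambda>x. f x + s * g x) j x = pd f j x + s * pd g j x" for j x
    by (rule pd_eqI[OF *])
  then show ?case using * by simp
qed

lemma pd_lin:
  fixes f g :: "real^'n \<Rightarrow> real"
  assumes "f \<in> polys k" "g \<in> polys l"
  shows "pd (\<lambda>x. f x + s * g x) j x = pd f j x + s * pd g j x"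
  by (rule pd_eqI, rule has_derivative_eq_rhs[OF has_derivative_add[OF polys_has_derivative[OF assms(1)] has_derivative_mult_right[OF polys_has_derivative[OF assms(2)]]]])
     (simp add: fun_eq_iff sum_distrib_left sum.distrib distrib_left mult_ac)

lemma pd_const [simp]: "pd (\<lambda>x. c) j x = 0"
  by (rule pd_eqI) simp

lemma pd_scale: "f \<in> polys k \<Longrightarrow> pd (\<lambda>x. s * f x) j x = s * pd f j x"
  using pd_lin[OF polys_zero[of k], of f k s j x] by simp

lemma pd_add: "f \<in> polys k \<Longrightarrow> g \<in> polys l \<Longrightarrow> pd (\<lambda>x. f x + g x) j x = pd f j x + pd g j x"
  using pd_lin[of f k g l 1] by simp

lemma pd_sum:
  assumes "\<And>i. i \<in> A \<Longrightarrow> f i \<in> polys k"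
  shows "pd (\<lambda>x. \<Sum>i\<in>A. f i x) j x = (\<Sum>i\<in>A. pd (f i) j x)"
  using assms
proof (induction A rule: infinite_finite_induct)
  case (insert i A)
  then show ?case using pd_add[of "f i" k "\<lambda>x. \<Sum>i\<in>A. f i x" k] polys_sum[of A f k] by simp
qed auto

lemma pd_mult:
  assumes "f \<in> polys k" "g \<in> polys l"
  shows "pd (\<lambda>x. f x * g x) j x = f x * pd g j x + pd f j x * g x"
  by (rule pd_eqI, rule has_derivative_eq_rhs[OF has_derivative_mult[OF polys_has_derivative[OF assms(1)] polys_has_derivative[OF assms(2)]]])
     (simp add: fun_eq_iff sum_distrib_left sum_distrib_right sum.distrib distrib_left mult_ac)

lemma pd_polys: "f \<in> polys k \<Longrightarrow> pd f j \<in> polys (k - 1)"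
proof (induction rule: polys_induct)
  case (mpow a)
  show ?case
  proof (cases "a j = 0")
    case True then show ?thesis by (simp add: pd_mpow polys_zero)
  next
    case False
    have "sum (a(j := a j - 1)) UNIV = sum a UNIV - 1"
      using False by (simp add: sum.remove[of UNIV j])
    then show ?thesis unfolding pd_mpow using mpow by (intro polys_scale mpow_polys) simp
  qed
next
  case (lin f g s)
  then have "pd (\<lambda>x. f x + s * g x) j = (\<lambda>x. pd f j x + s * pd g j x)" by (auto simp: pd_lin)
  then show ?case using lin by (simp add: polys_lin)
qed

lemma pd_commute:
  fixes f :: "real^'n \<Rightarrow> real"
  assumes "f \<in> polys k"
  shows "pd (pd f i) j = pd (pd f j) i"
  using assms
proof (induction rule: polys_induct)
  case (mpow a)
  show ?case
    by (cases "i = j") (simp_all add: fun_eq_iff pd_mpow pd_scale[OF mpow_polys[OF order_refl]] fun_upd_twist)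
next
  case (lin f g s)
  have *: "pd (\<lambda>x. f x + s * g x) m = (\<lambda>x. pd f m x + s * pd g m x)" for m
    using lin by (auto simp: pd_lin)
  show ?case
    unfolding * by (rule ext) (simp add: pd_lin[OF pd_polys[OF lin(1)] pd_polys[OF lin(2)]] lin(3,4))
qed

text \<open>Integrating in a single coordinate raises the degree by one; this makes the divergence
  surjective when p and r are shown to vanish.\<close>

lemma polys_antiderivative: "p \<in> polys k \<Longrightarrow> \<exists>q\<in>polys (Suc k). pd q j = p"
proof (induction rule: polys_induct)
  case (mpow a)
  let ?a = "a(j := Suc (a j))"
  have "sum ?a UNIV = Suc (sum a UNIV)" by (simp add: sum.remove[of UNIV j])
  then have q: "mpow ?a \<in> polys (Suc k)" using mpow by (intro mpow_polys) simp
  have "pd (\<lambda>x. inverse (Suc (a j)) * mpow ?a x) j = mpow a"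
    by (rule ext, subst pd_scale[OF q]) (simp add: pd_mpow del: of_nat_Suc)
  then show ?case using polys_scale[OF q] by blast
next
  case (lin f g s)
  then obtain F G where "F \<in> polys (Suc k)" "pd F j = f" "G \<in> polys (Suc k)" "pd G j = g" by blast
  then show ?case by (intro bexI[of _ "\<lambda>x. F x + s * G x"]) (auto simp: pd_lin polys_lin)
qed

lemma polys_continuous: "f \<in> polys k \<Longrightarrow> continuous_on S f"
  by (rule has_derivative_continuous_on, rule polys_has_derivative)

lemma poly_s_restrict: "poly_s k S = (\<lambda>f. restrict f S) ` polys k"
  unfolding poly_s_def polys_def image_image mpow_def by (auto simp: full_SetCompr_eq image_image)

section \<open>Facets of a full-dimensional polytope\<close>

text \<open>A facet F lies in the plane where the inner product with \<open>normal K F\<close>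
  equals this number; as that product is constant on F, the chosen point is immaterial.\<close>

definition offset :: "(real^'n) set \<Rightarrow> (real^'n) set \<Rightarrow> real" where
  "offset K F = normal K F \<bullet> (SOME a. a \<in> F)"

locale full_polytope =
  fixes K :: "(real^'n) set"
  assumes polytope: "polytope K" and interior_ne: "interior K \<noteq> {}"
begin

lemma compact: "compact K" and convex: "convex K" and closed: "closed K"
  using polytope polytope_imp_compact polytope_imp_convex compact_imp_closed by blast+

text \<open>The definite description in \<open>normal\<close> has to be shown unique. A facet spans
  its hyperplane by a dimension count, so a competing unit vector is parallel to n, and an interior
  point of K excludes -n.\<close>

lemma normal_eqI:
  assumes F: "F facet_of K" and n: "norm n = 1" "F \<subseteq> {x. n \<bullet> x = c}" "K \<subseteq> {x. n \<bullet> x \<le> c}"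
  shows "normal K F = n"
  unfolding normal_def
proof (rule the_equality)
  show "norm n = 1 \<and> (\<forall>x\<in>F. \<forall>y\<in>K. n \<bullet> (y - x) \<le> 0)"
    using n by (auto simp: inner_diff_right)
next
  fix m assume m: "norm m = 1 \<and> (\<forall>x\<in>F. \<forall>y\<in>K. m \<bullet> (y - x) \<le> 0)"
  have "F \<noteq> {}" "F \<subseteq> K" using F by (auto simp: facet_of_def facet_of_imp_subset)
  then obtain x0 where x0: "x0 \<in> F" by blast
  have F_sub: "F \<subseteq> {x. m \<bullet> x = m \<bullet> x0}"
  proof
    fix x assume x: "x \<in> F"
    then have "m \<bullet> (x - x0) \<le> 0" "m \<bullet> (x0 - x) \<le> 0" using m x0 \<open>F \<subseteq> K\<close> by blast+
    then show "x \<in> {x. m \<bullet> x = m \<bullet> x0}" by (simp add: inner_diff_right)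
  qed
  have n0: "n \<noteq> 0" and nn: "n \<bullet> n = 1" and mm: "m \<bullet> m = 1" using n m by (auto simp: norm_eq_1)
  have "aff_dim F = int CARD('n) - 1"
    using F affine_hull_nonempty_interior[OF interior_ne] aff_dim_affine_hull[of K]
    by (simp add: facet_of_def)
  moreover have "aff_dim {x. n \<bullet> x = c} = int CARD('n) - 1"
    using n0 by simp
  ultimately have hull: "affine hull F = {x. n \<bullet> x = c}"
    using \<open>F \<noteq> {}\<close> n(2) by (intro affine_dim_equal) (auto simp: affine_hyperplane hull_minimal)
  have "affine hull F \<subseteq> {x. m \<bullet> x = m \<bullet> x0}"
    using F_sub by (simp add: affine_hyperplane hull_minimal)
  \<comment> \<open>The tangential part of m is a direction inside the hyperplane, along which the
    inner product with m does not vary; hence this part is zero.\<close>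
  moreover have "x0 + (m - (m \<bullet> n) *\<^sub>R n) \<in> affine hull F"
    unfolding hull using x0 n(2) nn by (auto simp: inner_simps inner_commute)
  ultimately have "m \<bullet> (m - (m \<bullet> n) *\<^sub>R n) = 0"
    by (auto simp: inner_add_right)
  then have sq: "(m \<bullet> n)\<^sup>2 = 1" using mm by (simp add: inner_diff_right power2_eq_square)
  have "(m - (m \<bullet> n) *\<^sub>R n) \<bullet> (m - (m \<bullet> n) *\<^sub>R n) = 0"
    using sq mm nn by (simp add: inner_simps power2_eq_square inner_commute)
  then have mn: "m = (m \<bullet> n) *\<^sub>R n" by simp
  \<comment> \<open>For m = -n the set K would lie on both sides of the hyperplane, that is, inside
    it; stepping from an interior point against n contradicts this.\<close>
  have "m \<bullet> n \<noteq> -1"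
  proof
    assume "m \<bullet> n = -1"
    then have [simp]: "m = - n" using mn by simp
    obtain z where z: "z \<in> interior K" using interior_ne by blast
    obtain e where e: "e > 0" "ball z e \<subseteq> K" using z mem_interior by blast
    have "z - (e/2) *\<^sub>R n \<in> K" using e n(1) by (intro subsetD[OF e(2)]) (simp add: dist_norm)
    moreover have "n \<bullet> z \<le> c" using z n(3) interior_subset by blast
    moreover have "m \<bullet> (z - (e/2) *\<^sub>R n - x0) \<le> 0" using m x0 calculation by blast
    moreover have "n \<bullet> x0 = c" using x0 n(2) by blast
    ultimately show False using e(1) nn by (simp add: inner_simps)
  qed
  then have "m \<bullet> n = 1" using sq by (metis power2_eq_1_iff)
  then show "m = n" using mn by simp
qed

text \<open>A minimal half-space representation has one half-space per facet, and rescaling its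
  normals to unit length turns them into \<open>normal\<close>. Facets, K and the interior are then
  governed by one finite list of affine inequalities.\<close>

lemma facet_representation:
  "(\<forall>F. F facet_of K \<longrightarrow> norm (normal K F) = 1 \<and> F = K \<inter> {x. normal K F \<bullet> x = offset K F}) \<and>
    K = {x. \<forall>F. F facet_of K \<longrightarrow> normal K F \<bullet> x \<le> offset K F} \<and>
    interior K = {x. \<forall>F. F facet_of K \<longrightarrow> normal K F \<bullet> x < offset K F}"
proof -
  have U: "affine hull K = UNIV" using interior_ne by (rule affine_hull_nonempty_interior)
  obtain H where H: "finite H" and K: "K = affine hull K \<inter> \<Inter>H"
    and ex: "\<forall>h\<in>H. \<exists>a b. a \<noteq> 0 \<and> h = {x. a \<bullet> x \<le> b}"
    and min: "\<And>H'. H' \<subset> H \<Longrightarrow> K \<subset> affine hull K \<inter> \<Inter>H'"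
    using polytope_imp_polyhedron[OF polytope] polyhedron_Int_affine_minimal[of K] by auto
  obtain a b where ab: "\<And>h. h \<in> H \<Longrightarrow> a h \<noteq> 0 \<and> h = {x. a h \<bullet> x \<le> b h}"
    using ex by metis
  have facets: "F facet_of K \<longleftrightarrow> (\<exists>h. h \<in> H \<and> F = K \<inter> {x. a h \<bullet> x = b h})" for F
    by (rule facet_of_polyhedron_explicit[OF H K ab min])
  have int: "interior K = {x \<in> K. \<forall>h\<in>H. a h \<bullet> x < b h}"
    using rel_interior_polyhedron_explicit[OF H K ab min] rel_interior_interior[OF U] by simp
  have nF: "normal K F = inverse (norm (a h)) *\<^sub>R a h \<and> offset K F = inverse (norm (a h)) * b h"
    if h: "h \<in> H" and F: "F = K \<inter> {x. a h \<bullet> x = b h}" for h F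
  proof -
    let ?n = "inverse (norm (a h)) *\<^sub>R a h" and ?c = "inverse (norm (a h)) * b h"
    have pos: "inverse (norm (a h)) > 0" using ab[OF h] by simp
    have facet: "F facet_of K" using facets h F by blast
    have "\<Inter>H \<subseteq> h" using h by blast
    then have "K \<subseteq> h" using K by blast
    then have Kh: "K \<subseteq> {x. a h \<bullet> x \<le> b h}" using ab[OF h] by blast
    have n: "normal K F = ?n"
    proof (rule normal_eqI[OF facet, where c = ?c])
      show "norm ?n = 1" using ab[OF h] by simp
      show "F \<subseteq> {x. ?n \<bullet> x = ?c}" using F by auto
      show "K \<subseteq> {x. ?n \<bullet> x \<le> ?c}" using Kh pos by (auto intro!: mult_left_mono)
    qed
    have "(SOME a. a \<in> F) \<in> F" using facet by (simp add: facet_of_def some_in_eq)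
    then have "offset K F = ?c" unfolding offset_def n using F by auto
    with n show ?thesis by simp
  qed
  have le: "normal K F \<bullet> x \<le> offset K F \<longleftrightarrow> a h \<bullet> x \<le> b h"
    and lt: "normal K F \<bullet> x < offset K F \<longleftrightarrow> a h \<bullet> x < b h"
    and eq: "normal K F \<bullet> x = offset K F \<longleftrightarrow> a h \<bullet> x = b h"
    and n1: "norm (normal K F) = 1"
    if "h \<in> H" "F = K \<inter> {x. a h \<bullet> x = b h}" for h F x
  proof -
    have pos: "inverse (norm (a h)) > 0" using ab[OF that(1)] by simp
    note nb = nF[OF that, THEN conjunct1] nF[OF that, THEN conjunct2]
    show "normal K F \<bullet> x \<le> offset K F \<longleftrightarrow> a h \<bullet> x \<le> b h"
      using mult_le_cancel_left_pos[OF pos] unfolding nb by simp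
    show "normal K F \<bullet> x < offset K F \<longleftrightarrow> a h \<bullet> x < b h"
      using mult_less_cancel_left_pos[OF pos] unfolding nb by simp
    show "normal K F \<bullet> x = offset K F \<longleftrightarrow> a h \<bullet> x = b h"
      using pos unfolding nb by simp
    show "norm (normal K F) = 1" unfolding nb using ab[OF that(1)] by simp
  qed
  have ball: "(\<forall>F. F facet_of K \<longrightarrow> P F) \<longleftrightarrow> (\<forall>h\<in>H. P (K \<inter> {x. a h \<bullet> x = b h}))" for P
    using facets by auto
  have KH: "K = {x. \<forall>h\<in>H. a h \<bullet> x \<le> b h}"
  proof -
    have "\<Inter>H = {x. \<forall>h\<in>H. a h \<bullet> x \<le> b h}" using ab by blast
    then show ?thesis using K U by simp
  qed
  show ?thesis
  proof (intro conjI)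
    show "\<forall>F. F facet_of K \<longrightarrow> norm (normal K F) = 1 \<and> F = K \<inter> {x. normal K F \<bullet> x = offset K F}"
      unfolding ball using n1 eq by simp
    show "K = {x. \<forall>F. F facet_of K \<longrightarrow> normal K F \<bullet> x \<le> offset K F}"
      unfolding ball using le KH by simp
    show "interior K = {x. \<forall>F. F facet_of K \<longrightarrow> normal K F \<bullet> x < offset K F}"
      unfolding ball int using lt KH by (auto intro: less_imp_le)
  qed
qed

lemma norm_normal: "F facet_of K \<Longrightarrow> norm (normal K F) = 1"
  and facet_eq: "F facet_of K \<Longrightarrow> F = K \<inter> {x. normal K F \<bullet> x = offset K F}"
  and mem_iff: "x \<in> K \<longleftrightarrow> (\<forall>F. F facet_of K \<longrightarrow> normal K F \<bullet> x \<le> offset K F)"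
  and mem_interior_iff: "x \<in> interior K \<longleftrightarrow> (\<forall>F. F facet_of K \<longrightarrow> normal K F \<bullet> x < offset K F)"
  using facet_representation by blast+

lemma normal_inner_self: "F facet_of K \<Longrightarrow> normal K F \<bullet> normal K F = 1"
  using norm_normal norm_eq_1 by blast

lemma finite_facets: "finite {F. F facet_of K}"
  using finite_polytope_facets polytope by blast

lemma compact_facet: "F facet_of K \<Longrightarrow> compact F"
  using face_of_imp_compact[OF convex compact facet_of_imp_face_of] .

lemma facet_subset: "F facet_of K \<Longrightarrow> F \<subseteq> K"
  by (rule facet_of_imp_subset)

lemma normal_facet: "F facet_of K \<Longrightarrow> x \<in> F \<Longrightarrow> normal K F \<bullet> x = offset K F"
  using facet_eq by blast

end

section \<open>The surface measure of a facet\<close>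

definition facet_proj :: "(real^'n) set \<Rightarrow> (real^'n) set \<Rightarrow> real^'n \<Rightarrow> real^'n" where
  "facet_proj K F y = y - (normal K F \<bullet> y - offset K F) *\<^sub>R normal K F"

definition cylinder :: "(real^'n) set \<Rightarrow> (real^'n) set \<Rightarrow> (real^'n) set" where
  "cylinder K F = {x + t *\<^sub>R normal K F | x t. x \<in> F \<and> 0 \<le> t \<and> t \<le> 1}"

context full_polytope
begin

lemma mem_cylinder_iff:
  assumes "F facet_of K"
  shows "y \<in> cylinder K F \<longleftrightarrow> facet_proj K F y \<in> F \<and> 0 \<le> normal K F \<bullet> y - offset K F \<and> normal K F \<bullet> y - offset K F \<le> 1"
proof
  assume "y \<in> cylinder K F"
  then obtain x t where y: "y = x + t *\<^sub>R normal K F" "x \<in> F" "0 \<le> t" "t \<le> 1"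
    unfolding cylinder_def by blast
  then have "normal K F \<bullet> y - offset K F = t"
    using normal_facet[OF assms] normal_inner_self[OF assms] by (simp add: inner_add_right)
  then show "facet_proj K F y \<in> F \<and> 0 \<le> normal K F \<bullet> y - offset K F \<and> normal K F \<bullet> y - offset K F \<le> 1"
    using y by (simp add: facet_proj_def)
next
  assume *: "facet_proj K F y \<in> F \<and> 0 \<le> normal K F \<bullet> y - offset K F \<and> normal K F \<bullet> y - offset K F \<le> 1"
  have "y = facet_proj K F y + (normal K F \<bullet> y - offset K F) *\<^sub>R normal K F"
    by (simp add: facet_proj_def)
  with * show "y \<in> cylinder K F" unfolding cylinder_def by blast
qed

lemma compact_cylinder:
  assumes "F facet_of K" shows "compact (cylinder K F)"
proof -
  have "cylinder K F = (\<lambda>p. fst p + snd p *\<^sub>R normal K F) ` (F \<times> {0..1})"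
    unfolding cylinder_def by (force simp: image_def)
  also have "compact \<dots>"
    by (intro compact_continuous_image continuous_intros compact_Times compact_facet[OF assms] compact_Icc)
  finally show ?thesis .
qed

lemma facet_measure_eq:
  assumes "F facet_of K"
  shows "facet_measure (normal K F) F =
    distr (restrict_space lborel (cylinder K F)) (restrict_space borel F) (facet_proj K F)"
  unfolding facet_measure_def facet_proj_def cylinder_def offset_def
  by (simp add: inner_diff_right inner_commute[of _ "normal K F"])

lemma space_facet_measure: "F facet_of K \<Longrightarrow> space (facet_measure (normal K F) F) = F"
  by (simp add: facet_measure_eq space_restrict_space)

lemma facet_proj_measurable:
  assumes "F facet_of K"
  shows "facet_proj K F \<in> restrict_space lborel (cylinder K F) \<rightarrow>\<^sub>M restrict_space borel F"
proof (rule measurable_restrict_space3)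
  show "facet_proj K F \<in> lborel \<rightarrow>\<^sub>M borel"
    unfolding facet_proj_def by (auto intro!: borel_measurable_continuous_onI continuous_intros)
  show "facet_proj K F \<in> cylinder K F \<rightarrow> F" using mem_cylinder_iff[OF assms] by blast
qed

text \<open>Unfolds surface integrals into volume integrals over the cylinder, the form in which
  they arise as limits of rescaled layer integrals.\<close>

lemma facet_integral:
  fixes g :: "real^'n \<Rightarrow> real"
  assumes F: "F facet_of K" and g: "continuous_on F g"
  shows "integrable (facet_measure (normal K F) F) g"
    and "(LINT x|facet_measure (normal K F) F. g x)
      = (LINT y|lborel. indicator (cylinder K F) y * g (facet_proj K F y))"
    and "(\<lambda>y. indicator (cylinder K F) y * g (facet_proj K F y)) \<in> borel_measurable borel"
proof -
  have cyl: "cylinder K F \<in> sets lborel" using compact_cylinder[OF F] by (simp add: borel_compact)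
  have gm: "g \<in> borel_measurable (restrict_space borel F)"
    by (rule borel_measurable_continuous_on_restrict[OF g])
  have "continuous_on (cylinder K F) (\<lambda>y. g (facet_proj K F y))"
    unfolding facet_proj_def
    by (rule continuous_on_compose2[OF g]) (auto intro!: continuous_intros simp: mem_cylinder_iff[OF F] facet_proj_def)
  then have "integrable lborel (\<lambda>y. indicator (cylinder K F) y *\<^sub>R g (facet_proj K F y))"
    by (intro borel_integrable_compact compact_cylinder[OF F])
  then have int: "integrable lborel (\<lambda>y. indicator (cylinder K F) y * g (facet_proj K F y))" by simp
  then show "(\<lambda>y. indicator (cylinder K F) y * g (facet_proj K F y)) \<in> borel_measurable borel"
    using borel_measurable_integrable by simp
  show "integrable (facet_measure (normal K F) F) g"
    unfolding facet_measure_eq[OF F]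
    by (subst integrable_distr_eq[OF facet_proj_measurable[OF F] gm])
      (use cyl int in \<open>simp add: integrable_restrict_space\<close>)
  show "(LINT x|facet_measure (normal K F) F. g x)
      = (LINT y|lborel. indicator (cylinder K F) y * g (facet_proj K F y))"
    unfolding facet_measure_eq[OF F]
    by (subst integral_distr[OF facet_proj_measurable[OF F] gm])
      (use cyl in \<open>simp add: integral_restrict_space\<close>)
qed

end

section \<open>Affine changes of variables\<close>

lemma lborel_integral_linear:
  fixes f :: "real^'n::{finite,wellorder} \<Rightarrow> real"
  assumes L: "linear L" "det (matrix L) \<noteq> 0" and f: "integrable lborel f"
  shows "integrable lborel (\<lambda>y. f (L y))"
    and "(LINT x|lborel. f x) = \<bar>det (matrix L)\<bar> * (LINT y|lborel. f (L y))"
proof -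
  have fb: "f \<in> borel_measurable borel" using f borel_measurable_integrable by simp
  have Lc: "L \<in> borel_measurable borel"
    using L(1) by (intro borel_measurable_continuous_onI linear_continuous_on linear_conv_bounded_linear[THEN iffD1])
  have fLb: "(\<lambda>y. f (L y)) \<in> borel_measurable borel" using measurable_compose[OF Lc fb] .
  \<comment> \<open>The change-of-variables rule concerns vector-valued functions; a scalar function
    is carried along one coordinate vector and read off again as its coefficient.\<close>
  let ?e = "axis undefined 1 :: real^'n::_"
  have abs_iff: "(\<lambda>x. g x *\<^sub>R ?e) absolutely_integrable_on UNIV \<longleftrightarrow> integrable lborel g"
    if "g \<in> borel_measurable borel" for g :: "real^'n::_ \<Rightarrow> real"
  proof
    assume "(\<lambda>x. g x *\<^sub>R ?e) absolutely_integrable_on UNIV"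
    then have "integrable lebesgue (\<lambda>x. g x *\<^sub>R ?e)" by (simp add: set_integrable_def)
    from integrable_inner_left[OF this, of ?e] have "integrable lebesgue g"
      by (simp add: inner_axis_axis)
    then show "integrable lborel g" using that by (simp add: integrable_completion)
  next
    assume "integrable lborel g"
    then have "integrable lebesgue g" using that by (simp add: integrable_completion)
    then have "integrable lebesgue (\<lambda>x. g x *\<^sub>R ?e)" by simp
    then show "(\<lambda>x. g x *\<^sub>R ?e) absolutely_integrable_on UNIV" by (simp add: set_integrable_def)
  qed
  have int_eq: "integral UNIV (\<lambda>x. g x *\<^sub>R ?e) = (LINT x|lborel. g x) *\<^sub>R ?e"
    if "integrable lborel g" for g :: "real^'n::_ \<Rightarrow> real"
  proof -
    have "g \<in> borel_measurable borel" using that borel_measurable_integrable by simp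
    then have "integral UNIV (\<lambda>x. g x *\<^sub>R ?e) = (LINT x|lebesgue. g x *\<^sub>R ?e)"
      using set_lebesgue_integral_eq_integral(2)[of UNIV "\<lambda>x. g x *\<^sub>R ?e"] abs_iff that
      by (simp add: set_lebesgue_integral_def)
    also have "\<dots> = (LINT x|lborel. g x *\<^sub>R ?e)"
      using \<open>g \<in> borel_measurable borel\<close> by (intro integral_completion) simp
    finally show ?thesis using that by simp
  qed
  have surj: "L ` UNIV = UNIV"
    using L det_nz_iff_inj linear_injective_imp_surjective by metis
  have "(\<lambda>x. \<bar>det (matrix L)\<bar> *\<^sub>R (f (L x) *\<^sub>R ?e)) absolutely_integrable_on UNIV \<and>
           integral UNIV (\<lambda>x. \<bar>det (matrix L)\<bar> *\<^sub>R (f (L x) *\<^sub>R ?e)) = (LINT x|lborel. f x) *\<^sub>R ?e"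
    by (rule iffD2[OF has_absolute_integral_change_of_variables_linear[OF L(1)]])
      (simp add: surj abs_iff[OF fb] f int_eq[OF f])
  then have a: "(\<lambda>x. (\<bar>det (matrix L)\<bar> * f (L x)) *\<^sub>R ?e) absolutely_integrable_on UNIV"
    and i: "integral UNIV (\<lambda>x. (\<bar>det (matrix L)\<bar> * f (L x)) *\<^sub>R ?e) = (LINT x|lborel. f x) *\<^sub>R ?e"
    by simp_all
  have a': "integrable lborel (\<lambda>x. \<bar>det (matrix L)\<bar> * f (L x))"
    using abs_iff[THEN iffD1, OF _ a] fLb by simp
  from a' show "integrable lborel (\<lambda>y. f (L y))" using L(2) by simp
  have "(LINT x|lborel. \<bar>det (matrix L)\<bar> * f (L x)) *\<^sub>R ?e = (LINT x|lborel. f x) *\<^sub>R ?e"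
    using int_eq[OF a'] i by simp
  then have "(LINT x|lborel. \<bar>det (matrix L)\<bar> * f (L x)) = (LINT x|lborel. f x)"
    by (simp add: axis_eq_0_iff)
  then show "(LINT x|lborel. f x) = \<bar>det (matrix L)\<bar> * (LINT y|lborel. f (L y))" by simp
qed

lemma lborel_integral_translation:
  fixes f :: "'a::euclidean_space \<Rightarrow> real"
  assumes f: "integrable lborel f"
  shows "integrable lborel (\<lambda>y. f (c + y))" and "(LINT x|lborel. f x) = (LINT y|lborel. f (c + y))"
proof -
  have fb: "f \<in> borel_measurable borel" using f borel_measurable_integrable by simp
  have m: "(+) c \<in> lborel \<rightarrow>\<^sub>M borel" by simp
  show "integrable lborel (\<lambda>y. f (c + y))"
    using integrable_distr_eq[OF m fb] f by (simp add: lborel_distr_plus)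
  show "(LINT x|lborel. f x) = (LINT y|lborel. f (c + y))"
    using integral_distr[OF m fb] by (simp add: lborel_distr_plus)
qed

text \<open>Rotating n onto a coordinate axis makes the map diagonal, with 1 - c in one place and
  ones elsewhere; conjugation leaves the determinant unchanged.\<close>

lemma det_rank_one_update:
  fixes n :: "real^'n"
  assumes n: "norm n = 1"
  shows "det (matrix (\<lambda>v. v - c *\<^sub>R ((n \<bullet> v) *\<^sub>R n))) = 1 - c"
proof -
  fix k :: 'n
  let ?e = "axis k 1 :: real^'n"
  let ?T = "\<lambda>v. v - c *\<^sub>R ((n \<bullet> v) *\<^sub>R n)"
  obtain f where f: "orthogonal_transformation f" "f n = ?e"
    using orthogonal_transformation_exists_1[OF n, of ?e] norm_axis_1 by metis
  have lf: "linear f" using f(1) orthogonal_transformation_linear by blast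
  obtain g where g: "linear g" "\<And>x. g (f x) = x" "\<And>x. f (g x) = x"
  proof
    note bij = orthogonal_transformation_bij[OF f(1)]
    show "linear (inv f)"
      using orthogonal_transformation_inv[OF f(1)] orthogonal_transformation_linear by blast
    show "inv f (f x) = x" for x using bij_is_inj[OF bij] by simp
    show "f (inv f x) = x" for x using bij_is_surj[OF bij] by (rule surj_f_inv_f)
  qed
  have lT: "linear ?T"
    by (intro linearI) (simp_all add: inner_add_right scaleR_add_left scaleR_add_right scaleR_diff_right mult_ac)
  have eq: "f (?T (g v)) = v - c *\<^sub>R ((v $ k) *\<^sub>R ?e)" for v
  proof -
    have "n \<bullet> g v = f n \<bullet> f (g v)"
      using f(1) by (simp add: orthogonal_transformation_def)
    also have "\<dots> = v $ k" by (simp add: f(2) g(3) inner_axis')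
    finally show ?thesis by (simp add: linear_diff[OF lf] linear_scale[OF lf] g(3) f(2))
  qed
  let ?D = "\<lambda>v. v - c *\<^sub>R ((v $ k) *\<^sub>R ?e)"
  have D: "?D = f \<circ> (?T \<circ> g)" using eq by (auto simp: fun_eq_iff)
  have "det (matrix f) * det (matrix g) = 1"
  proof -
    have "f \<circ> g = id" using g by auto
    then have "matrix f ** matrix g = mat 1"
      using matrix_compose[OF g(1) lf] by (simp add: matrix_id_mat_1)
    then show ?thesis by (metis det_I det_mul)
  qed
  moreover have "det (matrix ?D) = det (matrix f) * (det (matrix ?T) * det (matrix g))"
    unfolding D matrix_compose[OF linear_compose[OF g(1) lT] lf] matrix_compose[OF g(1) lT] det_mul ..
  ultimately have "det (matrix ?T) = det (matrix ?D)" by (simp add: algebra_simps)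
  also have "\<dots> = (\<Prod>i\<in>UNIV. matrix ?D $ i $ i)"
    by (rule det_diagonal) (auto simp: matrix_def axis_def)
  also have "\<dots> = (\<Prod>i\<in>UNIV. if i = k then 1 - c else 1)"
    by (intro prod.cong) (auto simp: matrix_def axis_def)
  also have "\<dots> = 1 - c" by simp
  finally show ?thesis .
qed

section \<open>Cutoff functions\<close>

text \<open>A primitive of the positive part, hence continuously differentiable. Test functions are
  only required to be of class C1, so cutoffs and mollifiers alike can be built from this one
  function.\<close>

definition sqp :: "real \<Rightarrow> real" where "sqp s = (max 0 s)\<^sup>2 / 2"

lemma sqp_has_derivative: "(sqp has_real_derivative max 0 s) (at s)"
proof (cases "s = 0")
  case True
  have "((\<lambda>h. sqp h / h) \<longlongrightarrow> 0) (at 0)"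
  proof (rule tendsto_sandwich)
    show "eventually (\<lambda>h. - \<bar>h\<bar> \<le> sqp h / h) (at (0::real))" "eventually (\<lambda>h. sqp h / h \<le> \<bar>h\<bar>) (at (0::real))"
      by (auto simp: sqp_def max_def power2_eq_square intro!: always_eventually)
    show "((\<lambda>h::real. - \<bar>h\<bar>) \<longlongrightarrow> 0) (at 0)" "((\<lambda>h::real. \<bar>h\<bar>) \<longlongrightarrow> 0) (at 0)"
      by (auto intro!: tendsto_eq_intros)
  qed
  then show ?thesis using True by (simp add: DERIV_def sqp_def)
next
  case False
  show ?thesis
  proof (cases "s > 0")
    case True
    have "((\<lambda>s. s\<^sup>2 / 2) has_real_derivative s) (at s)" by (auto intro!: derivative_eq_intros)
    then have "(sqp has_real_derivative s) (at s)"
      by (rule DERIV_cong_ev[THEN iffD1, rotated -1])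
        (use True eventually_nhds_in_open[of "{0<..}" s] in \<open>auto simp: sqp_def elim!: eventually_mono\<close>)
    then show ?thesis using True by simp
  next
    case 2: False
    have "((\<lambda>s. 0) has_real_derivative 0) (at s)" by (auto intro!: derivative_eq_intros)
    then have "(sqp has_real_derivative 0) (at s)"
      by (rule DERIV_cong_ev[THEN iffD1, rotated -1])
        (use 2 False eventually_nhds_in_open[of "{..<0}" s] in \<open>auto simp: sqp_def elim!: eventually_mono\<close>)
    then show ?thesis using 2 by simp
  qed
qed

lemmas sqp_has_derivative' [derivative_intros] = DERIV_chain2[OF sqp_has_derivative]

text \<open>A continuously differentiable substitute for \<open>min s 1\<close> that vanishes near zero, so that cutting off
  with it produces compact supports.\<close>

definition ramp :: "real \<Rightarrow> real \<Rightarrow> real" where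
  "ramp \<delta> s = (sqp (s - \<delta>) - sqp (s - 2 * \<delta>) - sqp (s - 1) + sqp (s - (1 + \<delta>))) / \<delta>"

text \<open>A trapezoid of height one: for small \<delta> it rises on [\<delta>, 2\<delta>], is
  constant up to 1 and falls to zero at 1 + \<delta>. As \<delta> tends to 0 it approaches the
  indicator of the unit interval.\<close>

definition ramp' :: "real \<Rightarrow> real \<Rightarrow> real" where
  "ramp' \<delta> s = (max 0 (s - \<delta>) - max 0 (s - 2 * \<delta>) - max 0 (s - 1) + max 0 (s - (1 + \<delta>))) / \<delta>"

lemma ramp_has_derivative: "(ramp \<delta> has_real_derivative ramp' \<delta> s) (at s)"
  unfolding ramp_def[abs_def] ramp'_def by (auto intro!: derivative_eq_intros simp: divide_inverse)

lemma continuous_ramp': "continuous_on S (ramp' \<delta>)"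
  unfolding ramp'_def[abs_def] by (cases "\<delta> = 0") (auto intro!: continuous_intros)

lemma continuous_ramp: "continuous_on S (ramp \<delta>)"
  using ramp_has_derivative DERIV_isCont continuous_at_imp_continuous_on by blast

context
  fixes \<delta> :: real assumes \<delta>: "0 < \<delta>" "2 * \<delta> \<le> 1"
begin

lemma ramp'_nonneg: "0 \<le> ramp' \<delta> s"
proof -
  have "0 \<le> max 0 (s - \<delta>) - max 0 (s - 2 * \<delta>) - max 0 (s - 1) + max 0 (s - (1 + \<delta>))"
    using \<delta> unfolding max_def by (auto split: if_splits)
  then show ?thesis using \<delta> by (simp add: ramp'_def)
qed

lemma ramp'_le: "ramp' \<delta> s \<le> 1"
proof -
  have "max 0 (s - \<delta>) - max 0 (s - 2 * \<delta>) - max 0 (s - 1) + max 0 (s - (1 + \<delta>)) \<le> \<delta>"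
    using \<delta> unfolding max_def by (auto split: if_splits)
  then show ?thesis using \<delta> by (simp add: ramp'_def)
qed

lemma ramp'_eq_0: "s \<le> \<delta> \<or> 1 + \<delta> \<le> s \<Longrightarrow> ramp' \<delta> s = 0"
  using \<delta> by (auto simp: ramp'_def max_def)

lemma ramp'_eq_1: "2 * \<delta> \<le> s \<Longrightarrow> s \<le> 1 \<Longrightarrow> ramp' \<delta> s = 1"
  using \<delta> by (auto simp: ramp'_def max_def)

lemma ramp_eq_0: "s \<le> \<delta> \<Longrightarrow> ramp \<delta> s = 0"
  using \<delta> by (auto simp: ramp_def sqp_def max_def)

text \<open>The trapezoid has area 1 - \<delta>, so the plateau of its primitive lies slightly below
  one.\<close>

lemma ramp_eq: "1 + \<delta> \<le> s \<Longrightarrow> ramp \<delta> s = 1 - \<delta>"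
  using \<delta> by (auto simp: ramp_def sqp_def max_def field_simps power2_eq_square)

lemma ramp_mono: "s \<le> t \<Longrightarrow> ramp \<delta> s \<le> ramp \<delta> t"
  using DERIV_nonneg_imp_nondecreasing[of s t "ramp \<delta>"] ramp_has_derivative ramp'_nonneg by blast

lemma ramp_nonneg: "0 \<le> ramp \<delta> s"
  using ramp_mono[of "min s \<delta>" s] ramp_eq_0[of "min s \<delta>"] by simp

lemma ramp_le: "ramp \<delta> s \<le> 1"
  using ramp_mono[of s "max s (1 + \<delta>)"] ramp_eq[of "max s (1 + \<delta>)"] \<delta> by simp

end

section \<open>The divergence theorem on a polytope\<close>

lemma AE_not_hyperplane:
  fixes a :: "'a::euclidean_space"
  assumes "a \<noteq> 0 \<or> b \<noteq> 0" shows "AE x in lborel. a \<bullet> x \<noteq> b"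
proof -
  have "{x. a \<bullet> x = b} \<in> null_sets lebesgue"
    using negligible_hyperplane[OF assms] negligible_iff_null_sets by blast
  then have "{x. a \<bullet> x = b} \<in> null_sets lborel"
    by (subst (asm) null_sets_completion_iff) (simp_all add: closed_hyperplane)
  then show ?thesis by (rule AE_I') auto
qed

lemma lebesgue_on_integral_eq_lborel:
  fixes f :: "'a::euclidean_space \<Rightarrow> real"
  assumes "S \<in> sets borel" "(\<lambda>x. indicator S x * f x) \<in> borel_measurable borel"
  shows "(LINT x|lebesgue_on S. f x) = (LINT x|lborel. indicator S x * f x)"
    and "integrable (lebesgue_on S) f \<longleftrightarrow> integrable lborel (\<lambda>x. indicator S x * f x)"
  using assms by (simp_all add: integral_restrict_space integrable_restrict_space integral_completion integrable_completion)

text \<open>The library has the determinant rule for linear changes of variables only for well-ordered index types.\<close>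

locale lebesgue_polytope = full_polytope K for K :: "(real^'n::{finite,wellorder}) set"
begin

text \<open>Signed distance to the plane of F, positive on the side of K.\<close>

definition gap :: "((real, 'n) vec) set \<Rightarrow> (real, 'n) vec \<Rightarrow> real" where
  "gap F x = offset K F - normal K F \<bullet> x"

text \<open>The reciprocal of the layer thickness. Starting at 2 keeps
  \<open>2 * (1 / wid N) \<le> 1\<close>, the ordering of the breakpoints that the lemmas on
  \<open>ramp\<close> require.\<close>

definition wid :: "nat \<Rightarrow> real" where "wid N = real N + 2"

text \<open>One parameter governs both scales: \<open>1 / wid N\<close> is the thickness of the
  layer and, in the rescaled variable, the smoothing of the ramp.\<close>

definition cut :: "nat \<Rightarrow> ((real, 'n) vec) set \<Rightarrow> (real, 'n) vec \<Rightarrow> real" where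
  "cut N F x = ramp (1 / wid N) (wid N * gap F x)"

definition cut' :: "nat \<Rightarrow> ((real, 'n) vec) set \<Rightarrow> (real, 'n) vec \<Rightarrow> real" where
  "cut' N F x = ramp' (1 / wid N) (wid N * gap F x)"

lemma wid: "wid N > 0" "0 < 1 / wid N" "2 * (1 / wid N) \<le> 1"
  by (auto simp: wid_def field_simps)

lemma wid_at_top: "filterlim wid at_top sequentially"
  using filterlim_tendsto_add_at_top[OF tendsto_const[of 2] filterlim_real_sequentially]
  by (simp add: wid_def[abs_def] add.commute)

lemma filterlim_wid_inverse: "(\<lambda>N. t / wid N) \<longlonglongrightarrow> 0"
  by (rule real_tendsto_divide_at_top[OF tendsto_const wid_at_top])

lemma eventually_wid: "e > 0 \<Longrightarrow> eventually (\<lambda>N. t / wid N < e) sequentially"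
  using filterlim_wid_inverse[of t] by (rule order_tendstoD)

lemma continuous_gap: "continuous_on S (gap F)"
  unfolding gap_def by (intro continuous_intros)

lemma continuous_cut: "continuous_on S (cut N F)"
  unfolding cut_def by (intro continuous_on_compose2[OF continuous_ramp[of UNIV]] continuous_intros continuous_gap) auto

lemma continuous_cut': "continuous_on S (cut' N F)"
  unfolding cut'_def by (intro continuous_on_compose2[OF continuous_ramp'[of UNIV]] continuous_intros continuous_gap) auto

lemma cut_bounds: "0 \<le> cut N F x" "cut N F x \<le> 1" "0 \<le> cut' N F x" "cut' N F x \<le> 1"
  unfolding cut_def cut'_def using ramp_nonneg ramp_le ramp'_nonneg ramp'_le wid by auto

lemma prod_cut_bounds: "0 \<le> (\<Prod>F\<in>A. cut N F x)" "(\<Prod>F\<in>A. cut N F x) \<le> 1"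
  using cut_bounds by (auto intro: prod_nonneg prod_le_1)

lemma mem_K_gap: "x \<in> K \<longleftrightarrow> (\<forall>F. F facet_of K \<longrightarrow> 0 \<le> gap F x)"
  using mem_iff by (auto simp: gap_def)

lemma mem_interior_gap: "x \<in> interior K \<longleftrightarrow> (\<forall>F. F facet_of K \<longrightarrow> 0 < gap F x)"
  using mem_interior_iff by (auto simp: gap_def)

text \<open>The evaluation points may move with N: positive limits of their gaps push every rescaled
  gap beyond the ramp, where the factor is \<open>1 - 1 / wid N\<close>.\<close>

lemma prod_cut_tendsto:
  assumes "finite A"
    and "\<And>F. F \<in> A \<Longrightarrow> (\<lambda>N. gap F (y N)) \<longlonglongrightarrow> g F" "\<And>F. F \<in> A \<Longrightarrow> 0 < g F"
  shows "(\<lambda>N. \<Prod>F\<in>A. cut N F (y N)) \<longlonglongrightarrow> 1"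
proof -
  have "(\<lambda>N. cut N F (y N)) \<longlonglongrightarrow> 1" if "F \<in> A" for F
  proof (rule Lim_transform_eventually)
    have "filterlim (\<lambda>N. gap F (y N) * wid N) at_top sequentially"
      using assms that by (intro filterlim_tendsto_pos_mult_at_top[OF _ _ wid_at_top])
    then have "eventually (\<lambda>N. gap F (y N) * wid N \<ge> 2) sequentially"
      by (simp add: filterlim_at_top)
    then show "eventually (\<lambda>N. 1 - 1 / wid N = cut N F (y N)) sequentially"
    proof eventually_elim
      case (elim N)
      then have "1 + 1 / wid N \<le> wid N * gap F (y N)" using wid(3)[of N] by (simp add: mult.commute)
      then show ?case unfolding cut_def using ramp_eq[OF wid(2,3)] by simp
    qed
    show "(\<lambda>N. 1 - 1 / wid N) \<longlonglongrightarrow> 1"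
      using tendsto_diff[OF tendsto_const[of 1] filterlim_wid_inverse[of 1]] by simp
  qed
  then have "(\<lambda>N. \<Prod>F\<in>A. cut N F (y N)) \<longlonglongrightarrow> (\<Prod>F\<in>A. 1)" by (intro tendsto_prod)
  then show ?thesis by simp
qed

lemma bounded_on_K:
  fixes h :: "(real, 'n) vec \<Rightarrow> real"
  assumes "continuous_on K h"
  obtains B where "\<And>x. x \<in> K \<Longrightarrow> \<bar>h x\<bar> \<le> B" "B \<ge> 0"
proof -
  have "bounded (h ` K)"
    using compact_continuous_image[OF assms compact] compact_imp_bounded by blast
  then obtain B where B: "\<And>x. x \<in> K \<Longrightarrow> \<bar>h x\<bar> \<le> B" by (auto simp: bounded_iff)
  have "B \<ge> 0" using interior_ne interior_subset[of K] B abs_ge_zero order_trans by (metis all_not_in_conv subsetD)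
  with B show ?thesis using that by blast
qed

lemma sets_K [measurable]: "K \<in> sets borel" "interior K \<in> sets borel"
  using closed by auto

lemma integrable_cball: "integrable lborel (indicator (cball a R) :: (real, 'n) vec \<Rightarrow> real)"
  using emeasure_bounded_finite[of "cball a R"] by (simp add: integrable_real_indicator)

text \<open>Maps the cylinder of height one erected over the facet \<open>F\<close> affinely onto the layer of thickness
  \<open>1 / wid N\<close> on the inner side of \<open>F\<close>.\<close>

definition squash :: "nat \<Rightarrow> ((real, 'n) vec) set \<Rightarrow> (real, 'n) vec \<Rightarrow> (real, 'n) vec" where
  "squash N F y = facet_proj K F y - ((normal K F \<bullet> y - offset K F) / wid N) *\<^sub>R normal K F"

text \<open>Height above F in the cylinder becomes the rescaled gap in the layer, so along
  \<open>squash\<close> the factor \<open>cut'\<close> is a trapezoid in the height.\<close>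

lemma gap_squash:
  assumes "F facet_of K" shows "wid N * gap F (squash N F y) = normal K F \<bullet> y - offset K F"
proof -
  have "normal K F \<bullet> squash N F y = offset K F - (normal K F \<bullet> y - offset K F) / wid N"
    by (simp add: squash_def facet_proj_def inner_diff_right normal_inner_self[OF assms])
  then show ?thesis using wid(1)[of N] by (simp add: gap_def)
qed

lemma squash_tendsto: "(\<lambda>N. squash N F y) \<longlonglongrightarrow> facet_proj K F y"
proof -
  have "(\<lambda>N. facet_proj K F y - ((normal K F \<bullet> y - offset K F) / wid N) *\<^sub>R normal K F)
      \<longlonglongrightarrow> facet_proj K F y - 0 *\<^sub>R normal K F"
    by (intro tendsto_intros filterlim_wid_inverse)
  then show ?thesis by (simp add: squash_def)
qed

text \<open>The normal direction is reversed and scaled by \<open>1 / wid N\<close> while tangential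
  directions stay fixed; the linear part is a rank-one update of the identity with determinant
  \<open>- (1 / wid N)\<close>.\<close>

lemma integral_squash:
  assumes F: "F facet_of K" and f: "integrable lborel f"
  shows "integrable lborel (\<lambda>y. f (squash N F y))"
    and "(LINT x|lborel. f x) = (LINT y|lborel. f (squash N F y)) / wid N"
proof -
  \<comment> \<open>A point at height t has to end up at height -t / wid, so (1 + 1 / wid) t times
    the normal is subtracted.\<close>
  let ?n = "normal K F" and ?c = "1 + 1 / wid N"
  let ?L = "\<lambda>v. v - ?c *\<^sub>R ((?n \<bullet> v) *\<^sub>R ?n)"
  have lin: "linear ?L"
    by (intro linearI) (simp_all add: inner_add_right scaleR_add_left scaleR_add_right scaleR_diff_right mult_ac)
  have det: "det (matrix ?L) = - (1 / wid N)" using det_rank_one_update[OF norm_normal[OF F]] by simp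
  have det0: "det (matrix ?L) \<noteq> 0" using det wid(1)[of N] by simp
  have eq: "(?c * offset K F) *\<^sub>R ?n + ?L y = squash N F y" for y
  proof -
    have "squash N F y = y - ((?c * (?n \<bullet> y - offset K F)) *\<^sub>R ?n)"
      by (simp add: squash_def facet_proj_def scaleR_add_left[symmetric] diff_diff_eq distrib_right del: scaleR_add_left)
    also have "\<dots> = (?c * offset K F) *\<^sub>R ?n + ?L y"
      by (simp add: scaleR_diff_left right_diff_distrib)
    finally show ?thesis by simp
  qed
  note tr = lborel_integral_translation[OF f, of "(?c * offset K F) *\<^sub>R ?n"]
  note li = lborel_integral_linear[OF lin det0 tr(1)]
  show "integrable lborel (\<lambda>y. f (squash N F y))" using li(1) unfolding eq .
  have "(LINT x|lborel. f x) = \<bar>det (matrix ?L)\<bar> * (LINT y|lborel. f (squash N F y))"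
    using tr(2) li(2) unfolding eq by simp
  then show "(LINT x|lborel. f x) = (LINT y|lborel. f (squash N F y)) / wid N"
    unfolding det using wid(1)[of N] by simp
qed

lemma boundary_layer_measurable:
  fixes h :: "(real, 'n) vec \<Rightarrow> real"
  assumes h: "continuous_on K h"
  shows "(\<lambda>x. indicator (interior K) x * (h x * cut' N F x * (\<Prod>F'\<in>A. cut N F' x))) \<in> borel_measurable borel"
    and "(\<lambda>x. indicator (interior K) x * h x) \<in> borel_measurable borel"
proof -
  have "(\<lambda>x. indicator K x *\<^sub>R h x) \<in> borel_measurable borel"
    using sets_K h by (intro borel_measurable_continuous_on_indicator)
  then have "(\<lambda>x. indicator (interior K) x * (indicator K x *\<^sub>R h x)) \<in> borel_measurable borel"
    by measurable
  moreover have "(\<lambda>x. indicator (interior K) x * (indicator K x *\<^sub>R h x)) = (\<lambda>x. indicator (interior K) x * h x)"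
    using interior_subset[of K] by (auto simp: indicator_def fun_eq_iff)
  ultimately show *: "(\<lambda>x. indicator (interior K) x * h x) \<in> borel_measurable borel" by simp
  have [measurable]: "cut N F \<in> borel_measurable borel" "cut' N F \<in> borel_measurable borel" for F
    using continuous_cut continuous_cut' by (auto intro!: borel_measurable_continuous_onI)
  have "(\<lambda>x. (indicator (interior K) x * h x) * (cut' N F x * (\<Prod>F'\<in>A. cut N F' x))) \<in> borel_measurable borel"
    using * by measurable
  then show "(\<lambda>x. indicator (interior K) x * (h x * cut' N F x * (\<Prod>F'\<in>A. cut N F' x))) \<in> borel_measurable borel"
    by (simp add: mult_ac)
qed

lemma boundary_layer_bound:
  assumes B: "\<And>x. x \<in> K \<Longrightarrow> \<bar>h x\<bar> \<le> B" and "x \<in> interior K"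
  shows "\<bar>h x * cut' N F x * (\<Prod>F'\<in>A. cut N F' x)\<bar> \<le> B"
proof -
  have "\<bar>h x * cut' N F x * (\<Prod>F'\<in>A. cut N F' x)\<bar> = \<bar>h x\<bar> * cut' N F x * (\<Prod>F'\<in>A. cut N F' x)"
    using cut_bounds prod_cut_bounds by (simp add: abs_mult)
  also have "\<dots> \<le> \<bar>h x\<bar> * 1 * 1"
    using cut_bounds prod_cut_bounds by (intro mult_mono) auto
  also have "\<dots> \<le> B" using B assms(2) interior_subset by auto
  finally show ?thesis .
qed

text \<open>Pulling back by \<open>squash\<close> absorbs the factor \<open>wid N\<close> into the
  Jacobian. The trapezoid then tends to the indicator of heights in [0, 1], and the interior
  indicator with the remaining cuts to that of points projecting into F; dominated convergence
  yields the cylinder form of the surface integral.\<close>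

lemma boundary_layer_limit:
  assumes F: "F facet_of K" and h: "continuous_on K h"
  shows "(\<lambda>N. wid N * (LINT x|lborel. indicator (interior K) x *
      (h x * cut' N F x * (\<Prod>F'\<in>{F. F facet_of K} - {F}. cut N F' x))))
    \<longlonglongrightarrow> (LINT x|facet_measure (normal K F) F. h x)"
proof -
  let ?n = "normal K F" and ?A = "{F. F facet_of K} - {F}"
  let ?g = "\<lambda>N x. indicator (interior K) x * (h x * cut' N F x * (\<Prod>F'\<in>?A. cut N F' x))"
  have finA: "finite ?A" using finite_facets by simp
  obtain B where B: "\<And>x. x \<in> K \<Longrightarrow> \<bar>h x\<bar> \<le> B" "B \<ge> 0"
    using bounded_on_K[OF h] by blast
  obtain R where R: "\<And>x. x \<in> K \<Longrightarrow> norm x \<le> R"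
    using compact_imp_bounded[OF compact] by (auto simp: bounded_iff)
  note gm = boundary_layer_measurable(1)[OF h, of _ F ?A]
  have gB: "\<bar>?g N x\<bar> \<le> B" for N x
    using boundary_layer_bound[where h = h and B = B and x = x and N = N and F = F and A = ?A, OF B(1)] B(2) by (auto simp: indicator_def)
  have gint: "integrable lborel (?g N)" for N
  proof (rule Bochner_Integration.integrable_bound)
    show "integrable lborel (\<lambda>x. B * indicator (cball (0 :: (real, 'n) vec) R) x)" using integrable_cball by simp
    show "AE x in lborel. norm (?g N x) \<le> norm (B * indicator (cball (0 :: (real, 'n) vec) R) x)"
    proof (rule AE_I2)
      fix x
      show "norm (?g N x) \<le> norm (B * indicator (cball (0 :: (real, 'n) vec) R) x)"
        using gB[of x N] R[of x] interior_subset[of K] B(2) by (auto simp: indicator_def)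
    qed
  qed (use gm in simp)
  have hF: "continuous_on F h" using h continuous_on_subset facet_subset[OF F] by blast
  have eq: "wid N * (LINT x|lborel. ?g N x) = (LINT y|lborel. ?g N (squash N F y))" for N
    using integral_squash(2)[OF F gint[of N], of N] wid(1)[of N] by simp
  \<comment> \<open>Where the trapezoid is nonzero the height t is at most 2, and y differs from a
    point of K by t + t / wid \<le> 4 in norm: one dominating ball for all N.\<close>
  have supp: "norm y \<le> R + 4" if "?g N (squash N F y) \<noteq> 0" for N y
  proof -
    let ?t = "?n \<bullet> y - offset K F"
    have i: "squash N F y \<in> interior K" and c: "cut' N F (squash N F y) \<noteq> 0"
      using that by (auto simp: indicator_def split: if_splits)
    have "ramp' (1 / wid N) ?t \<noteq> 0" using c unfolding cut'_def gap_squash[OF F] .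
    then have "\<not> (?t \<le> 1 / wid N \<or> 1 + 1 / wid N \<le> ?t)"
      using ramp'_eq_0[OF wid(2,3)] by blast
    then have t: "0 \<le> ?t" "?t \<le> 2" using wid(2,3)[of N] by (simp_all only: not_le de_Morgan_disj) linarith+
    have y: "y = squash N F y + (?t + ?t / wid N) *\<^sub>R ?n"
      by (simp add: squash_def facet_proj_def scaleR_add_left)
    have "norm y \<le> norm (squash N F y) + norm ((?t + ?t / wid N) *\<^sub>R ?n)"
      by (subst y) (rule norm_triangle_ineq)
    also have "\<dots> = norm (squash N F y) + (?t + ?t / wid N)"
      using norm_normal[OF F] t wid(1)[of N] by simp
    also have "\<dots> \<le> R + (2 + 2 * 1)"
    proof -
      have "?t / wid N = ?t * (1 / wid N)" by simp
      also have "\<dots> \<le> 2 * 1" using t wid[of N] by (intro mult_mono) auto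
      finally show ?thesis using R i interior_subset t by (intro add_mono) auto
    qed
    finally show ?thesis by simp
  qed
  \<comment> \<open>The excluded y lie on the end planes of the cylinder or project onto the plane
    of another facet; together they form a null set.\<close>
  have lim: "(\<lambda>N. ?g N (squash N F y)) \<longlonglongrightarrow> indicator (cylinder K F) y * h (facet_proj K F y)"
    if y0: "?n \<bullet> y \<noteq> offset K F" and y1: "?n \<bullet> y \<noteq> offset K F + 1"
      and y2: "\<And>F'. F' \<in> ?A \<Longrightarrow> gap F' (facet_proj K F y) \<noteq> 0" for y
  proof -
    let ?t = "?n \<bullet> y - offset K F"
    have c: "cut' N F (squash N F y) = ramp' (1 / wid N) ?t" for N
      unfolding cut'_def gap_squash[OF F] ..
    have z: "(\<lambda>N. ?g N (squash N F y)) \<longlonglongrightarrow> 0" if "eventually (\<lambda>N. ?g N (squash N F y) = 0) sequentially"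
      using that by (rule tendsto_eventually)
    consider "?t < 0" | "?t > 1" | "0 < ?t" "?t < 1" using y0 y1 by fastforce
    then show ?thesis
    proof cases
      case 1
      then have "cut' N F (squash N F y) = 0" for N
        unfolding c using 1 wid(2)[of N] by (intro ramp'_eq_0[OF wid(2,3)] disjI1) linarith
      moreover have "y \<notin> cylinder K F" using 1 mem_cylinder_iff[OF F] by auto
      ultimately show ?thesis by simp
    next
      case 2
      have "eventually (\<lambda>N. 1 / wid N < ?t - 1) sequentially" using 2 by (intro eventually_wid) simp
      then have "eventually (\<lambda>N. ?g N (squash N F y) = 0) sequentially"
      proof eventually_elim
        case (elim N)
        then have "cut' N F (squash N F y) = 0" unfolding c by (intro ramp'_eq_0[OF wid(2,3)] disjI2) linarith
        then show ?case by simp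
      qed
      moreover have "y \<notin> cylinder K F" using 2 mem_cylinder_iff[OF F] by auto
      ultimately show ?thesis using z by simp
    next
      case 3
      have gl: "(\<lambda>N. gap F' (squash N F y)) \<longlonglongrightarrow> gap F' (facet_proj K F y)" for F'
        unfolding gap_def by (intro tendsto_intros squash_tendsto)
      show ?thesis
      proof (cases "\<exists>F'\<in>?A. gap F' (facet_proj K F y) < 0")
        case True
        then obtain F' where F': "F' \<in> ?A" "gap F' (facet_proj K F y) < 0" by blast
        \<comment> \<open>The projection violates another facet inequality strictly, so the squashed
          points eventually leave K as well and both the sequence and its limit are zero.\<close>
        have "eventually (\<lambda>N. gap F' (squash N F y) < 0) sequentially"
          using order_tendstoD(2)[OF gl F'(2)] .
        then have "eventually (\<lambda>N. ?g N (squash N F y) = 0) sequentially"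
        proof eventually_elim
          case (elim N)
          then have "squash N F y \<notin> interior K" using mem_interior_gap F'(1) by force
          then show ?case by simp
        qed
        moreover have "facet_proj K F y \<notin> K" using F' mem_K_gap by force
        then have "y \<notin> cylinder K F" using mem_cylinder_iff[OF F] facet_subset[OF F] by blast
        ultimately show ?thesis using z by simp
      next
        case False
        then have pos: "gap F' (facet_proj K F y) > 0" if "F' \<in> ?A" for F'
          using that y2 by (meson linorder_neqE_linordered_idom)
        have gF: "?n \<bullet> facet_proj K F y = offset K F"
          using normal_inner_self[OF F] by (simp add: facet_proj_def inner_diff_right)
        have PK: "facet_proj K F y \<in> K"
          unfolding mem_K_gap using pos gF by (metis DiffI gap_def diff_self less_imp_le mem_Collect_eq order_refl singletonD)
        then have PF: "facet_proj K F y \<in> F" using facet_eq[OF F] gF by blast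
        then have cyl: "y \<in> cylinder K F" using mem_cylinder_iff[OF F] 3 by simp
        have "\<forall>F'\<in>?A. eventually (\<lambda>N. 0 < gap F' (squash N F y)) sequentially"
          using order_tendstoD(1)[OF gl] pos by blast
        then have "eventually (\<lambda>N. \<forall>F'\<in>?A. 0 < gap F' (squash N F y)) sequentially"
          using finA by (simp add: eventually_ball_finite)
        then have int: "eventually (\<lambda>N. squash N F y \<in> interior K) sequentially"
        proof eventually_elim
          case (elim N)
          have "0 < wid N * gap F (squash N F y)" using gap_squash[OF F] 3 by simp
          then have "0 < gap F (squash N F y)" using wid(1)[of N] by (simp add: zero_less_mult_iff)
          then show ?case using elim unfolding mem_interior_gap by blast
        qed
        have hl: "(\<lambda>N. h (squash N F y)) \<longlonglongrightarrow> h (facet_proj K F y)"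
          using int interior_subset by (intro continuous_on_tendsto_compose[OF h squash_tendsto PK]) (auto elim!: eventually_mono)
        have "eventually (\<lambda>N. 2 / wid N < ?t) sequentially" using 3 by (intro eventually_wid) simp
        then have c1: "eventually (\<lambda>N. cut' N F (squash N F y) = 1) sequentially"
        proof eventually_elim
          case (elim N)
          then show ?case unfolding c using 3 by (intro ramp'_eq_1[OF wid(2,3)]) simp_all
        qed
        have "(\<lambda>N. h (squash N F y) * (\<Prod>F'\<in>?A. cut N F' (squash N F y))) \<longlonglongrightarrow> h (facet_proj K F y) * 1"
          by (intro tendsto_mult hl prod_cut_tendsto[OF finA gl] pos)
        moreover have "eventually (\<lambda>N. h (squash N F y) * (\<Prod>F'\<in>?A. cut N F' (squash N F y)) = ?g N (squash N F y)) sequentially"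
          using c1 int by eventually_elim simp
        ultimately have "(\<lambda>N. ?g N (squash N F y)) \<longlonglongrightarrow> h (facet_proj K F y) * 1"
          by (rule Lim_transform_eventually)
        then show ?thesis using cyl by simp
      qed
    qed
  qed
  have n0: "?n \<noteq> 0" using norm_normal[OF F] by auto
  have ae2: "AE y in lborel. gap F' (facet_proj K F y) \<noteq> 0" if F'A: "F' \<in> ?A" for F'
  proof -
    let ?m = "normal K F'"
    let ?a = "?m - (?m \<bullet> ?n) *\<^sub>R ?n" and ?b = "offset K F' - (?m \<bullet> ?n) * offset K F"
    have F': "F' facet_of K" "F' \<noteq> F" using F'A by auto
    have gap_eq: "gap F' (facet_proj K F y) = ?b - ?a \<bullet> y" for y
      by (simp add: gap_def facet_proj_def inner_diff_left inner_diff_right algebra_simps)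
    \<comment> \<open>If this affine function vanished identically, the two normals would be
      parallel and both facets would be cut from K by the same plane, hence equal.\<close>
    have "?a \<noteq> 0 \<or> ?b \<noteq> 0"
    proof (rule ccontr)
      assume "\<not> ?thesis"
      then have a0: "?m = (?m \<bullet> ?n) *\<^sub>R ?n" and b0: "offset K F' = (?m \<bullet> ?n) * offset K F" by auto
      have "?m \<bullet> ?n \<noteq> 0" using a0 norm_normal[OF F'(1)] by auto
      then have "?m \<bullet> x = offset K F' \<longleftrightarrow> ?n \<bullet> x = offset K F" for x
        unfolding b0 by (subst a0) simp
      then have "F' = F" using facet_eq[OF F] facet_eq[OF F'(1)] by simp
      then show False using F' by simp
    qed
    from AE_not_hyperplane[OF this] show ?thesis unfolding gap_eq by (auto elim!: eventually_mono)
  qed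
  have ae: "AE y in lborel. ?n \<bullet> y \<noteq> offset K F \<and> ?n \<bullet> y \<noteq> offset K F + 1 \<and>
      (\<forall>F'\<in>?A. gap F' (facet_proj K F y) \<noteq> 0)"
    using AE_not_hyperplane[of ?n] n0 ae2 finA by (auto simp: AE_finite_all)
  have "(\<lambda>N. LINT y|lborel. ?g N (squash N F y)) \<longlonglongrightarrow>
      (LINT y|lborel. indicator (cylinder K F) y * h (facet_proj K F y))"
  proof (rule integral_dominated_convergence[where w = "\<lambda>y. B * indicator (cball (0 :: (real, 'n) vec) (R + 4)) y"])
    show "(\<lambda>y. indicator (cylinder K F) y * h (facet_proj K F y)) \<in> borel_measurable lborel"
      using facet_integral(3)[OF F hF] by simp
    show "(\<lambda>y. ?g N (squash N F y)) \<in> borel_measurable lborel" for N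
      using integral_squash(1)[OF F gint] by (rule borel_measurable_integrable)
    show "integrable lborel (\<lambda>y. B * indicator (cball (0 :: (real, 'n) vec) (R + 4)) y)" using integrable_cball by simp
    show "AE y in lborel. (\<lambda>N. ?g N (squash N F y)) \<longlonglongrightarrow> indicator (cylinder K F) y * h (facet_proj K F y)"
      using ae by eventually_elim (rule lim; blast)
    show "AE y in lborel. norm (?g N (squash N F y)) \<le> B * indicator (cball (0 :: (real, 'n) vec) (R + 4)) y" for N
    proof (rule AE_I2)
      fix y
      show "norm (?g N (squash N F y)) \<le> B * indicator (cball (0 :: (real, 'n) vec) (R + 4)) y"
      proof (cases "?g N (squash N F y) = 0")
        case True then show ?thesis using B(2) by (metis indicator_pos_le mult_nonneg_nonneg norm_zero)
      next
        case False
        then have "y \<in> cball 0 (R + 4)" using supp by simp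
        then show ?thesis using gB[of "squash N F y" N] by simp
      qed
    qed
  qed
  then show ?thesis unfolding eq facet_integral(2)[OF F hF] .
qed

end

section \<open>Compactly supported test functions\<close>

lemma test_function_outside:
  assumes "test_function U \<phi> \<psi>" "x \<notin> closure {x. \<phi> x \<noteq> 0}"
  shows "\<phi> x = 0" "\<psi> x = 0"
proof -
  let ?S = "closure {x. \<phi> x \<noteq> 0}"
  have z: "\<phi> y = 0" if "y \<in> - ?S" for y using that closure_subset[of "{x. \<phi> x \<noteq> 0}"] by auto
  show "\<phi> x = 0" by (rule z) (use assms(2) in simp)
  have "((\<lambda>_. 0) has_derivative (\<lambda>h. 0)) (at x)" by simp
  then have "(\<phi> has_derivative (\<lambda>h. 0)) (at x)"
  proof (rule has_derivative_transform_within_open[where s = "- ?S"])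
    show "open (- ?S)" by (intro open_Compl closed_closure)
    show "x \<in> - ?S" using assms(2) by simp
    show "0 = \<phi> y" if "y \<in> - ?S" for y using z[OF that] by (rule sym)
  qed
  moreover have "(\<phi> has_derivative (\<lambda>h. h \<bullet> \<psi> x)) (at x)"
    using assms by (auto simp: test_function_def gderiv_def)
  ultimately have "(\<lambda>h. 0) = (\<lambda>h. h \<bullet> \<psi> x)" by (rule has_derivative_unique)
  from fun_cong[OF this[symmetric], of "\<psi> x"] have "\<psi> x \<bullet> \<psi> x = 0" by simp
  then show "\<psi> x = 0" by simp
qed

lemma test_function_bounds:
  assumes "test_function U \<phi> \<psi>"
  obtains R B where "\<And>x. norm x > R \<Longrightarrow> \<phi> x = 0 \<and> \<psi> x = 0" "\<And>x. norm (\<psi> x) \<le> B" "\<And>x. \<bar>\<phi> x\<bar> \<le> B" "B \<ge> 0" "R \<ge> 0"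
proof -
  let ?S = "closure {x. \<phi> x \<noteq> 0}"
  have c: "compact ?S" using assms by (simp add: test_function_def)
  obtain R where R: "\<And>x. x \<in> ?S \<Longrightarrow> norm x \<le> R" using compact_imp_bounded[OF c] by (auto simp: bounded_iff)
  have "continuous_on UNIV \<phi>"
  proof (rule has_derivative_continuous_on)
    show "(\<phi> has_derivative (\<lambda>h. h \<bullet> \<psi> x)) (at x within UNIV)" for x
      using assms by (auto simp: test_function_def gderiv_def)
  qed
  then have "bounded (\<phi> ` ?S)" "bounded (\<psi> ` ?S)"
    using assms c by (auto simp: test_function_def intro!: compact_imp_bounded compact_continuous_image elim!: continuous_on_subset)
  then obtain B1 B2 where B: "\<And>x. x \<in> ?S \<Longrightarrow> \<bar>\<phi> x\<bar> \<le> B1" "\<And>x. x \<in> ?S \<Longrightarrow> norm (\<psi> x) \<le> B2"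
    by (auto simp: bounded_iff)
  show ?thesis
  proof (rule that[of "max 0 R" "max 0 (max B1 B2)"])
    show "\<phi> x = 0 \<and> \<psi> x = 0" if "norm x > max 0 R" for x
    proof -
      have "x \<notin> ?S" using R[of x] that by linarith
      from test_function_outside[OF assms this] show ?thesis by (rule conjI)
    qed
    show "norm (\<psi> x) \<le> max 0 (max B1 B2)" for x
    proof (cases "x \<in> ?S")
      case True then show ?thesis using B(2)[OF True] by linarith
    next
      case False
      show ?thesis unfolding test_function_outside(2)[OF assms False] by simp
    qed
    show "\<bar>\<phi> x\<bar> \<le> max 0 (max B1 B2)" for x
    proof (cases "x \<in> ?S")
      case True then show ?thesis using B(1)[OF True] by linarith
    next
      case False
      show ?thesis unfolding test_function_outside(1)[OF assms False] by simp
    qed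
  qed auto
qed

lemma test_function_measurable:
  assumes "test_function U \<phi> \<psi>"
  shows "\<phi> \<in> borel_measurable borel" "\<psi> \<in> borel_measurable borel" "continuous_on S \<phi>" "continuous_on S \<psi>"
proof -
  have "\<And>x. (\<phi> has_derivative (\<lambda>h. h \<bullet> \<psi> x)) (at x within UNIV)"
    using assms by (auto simp: test_function_def gderiv_def)
  then have "continuous_on UNIV \<phi>" by (rule has_derivative_continuous_on)
  moreover have "continuous_on UNIV \<psi>" using assms by (simp add: test_function_def)
  ultimately show "\<phi> \<in> borel_measurable borel" "\<psi> \<in> borel_measurable borel" "continuous_on S \<phi>" "continuous_on S \<psi>"
    by (auto intro: borel_measurable_continuous_onI continuous_on_subset)
qed

text \<open>Difference quotients of a compactly supported function have integral zero by translation invariance.\<close>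

lemma integral_gradient_test_function:
  fixes \<phi> :: "real^'n \<Rightarrow> real"
  assumes T: "test_function U \<phi> \<psi>"
  shows "(LINT x|lborel. \<psi> x $ j) = 0"
proof -
  obtain R B where R: "\<And>x. norm x > R \<Longrightarrow> \<phi> x = 0 \<and> \<psi> x = 0" and B: "\<And>x. norm (\<psi> x) \<le> B" "\<And>x. \<bar>\<phi> x\<bar> \<le> B"
    and nn: "B \<ge> 0" "R \<ge> 0" using test_function_bounds[OF T] by blast
  let ?e = "axis j 1 :: real^'n"
  let ?t = "\<lambda>m::nat. 1 / (real m + 1)"
  let ?q = "\<lambda>m x. (\<phi> (?t m *\<^sub>R ?e + x) - \<phi> x) / ?t m"
  have der: "(\<phi> has_derivative (\<lambda>h. h \<bullet> \<psi> x)) (at x within S)" for x S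
    using T by (auto simp: test_function_def gderiv_def intro: has_derivative_at_withinI)
  have cb: "integrable lborel (indicator (cball 0 r) :: real^'n \<Rightarrow> real)" for r
    using emeasure_bounded_finite[of "cball (0::real^'n) r"] by (simp add: integrable_real_indicator)
  have int: "integrable lborel \<phi>"
  proof (rule Bochner_Integration.integrable_bound)
    show "integrable lborel (\<lambda>x. B * indicator (cball (0::real^'n) R) x)" using cb by simp
    show "\<phi> \<in> borel_measurable lborel" using test_function_measurable[OF T] by simp
    show "AE x in lborel. norm (\<phi> x) \<le> norm (B * indicator (cball 0 R) x)"
      using R B(2) nn by (intro AE_I2) (auto simp: indicator_def not_le)
  qed
  have zero: "(LINT x|lborel. ?q m x) = 0" for m
  proof -
    have "(LINT x|lborel. \<phi> (?t m *\<^sub>R ?e + x) - \<phi> x) = 0"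
      using lborel_integral_translation[OF int, of "?t m *\<^sub>R ?e"] int by (subst Bochner_Integration.integral_diff) auto
    then show ?thesis by simp
  qed
  have "(\<lambda>m. LINT x|lborel. ?q m x) \<longlonglongrightarrow> (LINT x|lborel. \<psi> x $ j)"
  proof (rule integral_dominated_convergence[where w = "\<lambda>x. B * indicator (cball (0::real^'n) (R + 1)) x"])
    show "(\<lambda>x. \<psi> x $ j) \<in> borel_measurable lborel"
      using test_function_measurable(4)[OF T, of UNIV]
      by (auto intro!: borel_measurable_continuous_onI continuous_intros)
    show "?q m \<in> borel_measurable lborel" for m
      using test_function_measurable(1)[OF T] by simp
    show "integrable lborel (\<lambda>x. B * indicator (cball (0::real^'n) (R + 1)) x)" using cb by simp
    show "AE x in lborel. (\<lambda>m. ?q m x) \<longlonglongrightarrow> \<psi> x $ j"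
    proof (rule AE_I2)
      fix x
      have "((\<lambda>s. \<phi> (s *\<^sub>R ?e + x)) has_derivative (\<lambda>s. (s *\<^sub>R ?e) \<bullet> \<psi> x)) (at 0)"
        by (rule has_derivative_compose[of "\<lambda>s. s *\<^sub>R ?e + x" _ _ _ \<phi>, simplified])
          (auto intro!: derivative_eq_intros der)
      then have "((\<lambda>s. \<phi> (s *\<^sub>R ?e + x)) has_real_derivative (\<psi> x $ j)) (at 0)"
        by (simp add: has_field_derivative_def inner_axis' mult_commute_abs)
      then have "((\<lambda>h. (\<phi> (h *\<^sub>R ?e + x) - \<phi> x) / h) \<longlongrightarrow> \<psi> x $ j) (at 0)"
        by (simp add: DERIV_def)
      moreover have "filterlim ?t (at 0) sequentially"
        unfolding filterlim_at
        using LIMSEQ_inverse_real_of_nat by (auto simp: inverse_eq_divide add.commute)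
      ultimately show "(\<lambda>m. ?q m x) \<longlonglongrightarrow> \<psi> x $ j"
        by (rule filterlim_compose)
    qed
    \<comment> \<open>The mean value inequality bounds the quotients by B, and as the shift has
      length at most one they vanish outside the ball of radius R + 1.\<close>
    show "AE x in lborel. norm (?q m x) \<le> B * indicator (cball 0 (R + 1)) x" for m
    proof (rule AE_I2)
      fix x
      have t: "0 < ?t m" "?t m \<le> 1" by auto
      show "norm (?q m x) \<le> B * indicator (cball 0 (R + 1)) x"
      proof (cases "norm x \<le> R + 1")
        case True
        have "norm (\<phi> (?t m *\<^sub>R ?e + x) - \<phi> x) \<le> B * norm (?t m *\<^sub>R ?e + x - x)"
        proof (rule differentiable_bound[OF convex_UNIV der])
          show "onorm (\<lambda>h. h \<bullet> \<psi> y) \<le> B" for y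
          proof (rule onorm_bound[OF nn(1)])
            fix h
            have "norm (h \<bullet> \<psi> y) \<le> norm h * norm (\<psi> y)" by (simp add: Cauchy_Schwarz_ineq2)
            also have "\<dots> \<le> B * norm h" using mult_left_mono[OF B(1)[of y], of "norm h"] by (simp add: mult.commute)
            finally show "norm (h \<bullet> \<psi> y) \<le> B * norm h" .
          qed
        qed auto
        then have "\<bar>\<phi> (?t m *\<^sub>R ?e + x) - \<phi> x\<bar> \<le> B * ?t m" using t by simp
        then have "\<bar>\<phi> (?t m *\<^sub>R ?e + x) - \<phi> x\<bar> / \<bar>?t m\<bar> \<le> B"
          unfolding abs_of_pos[OF t(1)] pos_divide_le_eq[OF t(1)] .
        then have "norm (?q m x) \<le> B" unfolding real_norm_def by (subst abs_divide)
        then show ?thesis using True by simp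
      next
        case False
        have "norm (- (?t m *\<^sub>R ?e)) \<le> 1" using t by simp
        moreover have "norm x - norm (- (?t m *\<^sub>R ?e)) \<le> norm (?t m *\<^sub>R ?e + x)"
          using norm_triangle_ineq2[of x "- (?t m *\<^sub>R ?e)"]
          unfolding diff_minus_eq_add add.commute[of x] .
        ultimately have "norm (?t m *\<^sub>R ?e + x) > R" using False by linarith
        then show ?thesis using False R[of x] R[of "?t m *\<^sub>R ?e + x"] nn by simp
      qed
    qed
  qed
  then show ?thesis unfolding zero by (simp add: LIMSEQ_const_iff)
qed

text \<open>Fed into the divergence theorem, the coordinate fields give Gauss's formula for
  polynomials.\<close>

lemma weak_divergence_const:
  fixes U :: "(real^'n) set"
  assumes U: "open U" shows "weak_divergence U (\<lambda>x. axis j 1) (\<lambda>x. 0)"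
  unfolding weak_divergence_def
proof (intro allI impI)
  fix \<phi> :: "real^'n \<Rightarrow> real" and \<psi> assume T: "test_function U \<phi> \<psi>"
  have *: "indicator U x * \<psi> x $ j = \<psi> x $ j" for x
  proof (cases "x \<in> U")
    case False
    then have "x \<notin> closure {x. \<phi> x \<noteq> 0}" using T by (auto simp: test_function_def)
    then show ?thesis using test_function_outside(2)[OF T] by simp
  qed simp
  have m: "(\<lambda>x. indicator U x * \<psi> x $ j) \<in> borel_measurable borel"
    unfolding * using test_function_measurable(4)[OF T, of UNIV]
    by (auto intro!: borel_measurable_continuous_onI continuous_intros)
  have "(LINT x|lebesgue_on U. axis j 1 \<bullet> \<psi> x) = (LINT x|lborel. \<psi> x $ j)"
    using lebesgue_on_integral_eq_lborel(1)[OF _ m] U * by (simp add: inner_axis')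
  then show "(LINT x|lebesgue_on U. axis j 1 \<bullet> \<psi> x) = - (LINT x|lebesgue_on U. 0 * \<phi> x)"
    using integral_gradient_test_function[OF T] by simp
qed

section \<open>Passing between an element and its interior\<close>

context full_polytope
begin

lemma null_boundary: "K - interior K \<in> null_sets (lebesgue_on K)"
proof -
  have "negligible (frontier K)" by (rule negligible_convex_frontier[OF convex])
  moreover have "K - interior K = frontier K" using closed by (simp add: frontier_def)
  ultimately have "K - interior K \<in> null_sets lebesgue" by (simp add: negligible_iff_null_sets)
  then show ?thesis using closed by (subst null_sets_restrict_space) auto
qed

text \<open>The equations integrate over K, weak derivatives live on its interior; the two differ by
  the frontier of a convex set, which is null. Functions that are not integrable are covered as
  well, since their integral is zero by convention.\<close>

lemma lebesgue_on_interior: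
  fixes f :: "real^'n \<Rightarrow> 'b::euclidean_space"
  shows "f \<in> borel_measurable (lebesgue_on K) \<longleftrightarrow> f \<in> borel_measurable (lebesgue_on (interior K))"
    and "integrable (lebesgue_on K) f \<longleftrightarrow> integrable (lebesgue_on (interior K)) f"
    and "(LINT x|lebesgue_on K. f x) = (LINT x|lebesgue_on (interior K). f x)"
proof -
  have sets: "K \<in> sets lebesgue" "interior K \<in> sets lebesgue" using closed by auto
  have "K - (K - interior K) = interior K" using interior_subset by blast
  then show m: "f \<in> borel_measurable (lebesgue_on K) \<longleftrightarrow> f \<in> borel_measurable (lebesgue_on (interior K))"
    using borel_measurable_diff_null[OF null_boundary sets(1), of f] by simp
  have null: "K - interior K \<in> null_sets lebesgue"
    using null_boundary sets by (simp add: null_sets_restrict_space)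
  have ae: "AE x in lebesgue. indicator K x *\<^sub>R f x = indicator (interior K) x *\<^sub>R f x"
    by (rule AE_I'[OF null]) (use interior_subset in \<open>auto simp: indicator_def\<close>)
  have mm: "(\<lambda>x. indicator S x *\<^sub>R f x) \<in> borel_measurable lebesgue"
    if "f \<in> borel_measurable (lebesgue_on S)" "S \<in> sets lebesgue" for S
    using that by (subst (asm) borel_measurable_restrict_space_iff) auto
  show i: "integrable (lebesgue_on K) f \<longleftrightarrow> integrable (lebesgue_on (interior K)) f"
  proof (cases "f \<in> borel_measurable (lebesgue_on K)")
    case True
    show ?thesis
      using integrable_cong_AE[OF mm[OF True sets(1)] mm[OF True[unfolded m] sets(2)] ae] sets
      by (simp add: integrable_restrict_space)
  next
    case False
    then show ?thesis using m borel_measurable_integrable by blast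
  qed
  show "(LINT x|lebesgue_on K. f x) = (LINT x|lebesgue_on (interior K). f x)"
  proof (cases "f \<in> borel_measurable (lebesgue_on K)")
    case True
    show ?thesis
      using integral_cong_AE[OF mm[OF True sets(1)] mm[OF True[unfolded m] sets(2)] ae] sets
      by (simp add: integral_restrict_space)
  next
    case False
    then show ?thesis using m i borel_measurable_integrable not_integrable_integral_eq by metis
  qed
qed

lemma integrable_continuous:
  fixes f :: "real^'n \<Rightarrow> 'b::euclidean_space"
  assumes "continuous_on K f" shows "integrable (lebesgue_on K) f"
proof -
  have "integrable lborel (\<lambda>x. indicator K x *\<^sub>R f x)"
    by (rule borel_integrable_compact[OF compact assms])
  then have "integrable lebesgue (\<lambda>x. indicator K x *\<^sub>R f x)"
    by (subst integrable_completion) (auto dest: borel_measurable_integrable)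
  then show ?thesis using closed by (simp add: integrable_restrict_space)
qed

end

section \<open>The cutoff of an element and the divergence theorem\<close>

context lebesgue_polytope
begin

definition cutoff :: "nat \<Rightarrow> (real, 'n) vec \<Rightarrow> real" where
  "cutoff N x = (\<Prod>F | F facet_of K. cut N F x)"

text \<open>By the product rule the gradient of the cutoff is a sum of layer terms, one per facet,
  negative because \<open>gap\<close> decreases along the outward normal. They have the shape whose
  integrals \<open>boundary_layer_limit\<close> evaluates.\<close>

lemma cutoff_test_function:
  assumes g: "\<And>x. GDERIV g x :> X x" and X: "continuous_on UNIV X"
  shows "test_function (interior K) (\<lambda>x. g x * cutoff N x)
    (\<lambda>x. cutoff N x *\<^sub>R X x - (\<Sum>F | F facet_of K. (wid N * (g x * cut' N F x * (\<Prod>F'\<in>{F. F facet_of K} - {F}. cut N F' x))) *\<^sub>R normal K F))"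
  (is "test_function _ ?\<phi> ?\<psi>")
proof -
  let ?A = "{F. F facet_of K}"
  have dcut: "(cut N F has_derivative (\<lambda>h. - wid N * cut' N F x * (h \<bullet> normal K F))) (at x)" for F x
  proof -
    have "((\<lambda>x. wid N * gap F x) has_derivative (\<lambda>h. - wid N * (h \<bullet> normal K F))) (at x)"
      unfolding gap_def by (auto intro!: derivative_eq_intros simp: inner_commute)
    from has_derivative_compose[OF this ramp_has_derivative[unfolded has_field_derivative_def]]
    show ?thesis unfolding cut_def[abs_def] cut'_def by (simp add: mult_ac)
  qed
  have dcutoff: "(cutoff N has_derivative (\<lambda>h. \<Sum>F\<in>?A. (- wid N * cut' N F x * (h \<bullet> normal K F)) * (\<Prod>F'\<in>?A - {F}. cut N F' x))) (at x)" for x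
    unfolding cutoff_def[abs_def] by (rule has_derivative_prod) (rule dcut)
  have GD: "GDERIV ?\<phi> x :> ?\<psi> x" for x
    unfolding gderiv_def
  proof (rule has_derivative_eq_rhs[OF has_derivative_mult[OF g[unfolded gderiv_def] dcutoff]])
    show "(\<lambda>h. g x * (\<Sum>F\<in>?A. (- wid N * cut' N F x * (h \<bullet> normal K F)) * (\<Prod>F'\<in>?A - {F}. cut N F' x)) + (h \<bullet> X x) * cutoff N x)
        = (\<lambda>h. h \<bullet> ?\<psi> x)"
      by (simp add: fun_eq_iff inner_diff_right inner_sum_right sum_distrib_left sum_negf mult_ac)
  qed
  have cont: "continuous_on UNIV ?\<psi>"
  proof -
    have "continuous_on UNIV g"
      using g unfolding gderiv_def by (intro has_derivative_continuous_on) auto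
    then show ?thesis unfolding cutoff_def
      by (intro continuous_intros X continuous_cut continuous_cut')
  qed
  \<comment> \<open>Outside this set some factor of the cutoff is zero. The set is closed, and
    positivity of every gap puts it in the interior.\<close>
  let ?S = "{x. \<forall>F. F facet_of K \<longrightarrow> 1 / wid N \<le> wid N * gap F x}"
  have supp: "{x. ?\<phi> x \<noteq> 0} \<subseteq> ?S"
  proof
    fix x assume "x \<in> {x. ?\<phi> x \<noteq> 0}"
    then have nz: "cutoff N x \<noteq> 0" by auto
    have "1 / wid N \<le> wid N * gap F x" if "F facet_of K" for F
    proof (rule ccontr)
      assume "\<not> ?thesis"
      then have "cut N F x = 0" unfolding cut_def using ramp_eq_0[OF wid(2,3)] by simp
      then have "cutoff N x = 0" unfolding cutoff_def using finite_facets that by (auto intro: prod_zero)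
      then show False using nz by simp
    qed
    then show "x \<in> ?S" by blast
  qed
  have Sint: "?S \<subseteq> interior K"
  proof
    fix x assume x: "x \<in> ?S"
    have "0 < gap F x" if "F facet_of K" for F
    proof -
      have "0 < 1 / wid N" by (rule wid(2))
      also have "1 / wid N \<le> wid N * gap F x" using x that by blast
      finally show ?thesis using wid(1)[of N] by (simp add: zero_less_mult_iff)
    qed
    then show "x \<in> interior K" unfolding mem_interior_gap by blast
  qed
  have "closed ?S"
    by (auto intro!: closed_Collect_all closed_Collect_imp closed_Collect_le continuous_intros continuous_gap)
  then have cl: "closure {x. ?\<phi> x \<noteq> 0} \<subseteq> ?S" using supp by (rule closure_minimal[rotated])
  have "bounded (closure {x. ?\<phi> x \<noteq> 0})"
    by (rule bounded_subset[OF compact_imp_bounded[OF compact]]) (use cl Sint interior_subset[of K] in auto)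
  then have "compact (closure {x. ?\<phi> x \<noteq> 0})" by (simp add: compact_eq_bounded_closed)
  then show ?thesis unfolding test_function_def using GD cont cl Sint by blast
qed

lemma cutoff_tendsto: "x \<in> interior K \<Longrightarrow> (\<lambda>N. cutoff N x) \<longlonglongrightarrow> 1"
  unfolding cutoff_def using finite_facets mem_interior_gap
  by (intro prod_cut_tendsto[where g = "\<lambda>F. gap F x"]) auto

lemma cutoff_bounds: "0 \<le> cutoff N x" "cutoff N x \<le> 1"
  unfolding cutoff_def by (rule prod_cut_bounds)+

lemma continuous_cutoff: "continuous_on S (cutoff N)"
  unfolding cutoff_def by (intro continuous_intros continuous_cut)

lemma cutoff_integral_limit:
  fixes f :: "(real, 'n) vec \<Rightarrow> real"
  assumes f: "integrable (lebesgue_on (interior K)) f"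
  shows "(\<lambda>N. LINT x|lebesgue_on (interior K). f x * cutoff N x) \<longlonglongrightarrow> (LINT x|lebesgue_on (interior K). f x)"
proof (rule integral_dominated_convergence[where w = "\<lambda>x. \<bar>f x\<bar>"])
  have fm: "f \<in> borel_measurable (lebesgue_on (interior K))" using f by (rule borel_measurable_integrable)
  have cm: "cutoff N \<in> borel_measurable (lebesgue_on (interior K))" for N
    by (rule continuous_imp_measurable_on_sets_lebesgue[OF continuous_cutoff]) simp
  show "f \<in> borel_measurable (lebesgue_on (interior K))" by (rule fm)
  show "(\<lambda>x. f x * cutoff N x) \<in> borel_measurable (lebesgue_on (interior K))" for N
    using fm cm by simp
  show "integrable (lebesgue_on (interior K)) (\<lambda>x. \<bar>f x\<bar>)" using f by simp
  show "AE x in lebesgue_on (interior K). (\<lambda>N. f x * cutoff N x) \<longlonglongrightarrow> f x"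
  proof (rule AE_I2)
    fix x assume "x \<in> space (lebesgue_on (interior K))"
    then have "x \<in> interior K" by simp
    from tendsto_mult[OF tendsto_const[of "f x"] cutoff_tendsto[OF this]]
    show "(\<lambda>N. f x * cutoff N x) \<longlonglongrightarrow> f x" by simp
  qed
  show "AE x in lebesgue_on (interior K). norm (f x * cutoff N x) \<le> \<bar>f x\<bar>" for N
    using cutoff_bounds by (intro AE_I2) (simp add: abs_mult mult_left_le)
qed

text \<open>This is integration by parts against a C1 multiplier g. With q = 0 it serves the
  coordinate fields and the convection velocity, with q an entry of a weak Jacobian the field v x
  d.\<close>

theorem divergence_theorem:
  assumes w: "continuous_on K w" and q: "q \<in> Linf (interior K)"
    and wq: "weak_divergence (interior K) w q"
    and g: "\<And>x. GDERIV g x :> X x" and X: "continuous_on UNIV X"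
  shows "(LINT x|lebesgue_on K. w x \<bullet> X x) + (LINT x|lebesgue_on (interior K). q x * g x)
    = (\<Sum>F | F facet_of K. LINT x|facet_measure (normal K F) F. (w x \<bullet> normal K F) * g x)"
proof -
  let ?U = "interior K" and ?A = "{F. F facet_of K}"
  have gc: "continuous_on UNIV g"
    using g unfolding gderiv_def by (intro has_derivative_continuous_on) auto
  have cont: "continuous_on K (\<lambda>x. w x \<bullet> X x)" "continuous_on K (\<lambda>x. (w x \<bullet> normal K F) * g x)" for F
    using gc X by (auto intro!: continuous_intros w elim: continuous_on_subset)
  have int1: "integrable (lebesgue_on ?U) (\<lambda>x. w x \<bullet> X x)"
    using integrable_continuous[OF cont(1)] lebesgue_on_interior(2) by blast
  have int2: "integrable (lebesgue_on ?U) (\<lambda>x. q x * g x)"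
  proof -
    obtain B where B: "\<And>x. x \<in> K \<Longrightarrow> \<bar>g x\<bar> \<le> B" "B \<ge> 0"
      using bounded_on_K[of g] continuous_on_subset[OF gc] by blast
    obtain C where C: "AE x in lebesgue_on ?U. norm (q x) \<le> C" and qm: "q \<in> borel_measurable (lebesgue_on ?U)"
      using q by (auto simp: Linf_def)
    have "integrable (lebesgue_on ?U) (\<lambda>x. C * B)"
      using integrable_continuous[of "\<lambda>x. C * B"] lebesgue_on_interior(2) by auto
    then show ?thesis
    proof (rule Bochner_Integration.integrable_bound)
      have "g \<in> borel_measurable (lebesgue_on ?U)"
        by (rule continuous_imp_measurable_on_sets_lebesgue) (use gc continuous_on_subset in auto)
      then show "(\<lambda>x. q x * g x) \<in> borel_measurable (lebesgue_on ?U)" using qm by simp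
      show "AE x in lebesgue_on ?U. norm (q x * g x) \<le> norm (C * B)"
        using C AE_space
      proof eventually_elim
        case (elim x)
        then have "x \<in> K" using interior_subset[of K] by auto
        then have "\<bar>q x\<bar> * \<bar>g x\<bar> \<le> C * B" using elim B by (intro mult_mono) auto
        then have "\<bar>q x * g x\<bar> \<le> C * B" by (simp add: abs_mult)
        then show ?case using abs_ge_self[of "C * B"] unfolding real_norm_def by linarith
      qed
    qed
  qed
  let ?b = "\<lambda>N F x. ((w x \<bullet> normal K F) * g x) * cut' N F x * (\<Prod>F'\<in>?A - {F}. cut N F' x)"
  have b: "integrable (lebesgue_on ?U) (?b N F)" "(LINT x|lebesgue_on ?U. ?b N F x) = (LINT x|lborel. indicator ?U x * ?b N F x)" for N F
  proof -
    have "continuous_on K (?b N F)"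
      by (intro continuous_intros cont(2) continuous_cut continuous_cut')
    then show "integrable (lebesgue_on ?U) (?b N F)"
      using integrable_continuous lebesgue_on_interior(2) by blast
    show "(LINT x|lebesgue_on ?U. ?b N F x) = (LINT x|lborel. indicator ?U x * ?b N F x)"
      by (rule lebesgue_on_integral_eq_lborel(1)) (simp_all add: boundary_layer_measurable(1)[OF cont(2)])
  qed
  have c1: "integrable (lebesgue_on ?U) (\<lambda>x. (w x \<bullet> X x) * cutoff N x)" for N
  proof -
    have "continuous_on K (\<lambda>x. (w x \<bullet> X x) * cutoff N x)"
      by (intro continuous_intros cont(1) continuous_cutoff)
    then show ?thesis using integrable_continuous lebesgue_on_interior(2) by blast
  qed
  \<comment> \<open>The weak formulation tested with g times the cutoff: the layer terms separate
    from the interior term, and each part has a limit.\<close>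
  have eq: "(LINT x|lebesgue_on ?U. (w x \<bullet> X x) * cutoff N x)
      - (\<Sum>F\<in>?A. wid N * (LINT x|lborel. indicator ?U x * ?b N F x))
      = - (LINT x|lebesgue_on ?U. (q x * g x) * cutoff N x)" for N
  proof -
    have "(LINT x|lebesgue_on ?U. w x \<bullet> (cutoff N x *\<^sub>R X x - (\<Sum>F\<in>?A. (wid N * (g x * cut' N F x * (\<Prod>F'\<in>?A - {F}. cut N F' x))) *\<^sub>R normal K F)))
        = - (LINT x|lebesgue_on ?U. q x * (g x * cutoff N x))"
      using wq cutoff_test_function[OF g X, of N] unfolding weak_divergence_def by blast
    moreover have "w x \<bullet> (cutoff N x *\<^sub>R X x - (\<Sum>F\<in>?A. (wid N * (g x * cut' N F x * (\<Prod>F'\<in>?A - {F}. cut N F' x))) *\<^sub>R normal K F))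
        = (w x \<bullet> X x) * cutoff N x - (\<Sum>F\<in>?A. wid N * ?b N F x)" for x
      by (simp add: inner_diff_right inner_sum_right mult_ac)
    ultimately have "(LINT x|lebesgue_on ?U. (w x \<bullet> X x) * cutoff N x - (\<Sum>F\<in>?A. wid N * ?b N F x))
        = - (LINT x|lebesgue_on ?U. (q x * g x) * cutoff N x)"
      by (simp add: mult.assoc)
    then show ?thesis
      using b c1 by (simp add: Bochner_Integration.integral_diff Bochner_Integration.integral_sum)
  qed
  have "(\<lambda>N. (LINT x|lebesgue_on ?U. (w x \<bullet> X x) * cutoff N x)
      - (\<Sum>F\<in>?A. wid N * (LINT x|lborel. indicator ?U x * ?b N F x)))
    \<longlonglongrightarrow> (LINT x|lebesgue_on ?U. w x \<bullet> X x)
      - (\<Sum>F\<in>?A. LINT x|facet_measure (normal K F) F. (w x \<bullet> normal K F) * g x)"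
    by (intro tendsto_diff cutoff_integral_limit int1 tendsto_sum boundary_layer_limit cont(2)) simp
  moreover have "(\<lambda>N. - (LINT x|lebesgue_on ?U. (q x * g x) * cutoff N x))
    \<longlonglongrightarrow> - (LINT x|lebesgue_on ?U. q x * g x)"
    by (intro tendsto_minus cutoff_integral_limit int2)
  ultimately have "(LINT x|lebesgue_on ?U. w x \<bullet> X x)
      - (\<Sum>F\<in>?A. LINT x|facet_measure (normal K F) F. (w x \<bullet> normal K F) * g x)
    = - (LINT x|lebesgue_on ?U. q x * g x)"
    unfolding eq by (rule LIMSEQ_unique)
  then show ?thesis by (simp add: lebesgue_on_interior(3))
qed

lemma polys_gradient:
  assumes "f \<in> polys k"
  shows "GDERIV f x :> (\<chi> j. pd f j x)" "continuous_on UNIV (\<lambda>x. \<chi> j. pd f j x)"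
  using polys_has_derivative[OF assms] polys_continuous[OF pd_polys[OF assms]]
  by (auto simp: gderiv_def inner_vec_def intro!: continuous_on_vec_lambda)

lemma polynomial_divergence:
  assumes "f \<in> polys k"
  shows "(LINT x|lebesgue_on K. pd f j x) = (\<Sum>F | F facet_of K. LINT x|facet_measure (normal K F) F. normal K F $ j * f x)"
proof -
  have "(LINT x|lebesgue_on K. axis j 1 \<bullet> (\<chi> j. pd f j x)) + (LINT x|lebesgue_on (interior K). 0 * f x)
    = (\<Sum>F | F facet_of K. LINT x|facet_measure (normal K F) F. (axis j 1 \<bullet> normal K F) * f x)"
    by (intro divergence_theorem weak_divergence_const polys_gradient[OF assms])
      (auto simp: Linf_def intro!: exI[of _ 0])
  then show ?thesis by (simp add: inner_axis')
qed

text \<open>The i-th component of u placed along the j-th axis is a vector field with weak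
  divergence \<open>D x $ i $ j\<close>.\<close>

lemma weak_jacobian_divergence:
  fixes u :: "(real, 'n) vec \<Rightarrow> (real, 'm::finite) vec"
  assumes u: "continuous_on K u" and D: "D \<in> Linf (interior K)" "weak_jacobian (interior K) u D"
    and f: "f \<in> polys k"
  shows "(LINT x|lebesgue_on K. u x $ i * pd f j x) + (LINT x|lebesgue_on (interior K). D x $ i $ j * f x)
    = (\<Sum>F | F facet_of K. LINT x|facet_measure (normal K F) F. u x $ i * normal K F $ j * f x)"
proof -
  have Dij: "(\<lambda>x. D x $ i $ j) \<in> Linf (interior K)"
  proof -
    obtain C where C: "AE x in lebesgue_on (interior K). norm (D x) \<le> C"
      and m: "D \<in> borel_measurable (lebesgue_on (interior K))" using D(1) by (auto simp: Linf_def)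
    have "(\<lambda>x. D x $ i $ j) \<in> borel_measurable (lebesgue_on (interior K))"
      by (rule measurable_compose[OF m]) (auto intro!: borel_measurable_continuous_onI continuous_intros)
    moreover have "AE x in lebesgue_on (interior K). norm (D x $ i $ j) \<le> C"
      using C
    proof eventually_elim
      case (elim x)
      show ?case using Finite_Cartesian_Product.norm_nth_le[of "D x $ i" j] Finite_Cartesian_Product.norm_nth_le[of "D x" i] elim by linarith
    qed
    ultimately show ?thesis by (auto simp: Linf_def)
  qed
  have "(LINT x|lebesgue_on K. (u x $ i *\<^sub>R axis j 1) \<bullet> (\<chi> j. pd f j x)) + (LINT x|lebesgue_on (interior K). D x $ i $ j * f x)
    = (\<Sum>F | F facet_of K. LINT x|facet_measure (normal K F) F. ((u x $ i *\<^sub>R axis j 1) \<bullet> normal K F) * f x)"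
  proof (rule divergence_theorem[OF _ Dij _ polys_gradient[OF f]])
    show "continuous_on K (\<lambda>x. u x $ i *\<^sub>R (axis j 1 :: (real, 'n) vec))" by (intro continuous_on_scaleR continuous_on_const bounded_linear.continuous_on[OF bounded_linear_vec_nth] u)
    show "weak_divergence (interior K) (\<lambda>x. u x $ i *\<^sub>R axis j 1) (\<lambda>x. D x $ i $ j)"
      using D(2) by (simp add: weak_divergence_def weak_jacobian_def inner_axis')
  qed
  then show ?thesis by (simp add: inner_axis')
qed

end

section \<open>Lipschitz continuity of \<open>W\<^sup>1\<^sup>,\<^sup>\<infinity>\<close> functions on convex open sets\<close>

lemma compact_support_integral:
  fixes h :: "'a::euclidean_space \<Rightarrow> real"
  assumes S: "compact S" "S \<subseteq> U" and U: "U \<in> sets borel" and h: "continuous_on S h"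
    and z: "\<And>x. x \<in> U \<Longrightarrow> x \<notin> S \<Longrightarrow> h x = 0"
  shows "integrable (lebesgue_on U) h"
    and "(LINT x|lebesgue_on U. h x) = (LINT x|lborel. indicator S x * h x)"
    and "integrable lborel (\<lambda>x. indicator S x * h x)"
proof -
  have eq: "(\<lambda>x. indicator U x * h x) = (\<lambda>x. indicator S x * h x)"
    using S(2) z by (auto simp: indicator_def fun_eq_iff)
  have "integrable lborel (\<lambda>x. indicator S x *\<^sub>R h x)" by (rule borel_integrable_compact[OF S(1) h])
  then show i: "integrable lborel (\<lambda>x. indicator S x * h x)" by simp
  then have m: "(\<lambda>x. indicator U x * h x) \<in> borel_measurable borel"
    unfolding eq using borel_measurable_integrable by simp
  show "integrable (lebesgue_on U) h" "(LINT x|lebesgue_on U. h x) = (LINT x|lborel. indicator S x * h x)"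
    using lebesgue_on_integral_eq_lborel[OF U m] i unfolding eq by auto
qed

text \<open>A radial C1 mollifier supported in the ball of radius \<epsilon>. Its mass is left
  unnormalized and carried as a factor through the estimates.\<close>

definition bump :: "real \<Rightarrow> 'a::euclidean_space \<Rightarrow> real" where
  "bump \<epsilon> z = sqp (\<epsilon>\<^sup>2 - z \<bullet> z)"

definition dbump :: "real \<Rightarrow> 'a::euclidean_space \<Rightarrow> 'a" where
  "dbump \<epsilon> z = max 0 (\<epsilon>\<^sup>2 - z \<bullet> z) *\<^sub>R (- 2 *\<^sub>R z)"

lemma bump_has_derivative: "(bump \<epsilon> has_derivative (\<lambda>h. h \<bullet> dbump \<epsilon> z)) (at z within S)"
proof -
  have "((\<lambda>z. \<epsilon>\<^sup>2 - z \<bullet> z) has_derivative (\<lambda>h. - (2 * (h \<bullet> z)))) (at z within S)"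
    by (auto intro!: derivative_eq_intros simp: inner_commute)
  from has_derivative_compose[OF this sqp_has_derivative[unfolded has_field_derivative_def]]
  show ?thesis unfolding bump_def[abs_def] dbump_def by (simp add: mult_ac)
qed

lemma continuous_bump: "continuous_on S (bump \<epsilon>)"
  by (rule has_derivative_continuous_on[OF bump_has_derivative])

lemma continuous_dbump: "continuous_on S (dbump \<epsilon>)"
  unfolding dbump_def by (intro continuous_intros)

lemma bump_nonneg: "0 \<le> bump \<epsilon> z"
  by (simp add: bump_def sqp_def)

lemma bump_eq_0: "0 \<le> \<epsilon> \<Longrightarrow> \<epsilon> \<le> norm z \<Longrightarrow> bump \<epsilon> z = 0"
  by (simp add: bump_def sqp_def power_mono dot_square_norm)

lemma bump_pos: "norm z < \<epsilon> \<Longrightarrow> 0 < bump \<epsilon> z"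
proof -
  assume "norm z < \<epsilon>"
  then have "(norm z)\<^sup>2 < \<epsilon>\<^sup>2" by (intro power_strict_mono) auto
  then show ?thesis by (simp add: bump_def sqp_def dot_square_norm)
qed

text \<open>Translation invariance gives every shifted bump the same mass; it is positive because an
  open ball is not null.\<close>

lemma integrable_bump:
  fixes x :: "'a::euclidean_space"
  assumes "0 < \<epsilon>"
  shows "integrable lborel (\<lambda>z. bump \<epsilon> (z - x))" "(LINT z|lborel. bump \<epsilon> (z - x)) = (LINT z|lborel. bump \<epsilon> (z :: 'a))"
    "0 < (LINT z|lborel. bump \<epsilon> (z :: 'a))"
proof -
  have "(\<lambda>z :: 'a. indicator (cball 0 \<epsilon>) z *\<^sub>R bump \<epsilon> z) = bump \<epsilon>"
  proof
    fix z :: 'a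
    show "indicator (cball 0 \<epsilon>) z *\<^sub>R bump \<epsilon> z = bump \<epsilon> z"
      using bump_eq_0[of \<epsilon> z] assms by (auto simp: indicator_def)
  qed
  moreover have "integrable lborel (\<lambda>z :: 'a. indicator (cball 0 \<epsilon>) z *\<^sub>R bump \<epsilon> z)"
    by (rule borel_integrable_compact[OF compact_cball continuous_bump])
  ultimately have i: "integrable lborel (bump \<epsilon> :: 'a \<Rightarrow> real)" by simp
  show "integrable lborel (\<lambda>z. bump \<epsilon> (z - x))" "(LINT z|lborel. bump \<epsilon> (z - x)) = (LINT z|lborel. bump \<epsilon> (z :: 'a))"
    using lborel_integral_translation[OF i, of "- x"] by simp_all
  have "(LINT z|lborel. bump \<epsilon> (z :: 'a)) \<noteq> 0"
  proof
    assume "(LINT z|lborel. bump \<epsilon> (z :: 'a)) = 0"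
    then have "AE z in lborel. bump \<epsilon> (z :: 'a) = 0"
      using integral_nonneg_eq_0_iff_AE[OF i] bump_nonneg by auto
    then have "AE z in lborel. (z :: 'a) \<notin> ball 0 \<epsilon>"
      by eventually_elim (use bump_pos in force)
    then have "ball (0::'a) \<epsilon> \<in> null_sets lborel"
      by (subst (asm) AE_iff_null_sets[symmetric]) auto
    then have "negligible (ball (0::'a) \<epsilon>)"
      by (simp add: negligible_iff_null_sets null_sets_completionI)
    then show False using assms open_not_negligible[of "ball (0::'a) \<epsilon>"] by auto
  qed
  moreover have "0 \<le> (LINT z|lborel. bump \<epsilon> (z :: 'a))" using bump_nonneg by (intro integral_nonneg_AE) auto
  ultimately show "0 < (LINT z|lborel. bump \<epsilon> (z :: 'a))" by simp
qed

text \<open>The bump smeared along the segment from \<open>x\<close> to \<open>x + v\<close>.  Its derivative in direction \<open>v\<close> telescopes to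
  the difference of the bumps at the two ends, so as a test function it compares the mollified values there.\<close>

definition tube :: "real \<Rightarrow> 'a::euclidean_space \<Rightarrow> 'a \<Rightarrow> 'a \<Rightarrow> real" where
  "tube \<epsilon> x v z = integral (cbox 0 1) (\<lambda>t::real. bump \<epsilon> (z - x - t *\<^sub>R v))"

definition dtube :: "real \<Rightarrow> 'a::euclidean_space \<Rightarrow> 'a \<Rightarrow> 'a \<Rightarrow> 'a" where
  "dtube \<epsilon> x v z = integral (cbox 0 1) (\<lambda>t::real. dbump \<epsilon> (z - x - t *\<^sub>R v))"

lemma tube_nonneg: "0 \<le> tube \<epsilon> x v z"
  unfolding tube_def
  by (intro Henstock_Kurzweil_Integration.integral_nonneg integrable_continuous bump_nonneg
      continuous_on_compose2[OF continuous_bump[of UNIV]] continuous_intros) auto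

lemma tube_gderiv: "GDERIV (tube \<epsilon> x v) z :> dtube \<epsilon> x v z"
proof -
  let ?fx = "\<lambda>z t::real. blinfun_inner_left (dbump \<epsilon> (z - x - t *\<^sub>R v))"
  have c: "continuous_on (UNIV \<times> cbox 0 1) (\<lambda>(z, t). ?fx z t)"
    unfolding split_beta
    by (intro bounded_linear.continuous_on[OF bounded_linear_blinfun_inner_left]
        continuous_on_compose2[OF continuous_dbump[of UNIV]] continuous_intros) auto
  have i: "(\<lambda>t. dbump \<epsilon> (z - x - t *\<^sub>R v)) integrable_on cbox 0 1"
    by (intro integrable_continuous continuous_on_compose2[OF continuous_dbump[of UNIV]] continuous_intros) auto
  have "((\<lambda>z. integral (cbox 0 1) (\<lambda>t::real. bump \<epsilon> (z - x - t *\<^sub>R v))) has_derivative integral (cbox 0 1) (?fx z)) (at z within UNIV)"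
  proof (rule leibniz_rule[OF _ _ c])
    show "((\<lambda>z. bump \<epsilon> (z - x - t *\<^sub>R v)) has_derivative blinfun_apply (?fx z t)) (at z within UNIV)" for z t
    proof -
      have "((\<lambda>z. z - x - t *\<^sub>R v) has_derivative (\<lambda>h. h)) (at z)" by (auto intro!: derivative_eq_intros)
      from has_derivative_compose[OF this bump_has_derivative]
      show ?thesis by (simp add: blinfun_inner_left.rep_eq)
    qed
    show "(\<lambda>t. bump \<epsilon> (z - x - t *\<^sub>R v)) integrable_on cbox 0 1" for z
      by (intro integrable_continuous continuous_on_compose2[OF continuous_bump[of UNIV]] continuous_intros) auto
  qed auto
  moreover have "integral (cbox 0 1) (?fx z) = blinfun_inner_left (dtube \<epsilon> x v z)"
    using integral_linear[OF i bounded_linear_blinfun_inner_left] by (simp add: o_def dtube_def)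
  ultimately show ?thesis
    unfolding gderiv_def tube_def[abs_def] by (simp add: blinfun_inner_left.rep_eq)
qed

lemma continuous_dtube: "continuous_on S (dtube \<epsilon> x v)"
  unfolding dtube_def
  by (rule integral_continuous_on_param)
    (auto simp: split_beta intro!: continuous_on_compose2[OF continuous_dbump[of UNIV]] continuous_intros)

lemma continuous_tube: "continuous_on S (tube \<epsilon> x v)"
  by (rule has_derivative_continuous_on) (use tube_gderiv has_derivative_at_withinI in \<open>unfold gderiv_def, blast\<close>)

lemma inner_dtube: "v \<bullet> dtube \<epsilon> x v z = bump \<epsilon> (z - x) - bump \<epsilon> (z - (x + v))"
proof -
  have i: "(\<lambda>t. dbump \<epsilon> (z - x - t *\<^sub>R v)) integrable_on {0..1}"
    by (intro integrable_continuous_real continuous_on_compose2[OF continuous_dbump[of UNIV]] continuous_intros) auto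
  have "((\<lambda>t. - (v \<bullet> dbump \<epsilon> (z - x - t *\<^sub>R v))) has_integral
      (bump \<epsilon> (z - x - 1 *\<^sub>R v) - bump \<epsilon> (z - x - 0 *\<^sub>R v))) {0..1}"
  proof (rule fundamental_theorem_of_calculus)
    fix t :: real
    have "((\<lambda>t. z - x - t *\<^sub>R v) has_derivative (\<lambda>h. - (h *\<^sub>R v))) (at t within {0..1})"
      by (auto intro!: derivative_eq_intros)
    from has_derivative_compose[OF this bump_has_derivative]
    show "((\<lambda>t. bump \<epsilon> (z - x - t *\<^sub>R v)) has_vector_derivative - (v \<bullet> dbump \<epsilon> (z - x - t *\<^sub>R v))) (at t within {0..1})"
      by (simp add: has_vector_derivative_def)
  qed simp
  moreover have "((\<lambda>t. - (v \<bullet> dbump \<epsilon> (z - x - t *\<^sub>R v))) has_integral - (v \<bullet> dtube \<epsilon> x v z)) {0..1}"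
    using has_integral_neg[OF has_integral_linear[OF integrable_integral[OF i] bounded_linear_inner_right[of v]]]
    by (simp add: o_def dtube_def cbox_interval)
  ultimately have "bump \<epsilon> (z - x - 1 *\<^sub>R v) - bump \<epsilon> (z - x - 0 *\<^sub>R v) = - (v \<bullet> dtube \<epsilon> x v z)"
    by (rule has_integral_unique)
  then show ?thesis by (simp add: diff_diff_eq)
qed

lemma tube_support:
  assumes "0 < \<epsilon>" "tube \<epsilon> x v z \<noteq> 0"
  shows "z \<in> (\<Union>p\<in>closed_segment x (x + v). cball p \<epsilon>)"
proof (rule ccontr)
  assume z: "\<not> ?thesis"
  have "bump \<epsilon> (z - x - t *\<^sub>R v) = 0" if "t \<in> cbox 0 1" for t
  proof (rule bump_eq_0)
    have "x + t *\<^sub>R v = (1 - t) *\<^sub>R x + t *\<^sub>R (x + v)" by (simp add: algebra_simps)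
    then have "x + t *\<^sub>R v \<in> closed_segment x (x + v)" using that unfolding in_segment by auto
    then have "z \<notin> cball (x + t *\<^sub>R v) \<epsilon>" using z by blast
    then show "\<epsilon> \<le> norm (z - x - t *\<^sub>R v)" by (simp add: dist_norm norm_minus_commute diff_diff_eq)
  qed (use assms in simp)
  then have "tube \<epsilon> x v z = integral (cbox 0 1) (\<lambda>t::real. 0)"
    unfolding tube_def by (intro Henstock_Kurzweil_Integration.integral_cong)
  then show False using assms by simp
qed

lemma compact_tube_support: "compact (\<Union>p\<in>closed_segment x (x + v :: 'a::euclidean_space). cball p \<epsilon>)"
proof -
  have eq: "(\<Union>p\<in>closed_segment x (x + v). cball p \<epsilon>) = {p + b | p b. p \<in> closed_segment x (x + v) \<and> b \<in> cball 0 \<epsilon>}"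
  proof (intro set_eqI iffI)
    fix z assume "z \<in> (\<Union>p\<in>closed_segment x (x + v). cball p \<epsilon>)"
    then obtain p where "p \<in> closed_segment x (x + v)" "z \<in> cball p \<epsilon>" by blast
    then show "z \<in> {p + b | p b. p \<in> closed_segment x (x + v) \<and> b \<in> cball 0 \<epsilon>}"
      unfolding mem_Collect_eq
      by (intro exI[of _ p] exI[of _ "z - p"]) (simp add: dist_norm norm_minus_commute)
  qed (force simp: dist_norm)
  show ?thesis unfolding eq by (rule compact_sums[OF compact_segment compact_cball])
qed

text \<open>Exchange the integrations over z and t on a common box; for each t the inner integral is
  the mass of a shifted bump.\<close>

lemma integral_tube:
  fixes x v :: "'a::euclidean_space"
  assumes "0 < \<epsilon>"
  shows "(LINT z|lborel. tube \<epsilon> x v z) = (LINT z|lborel. bump \<epsilon> (z :: 'a))"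
    and "integrable lborel (tube \<epsilon> x v)"
proof -
  let ?S = "\<Union>p\<in>closed_segment x (x + v). cball p \<epsilon>"
  obtain a b where ab: "?S \<subseteq> cbox a b"
    using bounded_subset_cbox_symmetric[OF compact_imp_bounded[OF compact_tube_support]] by metis
  have "(\<lambda>z. indicator ?S z *\<^sub>R tube \<epsilon> x v z) = tube \<epsilon> x v"
  proof
    fix z
    show "indicator ?S z *\<^sub>R tube \<epsilon> x v z = tube \<epsilon> x v z"
      using tube_support[OF assms, of x v z] by (auto simp: indicator_def)
  qed
  moreover have "integrable lborel (\<lambda>z. indicator ?S z *\<^sub>R tube \<epsilon> x v z)"
    by (rule borel_integrable_compact[OF compact_tube_support continuous_tube])
  ultimately show i: "integrable lborel (tube \<epsilon> x v)" by simp
  have cb: "integral (cbox a b) f = (LINT z|lborel. f z)"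
    if "integrable lborel f" "\<And>z. z \<notin> cbox a b \<Longrightarrow> f z = 0" for f :: "'a \<Rightarrow> real"
  proof -
    have "(\<lambda>z. if z \<in> cbox a b then f z else 0) = f" using that(2) by auto
    then show ?thesis using Henstock_Kurzweil_Integration.integral_restrict_UNIV[of "cbox a b" f] integral_lborel[OF that(1)] by simp
  qed
  have inner: "integral (cbox a b) (\<lambda>z. bump \<epsilon> (z - x - t *\<^sub>R v)) = (LINT z|lborel. bump \<epsilon> (z :: 'a))"
    if t: "t \<in> cbox 0 1" for t
  proof -
    have e: "z - x - t *\<^sub>R v = z - (x + t *\<^sub>R v)" for z by simp
    have "x + t *\<^sub>R v = (1 - t) *\<^sub>R x + t *\<^sub>R (x + v)" by (simp add: algebra_simps)
    then have p: "x + t *\<^sub>R v \<in> closed_segment x (x + v)" using t unfolding in_segment by auto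
    have "bump \<epsilon> (z - (x + t *\<^sub>R v)) = 0" if "z \<notin> cbox a b" for z
    proof (rule bump_eq_0)
      have "z \<notin> cball (x + t *\<^sub>R v) \<epsilon>" using ab p that by blast
      then show "\<epsilon> \<le> norm (z - (x + t *\<^sub>R v))" by (simp add: dist_norm norm_minus_commute)
    qed (use assms in simp)
    then show ?thesis unfolding e
      using cb[OF integrable_bump(1)[OF assms, of "x + t *\<^sub>R v"]] integrable_bump(2)[OF assms, of "x + t *\<^sub>R v"] by simp
  qed
  have "(LINT z|lborel. tube \<epsilon> x v z) = integral (cbox a b) (tube \<epsilon> x v)"
    using cb[OF i] tube_support[OF assms, of x v] ab by (metis subsetD)
  also have "\<dots> = integral (cbox 0 1) (\<lambda>t::real. integral (cbox a b) (\<lambda>z. bump \<epsilon> (z - x - t *\<^sub>R v)))"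
    unfolding tube_def
    by (rule integral_swap_continuous)
      (auto simp: split_beta intro!: continuous_on_compose2[OF continuous_bump[of UNIV]] continuous_intros)
  also have "\<dots> = integral (cbox 0 1) (\<lambda>t::real. (LINT z|lborel. bump \<epsilon> (z :: 'a)))"
    by (rule Henstock_Kurzweil_Integration.integral_cong[OF inner])
  also have "\<dots> = (LINT z|lborel. bump \<epsilon> (z :: 'a))" by simp
  finally show "(LINT z|lborel. tube \<epsilon> x v z) = (LINT z|lborel. bump \<epsilon> (z :: 'a))" .
qed

lemma tube_test_function:
  assumes "0 < \<epsilon>" "(\<Union>p\<in>closed_segment x (x + v). cball p \<epsilon>) \<subseteq> U"
  shows "test_function U (tube \<epsilon> x v) (dtube \<epsilon> x v)"
proof -
  let ?S = "\<Union>p\<in>closed_segment x (x + v). cball p \<epsilon>"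
  have "closure {z. tube \<epsilon> x v z \<noteq> 0} \<subseteq> ?S"
    using tube_support[OF assms(1)] compact_imp_closed[OF compact_tube_support]
    by (intro closure_minimal) blast+
  moreover from this have "compact (closure {z. tube \<epsilon> x v z \<noteq> 0})"
    using bounded_subset[OF compact_imp_bounded[OF compact_tube_support]] by (simp add: compact_eq_bounded_closed)
  ultimately show ?thesis
    unfolding test_function_def using tube_gderiv continuous_dtube assms(2) by blast
qed

text \<open>Near x the function is within e of \<open>g x\<close>; as the bump is nonnegative with
  some mass M, its weighted integral is within e M of \<open>g x\<close> times M.\<close>

lemma mollified_value:
  fixes g :: "'a::euclidean_space \<Rightarrow> real"
  assumes g: "continuous_on U g" and U: "open U" and x: "x \<in> U" and e: "0 < e"
  obtains \<epsilon>0 where "0 < \<epsilon>0"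
    "\<And>\<epsilon>. 0 < \<epsilon> \<Longrightarrow> \<epsilon> \<le> \<epsilon>0 \<Longrightarrow> integrable (lebesgue_on U) (\<lambda>z. g z * bump \<epsilon> (z - x))"
    "\<And>\<epsilon>. 0 < \<epsilon> \<Longrightarrow> \<epsilon> \<le> \<epsilon>0 \<Longrightarrow>
      \<bar>(LINT z|lebesgue_on U. g z * bump \<epsilon> (z - x)) - g x * (LINT z|lborel. bump \<epsilon> (z :: 'a))\<bar> \<le> e * (LINT z|lborel. bump \<epsilon> (z :: 'a))"
proof -
  have "isCont g x" using g U x by (simp add: continuous_on_eq_continuous_at)
  then obtain d where d: "d > 0" "\<And>z. dist z x < d \<Longrightarrow> dist (g z) (g x) < e"
    using e unfolding continuous_at_eps_delta by blast
  obtain r where r: "r > 0" "cball x r \<subseteq> U" using U x open_contains_cball by blast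
  show ?thesis
  proof (rule that[of "min (d / 2) r"])
    fix \<epsilon> assume \<epsilon>: "0 < \<epsilon>" "\<epsilon> \<le> min (d / 2) r"
    have sub: "cball x \<epsilon> \<subseteq> U" using \<epsilon> r by (meson min.boundedE order_trans subset_cball)
    have zero: "bump \<epsilon> (z - x) = 0" if "z \<notin> cball x \<epsilon>" for z
      using that \<epsilon> by (intro bump_eq_0) (auto simp: dist_norm norm_minus_commute)
    have c: "continuous_on (cball x \<epsilon>) (\<lambda>z. g z * bump \<epsilon> (z - x))"
      using g sub by (auto intro!: continuous_intros continuous_on_compose2[OF continuous_bump[of UNIV]] elim: continuous_on_subset)
    note cs = compact_support_integral[OF compact_cball sub borel_open[OF U] c]
    show "integrable (lebesgue_on U) (\<lambda>z. g z * bump \<epsilon> (z - x))" by (rule cs(1)) (simp add: zero)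
    have "(LINT z|lebesgue_on U. g z * bump \<epsilon> (z - x)) - g x * (LINT z|lborel. bump \<epsilon> (z :: 'a))
      = (LINT z|lborel. indicator (cball x \<epsilon>) z * (g z * bump \<epsilon> (z - x))) - (LINT z|lborel. g x * bump \<epsilon> (z - x))"
      using cs(2) zero integrable_bump(2)[OF \<epsilon>(1), of x] by simp
    also have "\<dots> = (LINT z|lborel. indicator (cball x \<epsilon>) z * (g z * bump \<epsilon> (z - x)) - g x * bump \<epsilon> (z - x))"
      using cs(3) zero integrable_bump(1)[OF \<epsilon>(1), of x] by (subst Bochner_Integration.integral_diff) auto
    also have "\<bar>\<dots>\<bar> \<le> (LINT z|lborel. e * bump \<epsilon> (z - x))"
    proof (rule integral_abs_bound_integral)
      show "integrable lborel (\<lambda>z. indicator (cball x \<epsilon>) z * (g z * bump \<epsilon> (z - x)) - g x * bump \<epsilon> (z - x))"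
        using cs(3) zero integrable_bump(1)[OF \<epsilon>(1), of x] by auto
      show "integrable lborel (\<lambda>z. e * bump \<epsilon> (z - x))" using integrable_bump(1)[OF \<epsilon>(1), of x] by simp
      fix z
      show "\<bar>indicator (cball x \<epsilon>) z * (g z * bump \<epsilon> (z - x)) - g x * bump \<epsilon> (z - x)\<bar> \<le> e * bump \<epsilon> (z - x)"
      proof (cases "z \<in> cball x \<epsilon>")
        case True
        then have "dist z x < d" using \<epsilon> d(1) by (simp add: dist_commute)
        then have "\<bar>g z - g x\<bar> \<le> e" using d(2)[of z] by (simp add: dist_real_def)
        then have "\<bar>g z - g x\<bar> * bump \<epsilon> (z - x) \<le> e * bump \<epsilon> (z - x)"
          by (intro mult_right_mono bump_nonneg)
        then show ?thesis using True bump_nonneg[of \<epsilon> "z - x"] by (simp add: left_diff_distrib[symmetric] abs_mult)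
      next
        case False
        then show ?thesis using zero[OF False] by simp
      qed
    qed
    also have "\<dots> = e * (LINT z|lborel. bump \<epsilon> (z :: 'a))" using integrable_bump(2)[OF \<epsilon>(1), of x] by simp
    finally show "\<bar>(LINT z|lebesgue_on U. g z * bump \<epsilon> (z - x)) - g x * (LINT z|lborel. bump \<epsilon> (z :: 'a))\<bar> \<le> e * (LINT z|lborel. bump \<epsilon> (z :: 'a))" .
  qed (use d r in auto)
qed

text \<open>Testing with the tube from x to y equates the difference of the mollified values with an
  integral of the directional derivative, at most \<open>C * norm (y - x)\<close> times the common
  mass. Dividing by the mass leaves an arbitrarily small error; convexity keeps the tube in
  U.\<close>

lemma weak_gradient_bound:
  fixes g :: "real^'n \<Rightarrow> real" and D :: "real^'n \<Rightarrow> real^'n"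
  assumes U: "open U" "convex U" and g: "continuous_on U g"
    and D: "D \<in> borel_measurable (lebesgue_on U)" "AE x in lebesgue_on U. norm (D x) \<le> C"
    and weak: "\<And>\<phi> \<psi> j. test_function U \<phi> \<psi> \<Longrightarrow>
      (LINT x|lebesgue_on U. g x * \<psi> x $ j) = - (LINT x|lebesgue_on U. D x $ j * \<phi> x)"
    and xy: "x \<in> U" "y \<in> U"
  shows "\<bar>g x - g y\<bar> \<le> C * norm (y - x)"
proof (rule field_le_epsilon)
  fix e :: real assume e: "0 < e"
  then have e2: "0 < e / 2" by simp
  define v where "v = y - x"
  have y: "y = x + v" by (simp add: v_def)
  obtain \<epsilon>1 where \<epsilon>1: "0 < \<epsilon>1" "(\<Union>p\<in>closed_segment x (x + v). cball p \<epsilon>1) \<subseteq> U"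
    using compact_subset_open_imp_cball_epsilon_subset[OF compact_segment U(1) closed_segment_subset[OF xy U(2)]] y by metis
  obtain \<epsilon>2 where \<epsilon>2: "0 < \<epsilon>2"
    and i2: "\<And>\<epsilon>. 0 < \<epsilon> \<Longrightarrow> \<epsilon> \<le> \<epsilon>2 \<Longrightarrow> integrable (lebesgue_on U) (\<lambda>z. g z * bump \<epsilon> (z - x))"
    and b2: "\<And>\<epsilon>. 0 < \<epsilon> \<Longrightarrow> \<epsilon> \<le> \<epsilon>2 \<Longrightarrow>
      \<bar>(LINT z|lebesgue_on U. g z * bump \<epsilon> (z - x)) - g x * (LINT z|lborel. bump \<epsilon> (z :: real^'n))\<bar> \<le> e / 2 * (LINT z|lborel. bump \<epsilon> (z :: real^'n))"
    using mollified_value[OF g U(1) xy(1) e2] by blast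
  obtain \<epsilon>3 where \<epsilon>3: "0 < \<epsilon>3"
    and i3: "\<And>\<epsilon>. 0 < \<epsilon> \<Longrightarrow> \<epsilon> \<le> \<epsilon>3 \<Longrightarrow> integrable (lebesgue_on U) (\<lambda>z. g z * bump \<epsilon> (z - y))"
    and b3: "\<And>\<epsilon>. 0 < \<epsilon> \<Longrightarrow> \<epsilon> \<le> \<epsilon>3 \<Longrightarrow>
      \<bar>(LINT z|lebesgue_on U. g z * bump \<epsilon> (z - y)) - g y * (LINT z|lborel. bump \<epsilon> (z :: real^'n))\<bar> \<le> e / 2 * (LINT z|lborel. bump \<epsilon> (z :: real^'n))"
    using mollified_value[OF g U(1) xy(2) e2] by blast
  \<comment> \<open>Small enough for the tube to fit in U and for each end value to be approximated
    within e / 2 times the mass.\<close>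
  define \<epsilon> where "\<epsilon> = min \<epsilon>1 (min \<epsilon>2 \<epsilon>3)"
  have \<epsilon>: "0 < \<epsilon>" "\<epsilon> \<le> \<epsilon>1" "\<epsilon> \<le> \<epsilon>2" "\<epsilon> \<le> \<epsilon>3" using \<epsilon>1 \<epsilon>2 \<epsilon>3 by (auto simp: \<epsilon>_def)
  let ?M = "LINT z|lborel. bump \<epsilon> (z :: real^'n)"
  let ?S = "\<Union>p\<in>closed_segment x (x + v). cball p \<epsilon>"
  have S: "?S \<subseteq> U" using \<epsilon>1(2) \<epsilon>(2) subset_cball[OF \<epsilon>(2)] by blast
  have T: "test_function U (tube \<epsilon> x v) (dtube \<epsilon> x v)" by (rule tube_test_function[OF \<epsilon>(1) S])
  have zero: "tube \<epsilon> x v z = 0" if "z \<notin> ?S" for z using tube_support[OF \<epsilon>(1)] that by blast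
  have cl: "closure {z. tube \<epsilon> x v z \<noteq> 0} \<subseteq> ?S"
    using zero compact_imp_closed[OF compact_tube_support] by (intro closure_minimal) blast+
  have dzero: "dtube \<epsilon> x v z = 0" if "z \<notin> ?S" for z
    using test_function_outside(2)[OF T] cl that by blast
  have it: "integrable (lebesgue_on U) (tube \<epsilon> x v)" "(LINT z|lebesgue_on U. tube \<epsilon> x v z) = ?M"
  proof -
    note cs = compact_support_integral[OF compact_tube_support S borel_open[OF U(1)] continuous_tube]
    show "integrable (lebesgue_on U) (tube \<epsilon> x v)" by (rule cs(1)) (simp add: zero)
    have "(LINT z|lebesgue_on U. tube \<epsilon> x v z) = (LINT z|lborel. indicator ?S z * tube \<epsilon> x v z)"
      by (rule cs(2)) (simp add: zero)
    also have "\<dots> = (LINT z|lborel. tube \<epsilon> x v z)"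
      by (intro Bochner_Integration.integral_cong refl) (use zero in \<open>auto simp: indicator_def\<close>)
    finally show "(LINT z|lebesgue_on U. tube \<epsilon> x v z) = ?M" using integral_tube(1)[OF \<epsilon>(1)] by simp
  qed
  have id: "integrable (lebesgue_on U) (\<lambda>z. g z * dtube \<epsilon> x v z $ j)" for j
  proof (rule compact_support_integral(1)[OF compact_tube_support S borel_open[OF U(1)]])
    show "continuous_on ?S (\<lambda>z. g z * dtube \<epsilon> x v z $ j)"
      using g S by (auto intro!: continuous_intros continuous_dtube elim: continuous_on_subset)
  qed (simp add: dzero)
  have Dm: "(\<lambda>z. D z $ j) \<in> borel_measurable (lebesgue_on U)" for j
    by (rule measurable_compose[OF D(1)]) (auto intro!: borel_measurable_continuous_onI continuous_intros)
  have Cpos: "AE z in lebesgue_on U. norm (D z $ j * tube \<epsilon> x v z) \<le> norm (C * tube \<epsilon> x v z)" for j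
    using D(2)
  proof eventually_elim
    case (elim z)
    have "\<bar>D z $ j\<bar> \<le> C" using Finite_Cartesian_Product.norm_nth_le[of "D z" j] elim by simp
    then have "\<bar>D z $ j\<bar> * \<bar>tube \<epsilon> x v z\<bar> \<le> \<bar>C\<bar> * \<bar>tube \<epsilon> x v z\<bar>" by (intro mult_right_mono) auto
    then show ?case by (simp add: abs_mult)
  qed
  have tm: "tube \<epsilon> x v \<in> borel_measurable (lebesgue_on U)" using it(1) by (rule borel_measurable_integrable)
  have iD: "integrable (lebesgue_on U) (\<lambda>z. D z $ j * tube \<epsilon> x v z)" for j
    by (rule Bochner_Integration.integrable_bound[where f = "\<lambda>z. C * tube \<epsilon> x v z"])
      (use it(1) Dm tm Cpos in auto)
  have "(LINT z|lebesgue_on U. g z * bump \<epsilon> (z - x)) - (LINT z|lebesgue_on U. g z * bump \<epsilon> (z - y))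
      = (LINT z|lebesgue_on U. g z * (v \<bullet> dtube \<epsilon> x v z))"
    unfolding inner_dtube y right_diff_distrib
    using i2[OF \<epsilon>(1,3)] i3[OF \<epsilon>(1,4)] y by (subst Bochner_Integration.integral_diff) auto
  also have "\<dots> = (LINT z|lebesgue_on U. (\<Sum>j\<in>UNIV. v $ j * (g z * dtube \<epsilon> x v z $ j)))"
    by (simp add: inner_vec_def sum_distrib_left mult_ac)
  also have "\<dots> = (\<Sum>j\<in>UNIV. v $ j * (LINT z|lebesgue_on U. g z * dtube \<epsilon> x v z $ j))"
    using id by (subst Bochner_Integration.integral_sum) auto
  also have "\<dots> = - (\<Sum>j\<in>UNIV. v $ j * (LINT z|lebesgue_on U. D z $ j * tube \<epsilon> x v z))"
    by (simp add: weak[OF T] sum_negf)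
  also have "\<dots> = - (LINT z|lebesgue_on U. (\<Sum>j\<in>UNIV. v $ j * (D z $ j * tube \<epsilon> x v z)))"
    using iD by (subst Bochner_Integration.integral_sum) auto
  also have "\<dots> = - (LINT z|lebesgue_on U. (v \<bullet> D z) * tube \<epsilon> x v z)"
    by (simp only: inner_vec_def sum_distrib_right mult.assoc inner_real_def)
  finally have eq: "(LINT z|lebesgue_on U. g z * bump \<epsilon> (z - x)) - (LINT z|lebesgue_on U. g z * bump \<epsilon> (z - y))
      = - (LINT z|lebesgue_on U. (v \<bullet> D z) * tube \<epsilon> x v z)" .
  have "\<bar>LINT z|lebesgue_on U. (v \<bullet> D z) * tube \<epsilon> x v z\<bar> \<le> (LINT z|lebesgue_on U. C * norm v * tube \<epsilon> x v z)"
  proof -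
    have iv: "integrable (lebesgue_on U) (\<lambda>z. (v \<bullet> D z) * tube \<epsilon> x v z)"
    proof -
      have "integrable (lebesgue_on U) (\<lambda>z. \<Sum>j\<in>UNIV. v $ j * (D z $ j * tube \<epsilon> x v z))" using iD by auto
      then show ?thesis by (simp only: inner_vec_def sum_distrib_right mult.assoc inner_real_def)
    qed
    have "\<bar>LINT z|lebesgue_on U. (v \<bullet> D z) * tube \<epsilon> x v z\<bar> \<le> (LINT z|lebesgue_on U. \<bar>(v \<bullet> D z) * tube \<epsilon> x v z\<bar>)"
      using integral_norm_bound[of "lebesgue_on U" "\<lambda>z. (v \<bullet> D z) * tube \<epsilon> x v z"] by simp
    also have "\<dots> \<le> (LINT z|lebesgue_on U. C * norm v * tube \<epsilon> x v z)"
    proof (rule integral_mono_AE)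
      show "AE z in lebesgue_on U. \<bar>(v \<bullet> D z) * tube \<epsilon> x v z\<bar> \<le> C * norm v * tube \<epsilon> x v z"
        using D(2)
      proof eventually_elim
        case (elim z)
        have "\<bar>v \<bullet> D z\<bar> \<le> norm v * norm (D z)" by (rule Cauchy_Schwarz_ineq2)
        also have "\<dots> \<le> norm v * C" using elim by (intro mult_left_mono) auto
        finally have "\<bar>v \<bullet> D z\<bar> * tube \<epsilon> x v z \<le> norm v * C * tube \<epsilon> x v z"
          by (intro mult_right_mono tube_nonneg)
        then show ?case using tube_nonneg[of \<epsilon> x v z] by (simp add: abs_mult mult_ac)
      qed
    qed (use iv it in auto)
    finally show ?thesis .
  qed
  also have "\<dots> = C * norm v * ?M" using it by simp
  finally have main: "\<bar>(LINT z|lebesgue_on U. g z * bump \<epsilon> (z - x)) - (LINT z|lebesgue_on U. g z * bump \<epsilon> (z - y))\<bar> \<le> C * norm v * ?M"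
    unfolding eq by simp
  have "\<bar>g x * ?M - g y * ?M\<bar> \<le> C * norm v * ?M + (e / 2 * ?M + e / 2 * ?M)"
    using main b2[OF \<epsilon>(1,3)] b3[OF \<epsilon>(1,4)] by linarith
  then have "\<bar>g x - g y\<bar> * ?M \<le> (C * norm v + e) * ?M"
    using integrable_bump(3)[OF \<epsilon>(1), where 'a = "real^'n"]
    by (simp add: left_diff_distrib[symmetric] abs_mult distrib_right)
  then show "\<bar>g x - g y\<bar> \<le> C * norm (y - x) + e"
    using integrable_bump(3)[OF \<epsilon>(1), where 'a = "real^'n"] by (simp add: v_def)
qed

lemma W1inf_Lipschitz:
  fixes f :: "real^'n \<Rightarrow> real^'m"
  assumes f: "f \<in> W1inf U" and U: "open U" "convex U"
  obtains C where "\<And>x y. x \<in> U \<Longrightarrow> y \<in> U \<Longrightarrow> norm (f x - f y) \<le> C * norm (x - y)"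
proof -
  obtain D where D: "D \<in> Linf U" "weak_jacobian U f D" and c: "continuous_on U f"
    using f by (auto simp: W1inf_def)
  obtain C where C: "AE x in lebesgue_on U. norm (D x) \<le> C" and m: "D \<in> borel_measurable (lebesgue_on U)"
    using D(1) by (auto simp: Linf_def)
  have comp: "\<bar>f x $ i - f y $ i\<bar> \<le> C * norm (y - x)" if "x \<in> U" "y \<in> U" for x y i
  proof (rule weak_gradient_bound[OF U _ _ _ _ that])
    show "continuous_on U (\<lambda>x. f x $ i)" by (intro continuous_intros c)
    show "(\<lambda>x. D x $ i) \<in> borel_measurable (lebesgue_on U)"
      by (rule measurable_compose[OF m]) (auto intro!: borel_measurable_continuous_onI continuous_intros)
    show "AE x in lebesgue_on U. norm (D x $ i) \<le> C"
      using C
    proof eventually_elim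
      case (elim x)
      then show ?case using Finite_Cartesian_Product.norm_nth_le[of "D x" i] by simp
    qed
    show "(LINT x|lebesgue_on U. f x $ i * \<psi> x $ j) = - (LINT x|lebesgue_on U. D x $ i $ j * \<phi> x)"
      if "test_function U \<phi> \<psi>" for \<phi> \<psi> j
      using D(2) that unfolding weak_jacobian_def by blast
  qed
  show ?thesis
  proof (rule that[of "real CARD('m) * C"])
    fix x y assume xy: "x \<in> U" "y \<in> U"
    have "norm (f x - f y) \<le> (\<Sum>i\<in>UNIV. \<bar>(f x - f y) $ i\<bar>)" by (rule norm_le_l1_cart)
    also have "\<dots> \<le> (\<Sum>i\<in>(UNIV::'m set). C * norm (y - x))" by (intro sum_mono) (simp add: comp[OF xy])
    also have "\<dots> = real CARD('m) * C * norm (x - y)" by (simp add: norm_minus_commute)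
    finally show "norm (f x - f y) \<le> real CARD('m) * C * norm (x - y)" .
  qed
qed

section \<open>Restrictions, traces and products of \<open>W\<^sup>1\<^sup>,\<^sup>\<infinity>\<close> functions\<close>

lemma test_function_mono: "test_function U \<phi> \<psi> \<Longrightarrow> U \<subseteq> V \<Longrightarrow> test_function V \<phi> \<psi>"
  unfolding test_function_def by blast

lemma test_function_zero:
  assumes "test_function U \<phi> \<psi>" "x \<notin> U" shows "\<phi> x = 0" "\<psi> x = 0"
proof -
  have "x \<notin> closure {x. \<phi> x \<noteq> 0}" using assms by (auto simp: test_function_def)
  from test_function_outside[OF assms(1) this] show "\<phi> x = 0" "\<psi> x = 0" .
qed

lemma lebesgue_on_subset_integral:
  fixes f :: "'a::euclidean_space \<Rightarrow> 'b::euclidean_space"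
  assumes "U \<subseteq> V" "U \<in> sets lebesgue" "V \<in> sets lebesgue" "\<And>x. x \<in> V \<Longrightarrow> x \<notin> U \<Longrightarrow> f x = 0"
  shows "(LINT x|lebesgue_on V. f x) = (LINT x|lebesgue_on U. f x)"
proof -
  have "(\<lambda>x. indicator V x *\<^sub>R f x) = (\<lambda>x. indicator U x *\<^sub>R f x)"
    using assms by (auto simp: indicator_def fun_eq_iff)
  then show ?thesis using assms by (simp add: integral_restrict_space)
qed

lemma Linf_subset:
  assumes "f \<in> Linf V" "U \<subseteq> V" "U \<in> sets lebesgue" "V \<in> sets lebesgue"
  shows "f \<in> Linf U"
proof -
  obtain C where C: "AE x in lebesgue_on V. norm (f x) \<le> C" and m: "f \<in> borel_measurable (lebesgue_on V)"
    using assms by (auto simp: Linf_def)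
  have "AE x in lebesgue_on U. norm (f x) \<le> C"
    using C assms by (auto simp: AE_restrict_space_iff elim!: eventually_mono)
  moreover have "f \<in> borel_measurable (lebesgue_on U)" using m assms(2) by (rule measurable_restrict_mono)
  ultimately show ?thesis by (auto simp: Linf_def)
qed

lemma weak_jacobian_subset:
  assumes "weak_jacobian V f D" "U \<subseteq> V" "open U" "open V"
  shows "weak_jacobian U f D"
  unfolding weak_jacobian_def
proof (intro allI impI)
  fix \<phi> \<psi> i j assume T: "test_function U \<phi> \<psi>"
  have "(LINT x|lebesgue_on V. f x $ i * \<psi> x $ j) = - (LINT x|lebesgue_on V. D x $ i $ j * \<phi> x)"
    using assms(1) test_function_mono[OF T assms(2)] unfolding weak_jacobian_def by blast
  moreover have "(LINT x|lebesgue_on V. f x $ i * \<psi> x $ j) = (LINT x|lebesgue_on U. f x $ i * \<psi> x $ j)"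
    using assms by (intro lebesgue_on_subset_integral) (auto simp: test_function_zero[OF T])
  moreover have "(LINT x|lebesgue_on V. D x $ i $ j * \<phi> x) = (LINT x|lebesgue_on U. D x $ i $ j * \<phi> x)"
    using assms by (intro lebesgue_on_subset_integral) (auto simp: test_function_zero[OF T])
  ultimately show "(LINT x|lebesgue_on U. f x $ i * \<psi> x $ j) = - (LINT x|lebesgue_on U. D x $ i $ j * \<phi> x)" by simp
qed

lemma W1inf_subset:
  assumes "f \<in> W1inf V" "U \<subseteq> V" "open U" "open V"
  shows "f \<in> W1inf U"
proof -
  obtain D where D: "D \<in> Linf V" "weak_jacobian V f D" and f: "f \<in> Linf V" "continuous_on V f"
    using assms by (auto simp: W1inf_def)
  have "D \<in> Linf U" "f \<in> Linf U" using D f assms by (auto intro: Linf_subset)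
  moreover have "weak_jacobian U f D" using weak_jacobian_subset D assms by blast
  ultimately show ?thesis using continuous_on_subset[OF f(2) assms(2)] by (auto simp: W1inf_def)
qed

lemma weak_divergence_subset:
  assumes "weak_divergence V f q" "U \<subseteq> V" "open U" "open V"
  shows "weak_divergence U f q"
  unfolding weak_divergence_def
proof (intro allI impI)
  fix \<phi> \<psi> assume T: "test_function U \<phi> \<psi>"
  have "(LINT x|lebesgue_on V. f x \<bullet> \<psi> x) = - (LINT x|lebesgue_on V. q x * \<phi> x)"
    using assms(1) test_function_mono[OF T assms(2)] unfolding weak_divergence_def by blast
  moreover have "(LINT x|lebesgue_on V. f x \<bullet> \<psi> x) = (LINT x|lebesgue_on U. f x \<bullet> \<psi> x)"
    using assms by (intro lebesgue_on_subset_integral) (auto simp: test_function_zero[OF T])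
  moreover have "(LINT x|lebesgue_on V. q x * \<phi> x) = (LINT x|lebesgue_on U. q x * \<phi> x)"
    using assms by (intro lebesgue_on_subset_integral) (auto simp: test_function_zero[OF T])
  ultimately show "(LINT x|lebesgue_on U. f x \<bullet> \<psi> x) = - (LINT x|lebesgue_on U. q x * \<phi> x)" by simp
qed

lemma lebesgue_on_cong_integral:
  assumes "\<And>x. x \<in> U \<Longrightarrow> f x = g x"
  shows "(LINT x|lebesgue_on U. f x) = (LINT x|lebesgue_on U. g x)"
  by (rule Bochner_Integration.integral_cong) (auto simp: assms)

lemma weak_divergence_cong:
  assumes "\<And>x. x \<in> U \<Longrightarrow> f x = g x" shows "weak_divergence U f q \<longleftrightarrow> weak_divergence U g q"
proof -
  have "(LINT x|lebesgue_on U. f x \<bullet> \<psi> x) = (LINT x|lebesgue_on U. g x \<bullet> \<psi> x)" for \<psi>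
    by (rule lebesgue_on_cong_integral) (simp add: assms)
  then show ?thesis by (simp add: weak_divergence_def)
qed

lemma weak_jacobian_cong:
  fixes f g :: "real^'n \<Rightarrow> real^'m"
  assumes "\<And>x. x \<in> U \<Longrightarrow> f x = g x" shows "weak_jacobian U f D \<longleftrightarrow> weak_jacobian U g D"
proof -
  have "(LINT x|lebesgue_on U. f x $ i * \<psi> x $ j) = (LINT x|lebesgue_on U. g x $ i * \<psi> x $ j)" for \<psi> :: "real^'n \<Rightarrow> real^'n" and i j
    by (rule lebesgue_on_cong_integral) (simp add: assms)
  then show ?thesis by (simp add: weak_jacobian_def)
qed

lemma weak_jac_cong:
  assumes "\<And>x. x \<in> U \<Longrightarrow> f x = g x" shows "weak_jac U f = weak_jac U g"
  unfolding weak_jac_def using weak_jacobian_cong[of U f g] assms by simp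

lemma weak_jac_works:
  assumes "D \<in> Linf U" "weak_jacobian U f D"
  shows "weak_jac U f \<in> Linf U" "weak_jacobian U f (weak_jac U f)"
  using someI[where P = "\<lambda>D. D \<in> Linf U \<and> weak_jacobian U f D", of D] assms
  unfolding weak_jac_def by blast+

text \<open>The set where the bound fails is open by continuity, and a null open set is
  empty.\<close>

lemma continuous_AE_bound:
  fixes f :: "real^'n \<Rightarrow> 'b::real_normed_vector"
  assumes U: "open U" and f: "continuous_on U f" and ae: "AE x in lebesgue_on U. norm (f x) \<le> c" and x: "x \<in> U"
  shows "norm (f x) \<le> c"
proof (rule ccontr)
  assume nle: "\<not> norm (f x) \<le> c"
  let ?S = "(\<lambda>x. norm (f x)) -` {c<..} \<inter> U"
  have "open ?S"
    using continuous_open_preimage[OF continuous_on_norm[OF f] U open_greaterThan] by (simp add: Int_commute)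
  moreover have "x \<in> ?S" using x nle by (simp add: not_le)
  then have "?S \<noteq> {}" by blast
  moreover have "negligible ?S"
  proof -
    have "AE x in lebesgue. x \<in> U \<longrightarrow> norm (f x) \<le> c"
      using ae U by (subst (asm) AE_restrict_space_iff) auto
    then have "AE x in lebesgue. x \<notin> ?S" by eventually_elim auto
    moreover have "?S \<in> sets lebesgue" by (rule sets_completionI_sets) (use \<open>open ?S\<close> in simp)
    ultimately have "?S \<in> null_sets lebesgue" by (simp only: AE_iff_null_sets)
    then show ?thesis by (simp add: negligible_iff_null_sets)
  qed
  ultimately show False using open_not_negligible by blast
qed

context full_polytope
begin

text \<open>A Lipschitz function on the interior is uniformly continuous and extends to the closure,
  which is K by convexity; the limit in \<open>trace_from\<close> is this extension.\<close>

lemma trace_W1inf: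
  fixes f :: "real^'n \<Rightarrow> real^'l"
  assumes f: "f \<in> W1inf (interior K)"
  shows "continuous_on K (trace_from K f)" and "x \<in> interior K \<Longrightarrow> trace_from K f x = f x"
proof -
  obtain C where C: "\<And>x y. x \<in> interior K \<Longrightarrow> y \<in> interior K \<Longrightarrow> norm (f x - f y) \<le> C * norm (x - y)"
    using W1inf_Lipschitz[OF f open_interior convex_interior[OF convex]] by blast
  have uc: "uniformly_continuous_on (interior K) f"
    unfolding uniformly_continuous_on_def
  proof (intro allI impI)
    fix e :: real assume e: "0 < e"
    \<comment> \<open>Dividing by \<open>\<bar>C\<bar> + 1\<close> is safe although C may be zero or
      negative.\<close>
    have "dist (f x') (f x) < e"
      if "x \<in> interior K" "x' \<in> interior K" "dist x' x < e / (\<bar>C\<bar> + 1)" for x x'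
    proof -
      have "dist (f x') (f x) \<le> C * norm (x' - x)" using C that by (simp add: dist_norm)
      also have "\<dots> \<le> (\<bar>C\<bar> + 1) * norm (x' - x)" by (intro mult_right_mono) auto
      also have "\<dots> < e" using that(3) by (simp add: dist_norm field_simps)
      finally show ?thesis .
    qed
    then show "\<exists>d>0. \<forall>x\<in>interior K. \<forall>x'\<in>interior K. dist x' x < d \<longrightarrow> dist (f x') (f x) < e"
      using e by (intro exI[of _ "e / (\<bar>C\<bar> + 1)"]) auto
  qed
  obtain g where g: "uniformly_continuous_on (closure (interior K)) g" "\<And>x. x \<in> interior K \<Longrightarrow> f x = g x"
    by (rule uniformly_continuous_on_extension_on_closure[OF uc], rule that)
  have cl: "closure (interior K) = K"
    using convex_closure_interior[OF convex interior_ne] closed by simp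
  have gc: "continuous_on K g" using g(1) uniformly_continuous_imp_continuous unfolding cl by blast
  have tr: "trace_from K f x = g x" if x: "x \<in> K" for x
    unfolding trace_from_def
  proof (rule tendsto_Lim)
    \<comment> \<open>Every point of K is a limit point of the interior, so the filter is proper and
      \<open>Lim\<close> has only one candidate.\<close>
    have "x islimpt interior K"
    proof (cases "x \<in> interior K")
      case True
      then show ?thesis using interior_limit_point[of x "interior K"] by simp
    next
      case False
      have "x \<in> closure (interior K)" using x cl by simp
      then show ?thesis using False unfolding closure_def by blast
    qed
    then show "at x within interior K \<noteq> bot" using trivial_limit_within[of x "interior K"] by simp
    have "(g \<longlongrightarrow> g x) (at x within interior K)"
      using gc x interior_subset tendsto_within_subset unfolding continuous_on_def by blast
    then show "(f \<longlongrightarrow> g x) (at x within interior K)"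
      by (rule Lim_transform_eventually) (auto simp: eventually_at_filter g(2))
  qed
  show "continuous_on K (trace_from K f)"
    using gc by (rule continuous_on_cong[THEN iffD1, rotated -1]) (simp_all add: tr)
  show "trace_from K f x = f x" if "x \<in> interior K"
    using tr[of x] g(2)[OF that] that interior_subset[of K] by auto
qed

lemma trace_bound:
  fixes f :: "real^'n \<Rightarrow> real^'l"
  assumes f: "f \<in> W1inf (interior K)" and c: "\<And>x. x \<in> interior K \<Longrightarrow> norm (f x) \<le> c" and x: "x \<in> K"
  shows "norm (trace_from K f x) \<le> c"
proof (rule continuous_on_closure_norm_le[where s = "interior K"])
  have cl: "closure (interior K) = K"
    using convex_closure_interior[OF convex interior_ne] closed by simp
  show "continuous_on (closure (interior K)) (trace_from K f)" "x \<in> closure (interior K)"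
    unfolding cl using trace_W1inf(1)[OF f] x by auto
  show "\<forall>y\<in>interior K. norm (trace_from K f y) \<le> c" using trace_W1inf(2)[OF f] c by simp
qed

end

section \<open>Algebra of essentially bounded functions\<close>

lemma Linf_mult_continuous:
  fixes f g :: "real^'n \<Rightarrow> real"
  assumes f: "f \<in> Linf U" and g: "continuous_on S g" "compact S" "U \<subseteq> S" and U: "U \<in> sets lebesgue"
  shows "(\<lambda>x. f x * g x) \<in> Linf U"
proof -
  obtain C where C: "AE x in lebesgue_on U. norm (f x) \<le> C" and m: "f \<in> borel_measurable (lebesgue_on U)"
    using f by (auto simp: Linf_def)
  obtain B where B: "\<And>x. x \<in> S \<Longrightarrow> \<bar>g x\<bar> \<le> B"
    using compact_imp_bounded[OF compact_continuous_image[OF g(1,2)]] by (auto simp: bounded_iff)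
  have "AE x in lebesgue_on U. norm (f x * g x) \<le> \<bar>C\<bar> * \<bar>B\<bar>"
    using C AE_space
  proof eventually_elim
    case (elim x)
    then have "x \<in> S" using g(3) by auto
    have "\<bar>f x\<bar> * \<bar>g x\<bar> \<le> \<bar>C\<bar> * \<bar>B\<bar>" using elim B[OF \<open>x \<in> S\<close>] by (intro mult_mono) auto
    then show ?case by (simp add: abs_mult)
  qed
  moreover have "g \<in> borel_measurable (lebesgue_on U)"
    by (rule continuous_imp_measurable_on_sets_lebesgue[OF continuous_on_subset[OF g(1,3)] U])
  ultimately show ?thesis using m by (auto simp: Linf_def)
qed

lemma Linf_add:
  assumes "f \<in> Linf U" "g \<in> Linf U" shows "(\<lambda>x. f x + g x) \<in> Linf U"
proof -
  obtain C B where C: "AE x in lebesgue_on U. norm (f x) \<le> C" and B: "AE x in lebesgue_on U. norm (g x) \<le> B"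
    and m: "f \<in> borel_measurable (lebesgue_on U)" "g \<in> borel_measurable (lebesgue_on U)"
    using assms by (auto simp: Linf_def)
  have "AE x in lebesgue_on U. norm (f x + g x) \<le> C + B"
    using C B by eventually_elim (rule norm_triangle_mono)
  then show ?thesis using m by (auto simp: Linf_def)
qed

lemma Linf_zero: "(\<lambda>x. 0) \<in> Linf U"
  unfolding Linf_def by (auto intro: exI[of _ 0])

lemma Linf_sum:
  "(\<And>i. i \<in> I \<Longrightarrow> f i \<in> Linf U) \<Longrightarrow> (\<lambda>x. \<Sum>i\<in>I. f i x) \<in> Linf U"
  by (induction I rule: infinite_finite_induct) (simp_all add: Linf_add Linf_zero)

lemma Linf_scale:
  fixes f :: "real^'n \<Rightarrow> real"
  assumes "f \<in> Linf U" shows "(\<lambda>x. c * f x) \<in> Linf U"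
proof -
  obtain C where C: "AE x in lebesgue_on U. norm (f x) \<le> C" and m: "f \<in> borel_measurable (lebesgue_on U)"
    using assms by (auto simp: Linf_def)
  have "AE x in lebesgue_on U. norm (c * f x) \<le> \<bar>c\<bar> * C"
    using C by eventually_elim (simp add: abs_mult mult_left_mono)
  then show ?thesis using m by (auto simp: Linf_def)
qed

lemma Linf_nth:
  assumes "f \<in> Linf U" shows "(\<lambda>x. f x $ i) \<in> Linf U"
proof -
  obtain C where C: "AE x in lebesgue_on U. norm (f x) \<le> C" and m: "f \<in> borel_measurable (lebesgue_on U)"
    using assms by (auto simp: Linf_def)
  have "AE x in lebesgue_on U. norm (f x $ i) \<le> C"
    using C
  proof eventually_elim
    case (elim x)
    then show ?case using Finite_Cartesian_Product.norm_nth_le[of "f x" i] by simp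
  qed
  moreover have "(\<lambda>x. f x $ i) \<in> borel_measurable (lebesgue_on U)"
    by (rule measurable_compose[OF m]) (auto intro!: borel_measurable_continuous_onI continuous_intros)
  ultimately show ?thesis by (auto simp: Linf_def)
qed

lemma Linf_vec_lambda:
  fixes f :: "'i::finite \<Rightarrow> real^'n \<Rightarrow> 'b::euclidean_space"
  assumes "\<And>i. f i \<in> Linf U" shows "(\<lambda>x. \<chi> i. f i x) \<in> Linf U"
proof -
  obtain C where C: "\<And>i. AE x in lebesgue_on U. norm (f i x) \<le> C i"
    using assms by (simp add: Linf_def) metis
  have m: "\<And>i. f i \<in> borel_measurable (lebesgue_on U)" using assms by (simp add: Linf_def)
  have "AE x in lebesgue_on U. \<forall>i\<in>UNIV. norm (f i x) \<le> C i"
    using C by (intro AE_finite_allI) auto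
  then have "AE x in lebesgue_on U. norm (\<chi> i. f i x) \<le> (\<Sum>i\<in>UNIV. C i)"
  proof eventually_elim
    case (elim x)
    have "norm (\<chi> i. f i x) \<le> (\<Sum>i\<in>UNIV. norm ((\<chi> i. f i x) $ i))" unfolding norm_vec_def by (rule L2_set_le_sum) simp
    also have "\<dots> \<le> (\<Sum>i\<in>UNIV. C i)" using elim by (intro sum_mono) simp
    finally show ?case .
  qed
  moreover have "(\<lambda>x. \<chi> i. f i x) \<in> borel_measurable (lebesgue_on U)"
  proof (rule borel_measurable_euclidean_space[THEN iffD2], rule ballI)
    fix b :: "'b^'i" assume "b \<in> Basis"
    then obtain i c where "b = axis i c" by (auto simp: Basis_vec_def)
    then show "(\<lambda>x. (\<chi> i. f i x) \<bullet> b) \<in> borel_measurable (lebesgue_on U)"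
      using m[of i] by (simp add: inner_axis)
  qed
  ultimately show ?thesis by (auto simp: Linf_def)
qed

lemma Linf_integrable:
  fixes f :: "real^'n \<Rightarrow> real"
  assumes f: "f \<in> Linf U" and U: "bounded U" "U \<in> sets lebesgue"
  shows "integrable (lebesgue_on U) f"
proof -
  obtain C where C: "AE x in lebesgue_on U. norm (f x) \<le> C" and m: "f \<in> borel_measurable (lebesgue_on U)"
    using f by (auto simp: Linf_def)
  have "U \<in> lmeasurable" using U by (rule bounded_set_imp_lmeasurable)
  then interpret finite_measure "lebesgue_on U" by (rule finite_measure_lebesgue_on)
  show ?thesis
    by (rule integrable_const_bound[OF C m])
qed

lemma Linf_continuous:
  fixes f :: "real^'n \<Rightarrow> real"
  assumes "continuous_on S f" "compact S" "U \<subseteq> S" "U \<in> sets lebesgue"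
  shows "f \<in> Linf U"
proof -
  have "(\<lambda>x. 1 :: real) \<in> Linf U" by (auto simp: Linf_def intro!: exI[of _ 1])
  from Linf_mult_continuous[OF this assms] show ?thesis by simp
qed

text \<open>The polynomial factor is moved onto the test function: f times \<phi> is again a test
  function, with gradient given by the classical product rule.\<close>

lemma (in full_polytope) weak_derivative_mult_polys:
  fixes h D :: "real^'n \<Rightarrow> real"
  assumes h: "continuous_on K h" and D: "D \<in> Linf (interior K)"
    and weak: "\<And>\<phi> \<psi>. test_function (interior K) \<phi> \<psi> \<Longrightarrow>
      (LINT x|lebesgue_on (interior K). h x * \<psi> x $ j) = - (LINT x|lebesgue_on (interior K). D x * \<phi> x)"
    and f: "f \<in> polys k" and T: "test_function (interior K) \<phi> \<psi>"
  shows "(LINT x|lebesgue_on (interior K). (f x * h x) * \<psi> x $ j)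
    = - (LINT x|lebesgue_on (interior K). (f x * D x + pd f j x * h x) * \<phi> x)"
proof -
  let ?U = "interior K"
  have bU: "bounded ?U" "?U \<in> sets lebesgue"
    using compact_imp_bounded[OF compact] bounded_subset[OF _ interior_subset] by auto
  have fc: "continuous_on S f" "continuous_on S (pd f j)" for S
    using polys_continuous[OF f] polys_continuous[OF pd_polys[OF f]] by auto
  have ints: "integrable (lebesgue_on ?U) g" if "continuous_on K g" for g :: "real^'n \<Rightarrow> real"
    by (rule Linf_integrable[OF Linf_continuous[OF that compact interior_subset bU(2)] bU])
  have T': "test_function ?U (\<lambda>x. f x * \<phi> x) (\<lambda>x. f x *\<^sub>R \<psi> x + \<phi> x *\<^sub>R (\<chi> i. pd f i x))"
  proof -
    have "GDERIV (\<lambda>x. f x * \<phi> x) x :> f x *\<^sub>R \<psi> x + \<phi> x *\<^sub>R (\<chi> i. pd f i x)" for x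
      unfolding gderiv_def
    proof (rule has_derivative_eq_rhs[OF has_derivative_mult[OF polys_has_derivative[OF f]]])
      show "(\<phi> has_derivative (\<lambda>h. h \<bullet> \<psi> x)) (at x)" using T by (simp add: test_function_def gderiv_def)
    qed (simp add: fun_eq_iff inner_vec_def sum_distrib_left sum_distrib_right sum.distrib distrib_left mult_ac)
    moreover have "continuous_on UNIV (\<lambda>x. f x *\<^sub>R \<psi> x + \<phi> x *\<^sub>R (\<chi> i. pd f i x))"
      using polys_continuous[OF f] polys_continuous[OF pd_polys[OF f]] test_function_measurable(3,4)[OF T]
      by (intro continuous_intros continuous_on_vec_lambda)
    moreover have sub: "closure {x. f x * \<phi> x \<noteq> 0} \<subseteq> closure {x. \<phi> x \<noteq> 0}" by (intro closure_mono) auto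
    moreover have "compact (closure {x. f x * \<phi> x \<noteq> 0})"
    proof -
      have "compact (closure {x. \<phi> x \<noteq> 0})" using T by (simp add: test_function_def)
      from bounded_subset[OF compact_imp_bounded[OF this] sub]
      show ?thesis by (simp only: compact_eq_bounded_closed closed_closure)
    qed
    ultimately show ?thesis using T unfolding test_function_def by blast
  qed
  have \<phi>c: "continuous_on S \<phi>" "continuous_on S \<psi>" for S using test_function_measurable(3,4)[OF T] by auto
  have i1: "integrable (lebesgue_on ?U) (\<lambda>x. (f x * h x) * \<psi> x $ j)"
    "integrable (lebesgue_on ?U) (\<lambda>x. (pd f j x * h x) * \<phi> x)"
    using fc h \<phi>c by (auto intro!: ints continuous_intros)
  have i2: "integrable (lebesgue_on ?U) (\<lambda>x. D x * (f x * \<phi> x))"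
    by (rule Linf_integrable[OF Linf_mult_continuous[OF D _ compact interior_subset bU(2)] bU])
      (intro continuous_intros fc \<phi>c)
  have "(LINT x|lebesgue_on ?U. h x * (f x *\<^sub>R \<psi> x + \<phi> x *\<^sub>R (\<chi> i. pd f i x)) $ j) = - (LINT x|lebesgue_on ?U. D x * (f x * \<phi> x))"
    by (rule weak[OF T'])
  then have "(LINT x|lebesgue_on ?U. (f x * h x) * \<psi> x $ j + (pd f j x * h x) * \<phi> x) = - (LINT x|lebesgue_on ?U. D x * (f x * \<phi> x))"
    by (simp add: distrib_left mult_ac)
  then have "(LINT x|lebesgue_on ?U. (f x * h x) * \<psi> x $ j) = - ((LINT x|lebesgue_on ?U. (pd f j x * h x) * \<phi> x) + (LINT x|lebesgue_on ?U. D x * (f x * \<phi> x)))"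
    using i1 by simp
  also have "\<dots> = - (LINT x|lebesgue_on ?U. (pd f j x * h x) * \<phi> x + D x * (f x * \<phi> x))"
    using i1 i2 by simp
  also have "\<dots> = - (LINT x|lebesgue_on ?U. (f x * D x + pd f j x * h x) * \<phi> x)"
    by (simp add: distrib_left distrib_right mult_ac add_ac)
  finally show ?thesis .
qed

text \<open>\<open>weak_jac\<close> is a Hilbert choice and carries information only once a bounded
  weak Jacobian exists. For v x d it is assembled from the product rule, the bilinear map entering
  through its coefficients.\<close>

lemma (in full_polytope) weak_jacobian_bilinear:
  fixes B :: "real^'n \<Rightarrow> real^'n \<Rightarrow> real^'m" and d :: "real^'n \<Rightarrow> real^'n"
  assumes B: "\<And>a b i. B a b $ i = (\<Sum>p\<in>UNIV. \<Sum>q\<in>UNIV. a $ p * b $ q * \<beta> i p q)"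
    and d: "continuous_on K d" "D \<in> Linf (interior K)" "weak_jacobian (interior K) d D"
    and v: "\<And>p. (\<lambda>x. v x $ p) \<in> polys k"
  shows "\<exists>E \<in> Linf (interior K). weak_jacobian (interior K) (\<lambda>x. B (v x) (d x)) E"
proof (intro bexI)
  let ?U = "interior K"
  have bU: "bounded ?U" "?U \<in> sets lebesgue"
    using compact_imp_bounded[OF compact] bounded_subset[OF _ interior_subset] by auto
  let ?w = "\<lambda>p q j x. v x $ p * D x $ q $ j + pd (\<lambda>x. v x $ p) j x * d x $ q"
  let ?E = "\<lambda>x. \<chi> i j. \<Sum>p\<in>UNIV. \<Sum>q\<in>UNIV. \<beta> i p q * ?w p q j x"
  have vc: "continuous_on K (\<lambda>x. v x $ p)" "continuous_on K (pd (\<lambda>x. v x $ p) j)" for p j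
    using polys_continuous[OF v] polys_continuous[OF pd_polys[OF v]] by auto
  have dc: "continuous_on K (\<lambda>x. d x $ q)" for q by (intro continuous_intros d(1))
  have w: "?w p q j \<in> Linf ?U" for p q j
  proof (rule Linf_add)
    show "(\<lambda>x. v x $ p * D x $ q $ j) \<in> Linf ?U"
      using Linf_mult_continuous[OF Linf_nth[OF Linf_nth[OF d(2)]] vc(1) compact interior_subset bU(2)]
      by (simp add: mult.commute)
    show "(\<lambda>x. pd (\<lambda>x. v x $ p) j x * d x $ q) \<in> Linf ?U"
      by (rule Linf_continuous[OF _ compact interior_subset bU(2)]) (intro continuous_intros vc dc)
  qed
  show "?E \<in> Linf ?U" by (intro Linf_vec_lambda Linf_sum Linf_scale w)
  show "weak_jacobian ?U (\<lambda>x. B (v x) (d x)) ?E"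
    unfolding weak_jacobian_def
  proof (intro allI impI)
    fix \<phi> \<psi> i j assume T: "test_function ?U \<phi> \<psi>"
    have \<phi>c: "continuous_on S \<phi>" "continuous_on S \<psi>" for S using test_function_measurable(3,4)[OF T] by auto
    have i1: "integrable (lebesgue_on ?U) (\<lambda>x. (v x $ p * d x $ q) * \<psi> x $ j)" for p q
      by (rule Linf_integrable[OF Linf_continuous[OF _ compact interior_subset bU(2)] bU])
        (intro continuous_intros vc dc \<phi>c)
    have i2: "integrable (lebesgue_on ?U) (\<lambda>x. ?w p q j x * \<phi> x)" for p q
      by (rule Linf_integrable[OF Linf_mult_continuous[OF w _ compact interior_subset bU(2)] bU]) (rule \<phi>c)
    have "(LINT x|lebesgue_on ?U. B (v x) (d x) $ i * \<psi> x $ j)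
        = (LINT x|lebesgue_on ?U. (\<Sum>p\<in>UNIV. \<Sum>q\<in>UNIV. \<beta> i p q * ((v x $ p * d x $ q) * \<psi> x $ j)))"
      by (simp add: B sum_distrib_right sum_distrib_left mult_ac)
    also have "\<dots> = (\<Sum>p\<in>UNIV. \<Sum>q\<in>UNIV. \<beta> i p q * (LINT x|lebesgue_on ?U. (v x $ p * d x $ q) * \<psi> x $ j))"
      using i1 by simp
    also have "\<dots> = (\<Sum>p\<in>UNIV. \<Sum>q\<in>UNIV. \<beta> i p q * - (LINT x|lebesgue_on ?U. ?w p q j x * \<phi> x))"
    proof (intro sum.cong refl arg_cong2[where f = "(*)"])
      fix p q
      show "(LINT x|lebesgue_on ?U. (v x $ p * d x $ q) * \<psi> x $ j) = - (LINT x|lebesgue_on ?U. ?w p q j x * \<phi> x)"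
      proof (rule weak_derivative_mult_polys[OF dc _ _ v T])
        show "(\<lambda>x. D x $ q $ j) \<in> Linf ?U" by (intro Linf_nth d)
        show "(LINT x|lebesgue_on ?U. d x $ q * \<psi> x $ j) = - (LINT x|lebesgue_on ?U. D x $ q $ j * \<phi> x)"
          if "test_function ?U \<phi> \<psi>" for \<phi> \<psi>
          using d(3) that unfolding weak_jacobian_def by blast
      qed
    qed
    also have "\<dots> = - (LINT x|lebesgue_on ?U. (\<Sum>p\<in>UNIV. \<Sum>q\<in>UNIV. \<beta> i p q * (?w p q j x * \<phi> x)))"
      using i2 by (simp add: sum_negf)
    also have "\<dots> = - (LINT x|lebesgue_on ?U. ?E x $ i $ j * \<phi> x)"
      by (simp add: sum_distrib_right mult.assoc)
    finally show "(LINT x|lebesgue_on ?U. B (v x) (d x) $ i * \<psi> x $ j) = - (LINT x|lebesgue_on ?U. ?E x $ i $ j * \<phi> x)" .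
  qed
qed

section \<open>Vector-valued polynomials\<close>

definition vpoly :: "nat \<Rightarrow> (real^'n \<Rightarrow> real^'l) \<Rightarrow> bool" where
  "vpoly k u \<longleftrightarrow> (\<forall>i. (\<lambda>x. u x $ i) \<in> polys k)"

definition mpoly :: "nat \<Rightarrow> (real^'n \<Rightarrow> real^'l^'m) \<Rightarrow> bool" where
  "mpoly k G \<longleftrightarrow> (\<forall>i j. (\<lambda>x. G x $ i $ j) \<in> polys k)"

text \<open>This and the next three are whole-space counterparts of \<open>grad\<close>,
  \<open>jac\<close>, \<open>div_v\<close> and \<open>div_m\<close>. They agree with these at
  interior points, and the interior carries every volume integral.\<close>

definition gr :: "(real^'n \<Rightarrow> real) \<Rightarrow> real^'n \<Rightarrow> real^'n" where
  "gr q x = (\<chi> j. pd q j x)"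

definition Dv :: "(real^'n \<Rightarrow> real^'l) \<Rightarrow> real^'n \<Rightarrow> real^'n^'l" where
  "Dv u x = (\<chi> i j. pd (\<lambda>y. u y $ i) j x)"

definition dvg :: "(real^'n \<Rightarrow> real^'n) \<Rightarrow> real^'n \<Rightarrow> real" where
  "dvg u x = (\<Sum>j\<in>UNIV. pd (\<lambda>y. u y $ j) j x)"

definition dvm :: "(real^'n \<Rightarrow> real^'n^'l) \<Rightarrow> real^'n \<Rightarrow> real^'l" where
  "dvm G x = (\<chi> i. \<Sum>j\<in>UNIV. pd (\<lambda>y. G y $ i $ j) j x)"

lemma vpolyD: "vpoly k u \<Longrightarrow> (\<lambda>x. u x $ i) \<in> polys k"
  by (simp add: vpoly_def)

lemma mpolyD: "mpoly k G \<Longrightarrow> (\<lambda>x. G x $ i $ j) \<in> polys k"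
  by (simp add: mpoly_def)

lemma vpoly_lin: "vpoly k u \<Longrightarrow> vpoly k v \<Longrightarrow> vpoly k (\<lambda>x. u x + t *\<^sub>R v x)"
  by (simp add: vpoly_def polys_lin)

lemma mpoly_lin: "mpoly k u \<Longrightarrow> mpoly k v \<Longrightarrow> mpoly k (\<lambda>x. u x + t *\<^sub>R v x)"
  by (simp add: mpoly_def polys_lin)

lemma vpoly_zero: "vpoly k (\<lambda>x. 0)" and mpoly_zero: "mpoly k (\<lambda>x. 0)"
  by (simp_all add: vpoly_def mpoly_def polys_zero)

lemma vpoly_continuous:
  assumes "vpoly k u" shows "continuous_on S u"
proof -
  have "continuous_on S (\<lambda>x. \<chi> i. u x $ i)"
    by (intro continuous_on_vec_lambda polys_continuous[OF vpolyD[OF assms]])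
  then show ?thesis by simp
qed

lemma mpoly_continuous:
  assumes "mpoly k u" shows "continuous_on S u"
proof -
  have "continuous_on S (\<lambda>x. \<chi> i j. u x $ i $ j)"
    by (intro continuous_on_vec_lambda polys_continuous[OF mpolyD[OF assms]])
  then show ?thesis by simp
qed

lemma gr_vpoly: "q \<in> polys k \<Longrightarrow> vpoly (k - 1) (gr q)"
  unfolding vpoly_def gr_def vec_lambda_beta by (intro allI pd_polys)

lemma Dv_mpoly: "vpoly k u \<Longrightarrow> mpoly (k - 1) (Dv u)"
  unfolding mpoly_def Dv_def vec_lambda_beta by (intro allI pd_polys vpolyD)

lemma dvg_polys: "vpoly k u \<Longrightarrow> dvg u \<in> polys (k - 1)"
  unfolding dvg_def[abs_def] by (intro polys_sum pd_polys vpolyD)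

lemma dvm_vpoly: "mpoly k G \<Longrightarrow> vpoly (k - 1) (dvm G)"
  unfolding vpoly_def dvm_def vec_lambda_beta by (intro allI polys_sum pd_polys mpolyD)

lemma mpoly_mono: "mpoly k u \<Longrightarrow> k \<le> l \<Longrightarrow> mpoly l u"
  using polys_le unfolding mpoly_def by blast

lemma gr_lin: "q \<in> polys k \<Longrightarrow> q' \<in> polys k \<Longrightarrow> gr (\<lambda>x. q x + t * q' x) x = gr q x + t *\<^sub>R gr q' x"
  by (simp add: gr_def vec_eq_iff pd_lin)

lemma Dv_lin: "vpoly k u \<Longrightarrow> vpoly k v \<Longrightarrow> Dv (\<lambda>x. u x + t *\<^sub>R v x) x = Dv u x + t *\<^sub>R Dv v x"
  by (simp add: Dv_def vec_eq_iff pd_lin[OF vpolyD vpolyD])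

lemma dvg_lin: "vpoly k u \<Longrightarrow> vpoly k v \<Longrightarrow> dvg (\<lambda>x. u x + t *\<^sub>R v x) x = dvg u x + t * dvg v x"
  by (simp add: dvg_def pd_lin[OF vpolyD vpolyD] sum.distrib sum_distrib_left)

lemma dvm_lin: "mpoly k u \<Longrightarrow> mpoly k v \<Longrightarrow> dvm (\<lambda>x. u x + t *\<^sub>R v x) x = dvm u x + t *\<^sub>R dvm v x"
  by (simp add: dvm_def vec_eq_iff pd_lin[OF mpolyD mpolyD] sum.distrib sum_distrib_left)

lemma jets_zero [simp]: "gr (\<lambda>x. 0) x = 0" "Dv (\<lambda>x. 0) x = 0" "dvg (\<lambda>x. 0) x = 0" "dvm (\<lambda>x. 0) x = 0"
  by (simp_all add: gr_def Dv_def dvg_def dvm_def vec_eq_iff)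

lemma vpoly_has_derivative:
  assumes "vpoly k u" shows "(u has_derivative (\<lambda>h. Dv u x *v h)) (at x)"
proof -
  have "((\<lambda>x. u x \<bullet> e) has_derivative (\<lambda>h. (Dv u x *v h) \<bullet> e)) (at x)" if eB: "e \<in> Basis" for e
  proof -
    obtain i where e: "e = axis i 1" using eB by (auto simp: Basis_vec_def)
    show ?thesis
      unfolding e inner_axis
      by (rule has_derivative_eq_rhs)
        (use polys_has_derivative[OF vpolyD[OF assms], of i x UNIV] in \<open>auto simp: matrix_vector_mult_def Dv_def mult.commute\<close>)
  qed
  then show ?thesis by (subst has_derivative_componentwise_within) blast
qed

text \<open>At an interior point differentiation within K is ordinary differentiation, so only the
  values of the polynomial on K matter.\<close>

lemma jac_interior:
  assumes u: "vpoly k u" and eq: "\<And>y. y \<in> K \<Longrightarrow> f y = u y" and x: "x \<in> interior K"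
  shows "jac K f x = Dv u x"
proof -
  have "(f has_derivative (\<lambda>h. Dv u x *v h)) (at x)"
    by (rule has_derivative_transform_within_open[OF vpoly_has_derivative[OF u] open_interior x])
      (use eq interior_subset in \<open>metis subsetD\<close>)
  then have "frechet_derivative f (at x) = (\<lambda>h. Dv u x *v h)"
    by (rule frechet_derivative_at[symmetric])
  then show ?thesis
    using at_within_interior[OF x] by (simp add: jac_def jacobian_def)
qed

lemma grad_interior:
  assumes u: "q \<in> polys k" and eq: "\<And>y. y \<in> K \<Longrightarrow> f y = q y" and x: "x \<in> interior K"
  shows "grad K f x = gr q x"
proof -
  have "(f has_derivative (\<lambda>h. \<Sum>j\<in>UNIV. h $ j * pd q j x)) (at x)"
    by (rule has_derivative_transform_within_open[OF polys_has_derivative[OF u] open_interior x])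
      (use eq interior_subset in \<open>metis subsetD\<close>)
  then have "pd f j x = pd q j x" for j by (rule pd_eqI)
  then show ?thesis
    using at_within_interior[OF x] by (simp add: grad_def gr_def pd_def)
qed

lemma div_v_interior:
  assumes "vpoly k u" "\<And>y. y \<in> K \<Longrightarrow> f y = u y" "x \<in> interior K"
  shows "div_v K f x = dvg u x"
  by (simp add: div_v_def jac_interior[OF assms] Dv_def dvg_def)

lemma div_m_interior:
  assumes "mpoly k G" "\<And>y. y \<in> K \<Longrightarrow> f y = G y" "x \<in> interior K"
  shows "div_m K f x = dvm G x"
proof -
  have "div_v K (\<lambda>y. f y $ i) x = dvg (\<lambda>y. G y $ i) x" for i
    using assms by (intro div_v_interior[where k = k]) (auto simp: mpoly_def vpoly_def)
  then show ?thesis by (simp add: div_m_def dvm_def dvg_def)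
qed

lemma poly_v_restrict:
  "poly_v k S = (\<lambda>u. restrict u S) ` {u. vpoly k u}"
proof (intro set_eqI iffI)
  fix f assume f: "f \<in> poly_v k S"
  have "\<exists>g\<in>polys k. (\<lambda>x\<in>S. f x $ i) = restrict g S" for i
    using f by (auto simp: poly_v_def poly_s_restrict)
  then obtain g where g: "\<And>i. g i \<in> polys k" "\<And>i. (\<lambda>x\<in>S. f x $ i) = restrict (g i) S" by metis
  have "f x $ i = g i x" if "x \<in> S" for x i
    using fun_cong[OF g(2)[of i], of x] that by simp
  then have "f = restrict (\<lambda>x. \<chi> i. g i x) S"
    using f by (auto simp: poly_v_def extensional_def restrict_def fun_eq_iff vec_eq_iff)
  moreover have "vpoly k (\<lambda>x. \<chi> i. g i x)" using g(1) by (simp add: vpoly_def)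
  ultimately show "f \<in> (\<lambda>u. restrict u S) ` {u. vpoly k u}" by blast
next
  fix f assume "f \<in> (\<lambda>u. restrict u S) ` {u. vpoly k u}"
  then obtain u where u: "vpoly k u" "f = restrict u S" by blast
  have "(\<lambda>x\<in>S. f x $ i) = restrict (\<lambda>x. u x $ i) S" for i
    by (auto simp: u(2) restrict_def fun_eq_iff)
  then show "f \<in> poly_v k S" using u by (auto simp: poly_v_def poly_s_restrict vpoly_def)
qed

lemma poly_m_restrict:
  "poly_m k S = (\<lambda>u. restrict u S) ` {u. mpoly k u}"
proof (intro set_eqI iffI)
  fix f assume f: "f \<in> poly_m k S"
  have "\<exists>g\<in>polys k. (\<lambda>x\<in>S. f x $ i $ j) = restrict g S" for i j
    using f by (auto simp: poly_m_def poly_s_restrict)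
  then obtain g where g: "\<And>i j. g i j \<in> polys k" "\<And>i j. (\<lambda>x\<in>S. f x $ i $ j) = restrict (g i j) S" by metis
  have "f x $ i $ j = g i j x" if "x \<in> S" for x i j
    using fun_cong[OF g(2)[of i j], of x] that by simp
  then have "f = restrict (\<lambda>x. \<chi> i j. g i j x) S"
    using f by (auto simp: poly_m_def extensional_def restrict_def fun_eq_iff vec_eq_iff)
  moreover have "mpoly k (\<lambda>x. \<chi> i j. g i j x)" using g(1) by (simp add: mpoly_def)
  ultimately show "f \<in> (\<lambda>u. restrict u S) ` {u. mpoly k u}" by blast
next
  fix f assume "f \<in> (\<lambda>u. restrict u S) ` {u. mpoly k u}"
  then obtain u where u: "mpoly k u" "f = restrict u S" by blast
  have "(\<lambda>x\<in>S. f x $ i $ j) = restrict (\<lambda>x. u x $ i $ j) S" for i j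
    by (auto simp: u(2) restrict_def fun_eq_iff)
  then show "f \<in> poly_m k S" using u by (auto simp: poly_m_def poly_s_restrict mpoly_def)
qed

text \<open>The degree may differ from one basis direction to another, so that all six unknowns, of
  degrees k and k - 1, fit into one finitely spanned space.\<close>

lemma polynomial_space_span:
  fixes dg :: "'v::euclidean_space \<Rightarrow> nat"
  shows "{Z :: real^'n \<Rightarrow> 'v. \<forall>e\<in>Basis. (\<lambda>x. Z x \<bullet> e) \<in> polys (dg e)}
    = range (\<lambda>c x. \<Sum>i\<in>(SIGMA e:Basis. {a. sum a UNIV \<le> dg e}). c i *\<^sub>R (mpow (snd i) x *\<^sub>R fst i))"
    (is "?X = range (\<lambda>c x. \<Sum>i\<in>?I. _ c i x)")
proof (intro set_eqI iffI)
  fix Z assume "Z \<in> ?X"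
  then have "\<forall>e\<in>Basis. \<exists>c. (\<lambda>x. Z x \<bullet> e) = (\<lambda>x. \<Sum>a | sum a UNIV \<le> dg e. c a * mpow a x)"
    by (auto simp: polys_def)
  then obtain c where c: "\<And>e. e \<in> Basis \<Longrightarrow> (\<lambda>x. Z x \<bullet> e) = (\<lambda>x. \<Sum>a | sum a UNIV \<le> dg e. c e a * mpow a x)"
    by metis
  have "Z x = (\<Sum>i\<in>?I. c (fst i) (snd i) *\<^sub>R (mpow (snd i) x *\<^sub>R fst i))" for x
  proof -
    have "Z x = (\<Sum>e\<in>Basis. (Z x \<bullet> e) *\<^sub>R e)" by (simp add: euclidean_representation)
    also have "\<dots> = (\<Sum>e\<in>Basis. \<Sum>a | sum a UNIV \<le> dg e. c e a *\<^sub>R (mpow a x *\<^sub>R e))"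
      by (intro sum.cong refl) (simp add: fun_cong[OF c] scaleR_sum_left)
    also have "\<dots> = (\<Sum>i\<in>?I. c (fst i) (snd i) *\<^sub>R (mpow (snd i) x *\<^sub>R fst i))"
      by (subst sum.Sigma) (auto simp: finite_multiindices split_beta)
    finally show ?thesis .
  qed
  then have "Z = (\<lambda>x. \<Sum>i\<in>?I. c (fst i) (snd i) *\<^sub>R (mpow (snd i) x *\<^sub>R fst i))" by (rule ext)
  then show "Z \<in> range (\<lambda>c x. \<Sum>i\<in>?I. c i *\<^sub>R (mpow (snd i) x *\<^sub>R fst i))"
    by (rule image_eqI[where x = "\<lambda>i. c (fst i) (snd i)"]) simp
next
  fix Z assume "Z \<in> range (\<lambda>c x. \<Sum>i\<in>?I. c i *\<^sub>R (mpow (snd i) x *\<^sub>R fst i))"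
  then obtain c where Z: "Z = (\<lambda>x. \<Sum>i\<in>?I. c i *\<^sub>R (mpow (snd i) x *\<^sub>R fst i))" by blast
  have "(\<lambda>x. Z x \<bullet> e) \<in> polys (dg e)" if e: "e \<in> Basis" for e
  proof -
    have "(\<lambda>x. Z x \<bullet> e) = (\<lambda>x. \<Sum>i\<in>?I. c i * (mpow (snd i) x * (fst i \<bullet> e)))"
      by (simp add: Z inner_sum_left mult.assoc)
    moreover have "(\<lambda>x. c i * (mpow (snd i) x * (fst i \<bullet> e))) \<in> polys (dg e)" if "i \<in> ?I" for i
    proof (cases "fst i = e")
      case True
      then show ?thesis using that e by (auto simp: inner_same_Basis intro!: polys_scale mpow_polys)
    next
      case False
      then show ?thesis using that e by (auto simp: inner_not_same_Basis polys_zero)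
    qed
    ultimately show ?thesis using polys_sum[of ?I "\<lambda>i x. c i * (mpow (snd i) x * (fst i \<bullet> e))"] by simp
  qed
  then show "Z \<in> ?X" by blast
qed

section \<open>Integrals over an element and over its boundary\<close>

context full_polytope
begin

definition IK :: "(real^'n \<Rightarrow> real) \<Rightarrow> real" where
  "IK h = (LINT x|lebesgue_on K. h x)"

definition IB :: "((real^'n) set \<Rightarrow> real^'n \<Rightarrow> real) \<Rightarrow> real" where
  "IB h = (\<Sum>F | F facet_of K. LINT x|facet_measure (normal K F) F. h F x)"

text \<open>Continuity is asked on each facet separately, because fluxes jump with the normal where
  facets meet; compactness of the facets then gives integrability.\<close>

definition bcont :: "((real^'n) set \<Rightarrow> real^'n \<Rightarrow> 'b::topological_space) \<Rightarrow> bool" where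
  "bcont h \<longleftrightarrow> (\<forall>F. F facet_of K \<longrightarrow> continuous_on F (h F))"

lemma IK_lin:
  assumes "integrable (lebesgue_on K) f" "integrable (lebesgue_on K) g"
  shows "IK (\<lambda>x. f x + t * g x) = IK f + t * IK g"
  using assms by (simp add: IK_def)

lemma IK_add: "continuous_on K f \<Longrightarrow> continuous_on K g \<Longrightarrow> IK (\<lambda>x. f x + g x) = IK f + IK g"
  by (simp add: IK_def integrable_continuous)

lemma IK_diff: "continuous_on K f \<Longrightarrow> continuous_on K g \<Longrightarrow> IK (\<lambda>x. f x - g x) = IK f - IK g"
  by (simp add: IK_def integrable_continuous)

lemma IK_cmult: "IK (\<lambda>x. c * f x) = c * IK f"
  by (simp add: IK_def)

lemma IK_minus: "IK (\<lambda>x. - f x) = - IK f"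
  by (simp add: IK_def)

lemma IK_cong: "(\<And>x. x \<in> interior K \<Longrightarrow> f x = g x) \<Longrightarrow> IK f = IK g"
  unfolding IK_def lebesgue_on_interior(3) by (rule lebesgue_on_cong_integral)

text \<open>Zero almost everywhere, then on the whole interior because a null open set is empty,
  then on K by density.\<close>

lemma IK_eq_0_imp:
  assumes f: "continuous_on K f" and nn: "\<And>x. x \<in> K \<Longrightarrow> 0 \<le> f x" and z: "IK f = 0" and x: "x \<in> K"
  shows "f x = 0"
proof -
  have "AE x in lebesgue_on K. f x = 0"
    using z nn integral_nonneg_eq_0_iff_AE[OF integrable_continuous[OF f]]
    unfolding IK_def by (auto simp: AE_restrict_space_iff closed)
  then have "AE x in lebesgue_on (interior K). norm (f x) \<le> 0"
    using closed by (auto simp: AE_restrict_space_iff interior_subset[THEN subsetD] elim!: eventually_mono)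
  then have "\<And>x. x \<in> interior K \<Longrightarrow> norm (f x) \<le> 0"
    by (rule continuous_AE_bound[OF open_interior continuous_on_subset[OF f interior_subset]])
  moreover have "closure (interior K) = K"
    using convex_closure_interior[OF convex interior_ne] closed by simp
  ultimately have "norm (f x) \<le> 0"
    using continuous_on_closure_norm_le[of "interior K" f 0 x] f x by simp
  then show ?thesis by simp
qed

lemma bint: "bcont h \<Longrightarrow> F facet_of K \<Longrightarrow> integrable (facet_measure (normal K F) F) (h F)"
  for h :: "(real^'n) set \<Rightarrow> real^'n \<Rightarrow> real"
  using facet_integral(1) by (simp add: bcont_def)

lemma IB_lin: "bcont f \<Longrightarrow> bcont g \<Longrightarrow> IB (\<lambda>F x. f F x + t * g F x) = IB f + t * IB g"
  unfolding IB_def using bint[of f] bint[of g] by (simp add: sum.distrib sum_distrib_left)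

lemma IB_add: "bcont f \<Longrightarrow> bcont g \<Longrightarrow> IB (\<lambda>F x. f F x + g F x) = IB f + IB g"
  using IB_lin[of f g 1] by simp

lemma IB_diff: "bcont f \<Longrightarrow> bcont g \<Longrightarrow> IB (\<lambda>F x. f F x - g F x) = IB f - IB g"
  using IB_lin[of f g "-1"] by simp

lemma IB_cmult: "IB (\<lambda>F x. c * f F x) = c * IB f"
  by (simp add: IB_def sum_distrib_left)

lemma IB_minus: "IB (\<lambda>F x. - f F x) = - IB f"
  by (simp add: IB_def sum_negf)

lemma IB_cong: "(\<And>F x. F facet_of K \<Longrightarrow> x \<in> F \<Longrightarrow> f F x = g F x) \<Longrightarrow> IB f = IB g"
  unfolding IB_def by (intro sum.cong refl Bochner_Integration.integral_cong) (auto simp: space_facet_measure)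

lemma IB_cong_AE:
  assumes "bcont f" "bcont g" "\<And>F. F facet_of K \<Longrightarrow> AE x in facet_measure (normal K F) F. f F x = g F x"
  shows "IB f = IB g"
  unfolding IB_def
  by (intro sum.cong refl integral_cong_AE borel_measurable_integrable bint) (use assms in auto)

lemma IB_nonneg: "(\<And>F x. F facet_of K \<Longrightarrow> x \<in> F \<Longrightarrow> 0 \<le> f F x) \<Longrightarrow> 0 \<le> IB f"
  unfolding IB_def by (intro sum_nonneg integral_nonneg_AE AE_I2) (auto simp: space_facet_measure)

text \<open>The conclusion stays almost everywhere on the facet, which is enough to annihilate later
  boundary integrals.\<close>

lemma IB_eq_0_imp:
  assumes f: "bcont f" and nn: "\<And>F x. F facet_of K \<Longrightarrow> x \<in> F \<Longrightarrow> 0 \<le> f F x" and z: "IB f = 0" and F: "F facet_of K"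
  shows "AE x in facet_measure (normal K F) F. f F x = 0"
proof -
  have ae: "AE x in facet_measure (normal K F) F. 0 \<le> f F x" if "F facet_of K" for F
    using nn that by (intro AE_I2) (auto simp: space_facet_measure)
  have "(LINT x|facet_measure (normal K F) F. f F x) = 0"
    using sum_nonneg_eq_0_iff[OF finite_facets, of "\<lambda>F. LINT x|facet_measure (normal K F) F. f F x"] z F ae integral_nonneg_AE
    unfolding IB_def by blast
  then show ?thesis
    using integral_nonneg_eq_0_iff_AE[OF bint[OF f F] ae[OF F]] by simp
qed

lemma IK_nonneg: "(\<And>x. x \<in> K \<Longrightarrow> 0 \<le> f x) \<Longrightarrow> 0 \<le> IK f"
  unfolding IK_def by (intro integral_nonneg_AE AE_I2) auto

lemma bcontI: "(\<And>F. F facet_of K \<Longrightarrow> continuous_on F (h F)) \<Longrightarrow> bcont h"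
  by (simp add: bcont_def)

lemma bcont_sum:
  fixes h :: "'i \<Rightarrow> (real^'n) set \<Rightarrow> real^'n \<Rightarrow> real"
  shows "(\<And>i. i \<in> I \<Longrightarrow> bcont (h i)) \<Longrightarrow> bcont (\<lambda>F x. \<Sum>i\<in>I. h i F x)"
  by (auto simp: bcont_def intro!: continuous_on_sum)

lemma IB_sum: "(\<And>i. i \<in> I \<Longrightarrow> bcont (h i)) \<Longrightarrow> IB (\<lambda>F x. \<Sum>i\<in>I. h i F x) = (\<Sum>i\<in>I. IB (h i))"
  unfolding IB_def by (subst sum.swap) (simp add: bint)

lemma IK_sum: "(\<And>i. i \<in> I \<Longrightarrow> continuous_on K (h i)) \<Longrightarrow> IK (\<lambda>x. \<Sum>i\<in>I. h i x) = (\<Sum>i\<in>I. IK (h i))"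
  by (simp add: IK_def integrable_continuous)

end

section \<open>Identities of the vector calculus\<close>

lemma linear_component:
  fixes T :: "real^'n \<Rightarrow> real^'l"
  assumes "linear T" shows "T b $ i = (\<Sum>l\<in>UNIV. T (axis l 1) $ i * b $ l)"
proof -
  have "T b = T (\<Sum>l\<in>UNIV. b $ l *\<^sub>R axis l 1)"
    using basis_expansion[of b] by (simp add: scalar_mult_eq_scaleR)
  also have "\<dots> = (\<Sum>l\<in>UNIV. b $ l *\<^sub>R T (axis l 1))"
    by (simp add: linear_sum[OF assms] linear_scale[OF assms])
  finally show ?thesis by (simp add: mult.commute)
qed

text \<open>A fixed linear map commutes with partial derivatives, which are the columns of the
  Jacobian.\<close>

lemma linear_vpoly:
  fixes T :: "real^'n \<Rightarrow> real^'l"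
  assumes T: "linear T" and b: "vpoly k b"
  shows "vpoly k (\<lambda>x. T (b x))" and "pd (\<lambda>x. T (b x) $ i) j x = T (column j (Dv b x)) $ i"
proof -
  have p: "(\<lambda>x. T (axis l 1) $ i * b x $ l) \<in> polys k" for i l
    by (intro polys_scale vpolyD[OF b])
  show "vpoly k (\<lambda>x. T (b x))"
    unfolding vpoly_def by (subst linear_component[OF T]) (intro allI polys_sum p)
  have "pd (\<lambda>x. T (b x) $ i) j x = pd (\<lambda>x. \<Sum>l\<in>UNIV. T (axis l 1) $ i * b x $ l) j x"
    by (subst linear_component[OF T]) simp
  also have "\<dots> = (\<Sum>l\<in>UNIV. T (axis l 1) $ i * pd (\<lambda>x. b x $ l) j x)"
    by (simp add: pd_sum[OF p] pd_scale[OF vpolyD[OF b]])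
  also have "\<dots> = T (column j (Dv b x)) $ i"
    by (subst linear_component[OF T, of "column j (Dv b x)"]) (simp add: column_def Dv_def)
  finally show "pd (\<lambda>x. T (b x) $ i) j x = T (column j (Dv b x)) $ i" .
qed

lemma matrix_sum_columns: "A = (\<Sum>j\<in>UNIV. outer (column j A) (axis j 1))"
  by (simp add: vec_eq_iff outer_def column_def axis_def if_distrib[of "\<lambda>c. _ * c"] cong: if_cong)

lemma inner_matrix: "A \<bullet> B = (\<Sum>i\<in>UNIV. \<Sum>j\<in>UNIV. A $ i $ j * B $ i $ j)"
  for A B :: "real^'n^'l"
  by (simp add: inner_vec_def)

lemma inner_outer: "A \<bullet> outer v n = (A *v n) \<bullet> v"
  by (simp add: inner_matrix outer_def matrix_vector_mult_def inner_vec_def sum_distrib_left sum_distrib_right mult_ac)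

lemma continuous_on_outer [continuous_intros]:
  fixes a :: "'a::topological_space \<Rightarrow> real^'l"
  assumes "continuous_on S a" "continuous_on S b"
  shows "continuous_on S (\<lambda>x. outer (a x) (b x))"
  unfolding outer_def
  by (intro continuous_on_vec_lambda continuous_on_mult bounded_linear.continuous_on[OF bounded_linear_vec_nth] assms)

lemma outer_lin: "outer (a + t *\<^sub>R a') b = outer a b + t *\<^sub>R outer a' b"
  "outer a (b + t *\<^sub>R b') = outer a b + t *\<^sub>R outer a b'"
  by (simp_all add: outer_def vec_eq_iff algebra_simps)

text \<open>The identities shared by the planar and the spatial calculus that the argument rests on.  The rules for
  \<open>outer\<close> say that a curl is \<open>\<nabla> \<times>\<close> formally.\<close>

locale mhd_calculus =
  fixes \<C> :: "('n::{finite,wellorder}, 'm::finite) vector_calculus"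
  assumes bilinear_v: "bounded_bilinear (cross_v \<C>)" and bilinear_s: "bounded_bilinear (cross_s \<C>)"
    and linear_curl_v: "linear (curl_v \<C>)" and linear_curl_s: "linear (curl_s \<C>)"
    and cross_s_inner: "cross_s \<C> a s \<bullet> b = s \<bullet> cross_v \<C> b a"
    and cross_v_skew: "cross_v \<C> b a = - cross_v \<C> a b"
    and curl_v_outer: "curl_v \<C> (outer u n) = cross_v \<C> n u"
    and curl_s_outer: "curl_s \<C> (outer s n) = cross_s \<C> n s"
    and curl_v_square: "curl_v \<C> A \<bullet> curl_v \<C> A = A \<bullet> A - A \<bullet> transpose A"
begin

text \<open>Turns the algebraic description of a curl into the formal nabla, the sum of the axes
  crossed with the partial derivatives, on which the integrations by parts operate.\<close>

lemma curl_v_columns: "curl_v \<C> A = (\<Sum>j\<in>UNIV. cross_v \<C> (axis j 1) (column j A))"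
  by (subst matrix_sum_columns[of A]) (simp only: linear_sum[OF linear_curl_v] curl_v_outer)

lemma curl_s_columns: "curl_s \<C> A = (\<Sum>j\<in>UNIV. cross_s \<C> (axis j 1) (column j A))"
  by (subst matrix_sum_columns[of A]) (simp only: linear_sum[OF linear_curl_s] curl_s_outer)

text \<open>Writes the pairing entrywise in A, with coefficients that are polynomial when b is; in
  this form a weak Jacobian can be integrated by parts.\<close>

lemma inner_curl_s: "b \<bullet> curl_s \<C> A = (\<Sum>j\<in>UNIV. \<Sum>i\<in>UNIV. A $ i $ j * cross_v \<C> b (axis j 1) $ i)"
proof -
  have "b \<bullet> curl_s \<C> A = (\<Sum>j\<in>UNIV. cross_s \<C> (axis j 1) (column j A) \<bullet> b)"
    by (simp add: curl_s_columns inner_sum_right inner_commute)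
  also have "\<dots> = (\<Sum>j\<in>UNIV. \<Sum>i\<in>UNIV. A $ i $ j * cross_v \<C> b (axis j 1) $ i)"
    unfolding cross_s_inner by (simp add: inner_vec_def column_def)
  finally show ?thesis .
qed

lemma inner_curl_v: "u \<bullet> curl_v \<C> A = - (\<Sum>j\<in>UNIV. u \<bullet> cross_v \<C> (column j A) (axis j 1))"
  by (simp add: curl_v_columns inner_sum_right cross_v_skew[of "column j A" "axis j 1" for j] sum_negf)

lemma continuous_on_cross [continuous_intros]:
  fixes a b :: "'a::topological_space \<Rightarrow> (real, 'n) vec"
  shows "continuous_on S a \<Longrightarrow> continuous_on S b \<Longrightarrow> continuous_on S (\<lambda>x. cross_v \<C> (a x) (b x))"
    and "continuous_on S a \<Longrightarrow> continuous_on S c \<Longrightarrow> continuous_on S (\<lambda>x. cross_s \<C> (a x) (c x))"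
  by (rule bounded_bilinear.continuous_on[OF bilinear_v] bounded_bilinear.continuous_on[OF bilinear_s]; assumption)+

lemma continuous_on_curl [continuous_intros]:
  shows "continuous_on S A \<Longrightarrow> continuous_on S (\<lambda>x. curl_v \<C> (A x))"
    and "continuous_on S B \<Longrightarrow> continuous_on S (\<lambda>x. curl_s \<C> (B x))"
  using linear_curl_v linear_curl_s
  by (auto intro: bounded_linear.continuous_on simp: linear_conv_bounded_linear)

lemma curl_lin: "curl_v \<C> (A + t *\<^sub>R A') = curl_v \<C> A + t *\<^sub>R curl_v \<C> A'"
  "curl_s \<C> (B + t *\<^sub>R B') = curl_s \<C> B + t *\<^sub>R curl_s \<C> B'"
  by (simp_all add: linear_add[OF linear_curl_v] linear_scale[OF linear_curl_v]
      linear_add[OF linear_curl_s] linear_scale[OF linear_curl_s])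

lemma cross_lin: "cross_v \<C> (a + t *\<^sub>R a') b = cross_v \<C> a b + t *\<^sub>R cross_v \<C> a' b"
  "cross_v \<C> a (b + t *\<^sub>R b') = cross_v \<C> a b + t *\<^sub>R cross_v \<C> a b'"
  "cross_s \<C> a (s + t *\<^sub>R s') = cross_s \<C> a s + t *\<^sub>R cross_s \<C> a s'"
  by (simp_all add: bounded_bilinear.add_left[OF bilinear_v] bounded_bilinear.add_right[OF bilinear_v]
      bounded_bilinear.scaleR_left[OF bilinear_v] bounded_bilinear.scaleR_right[OF bilinear_v]
      bounded_bilinear.add_right[OF bilinear_s] bounded_bilinear.scaleR_right[OF bilinear_s])

lemma cross_zero [simp]: "cross_v \<C> 0 b = 0" "cross_v \<C> a 0 = 0" "cross_s \<C> a 0 = 0"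
  "curl_v \<C> 0 = 0" "curl_s \<C> 0 = 0"
  by (simp_all add: bounded_bilinear.zero_left[OF bilinear_v] bounded_bilinear.zero_right[OF bilinear_v]
      bounded_bilinear.zero_right[OF bilinear_s] linear_0[OF linear_curl_v] linear_0[OF linear_curl_s])

lemma linear_cross_left: "linear (\<lambda>b. cross_v \<C> b a)"
  by (rule bounded_linear.linear[OF bounded_bilinear.bounded_linear_left[OF bilinear_v]])

lemma linear_cross_right: "linear (\<lambda>b. cross_v \<C> a b)"
  by (rule bounded_linear.linear[OF bounded_bilinear.bounded_linear_right[OF bilinear_v]])

end

section \<open>The local solver as a variational problem\<close>

text \<open>Collects what one element sees of the mesh problem: a pointwise bound for w strictly
  below 2 \<alpha>1, facet data continuous on each facet, and integrable sources f and g.\<close>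

locale local_solver = mhd_calculus \<C> + lebesgue_polytope K
  for \<C> :: "('n::{finite,wellorder}, 'm::finite) vector_calculus" and K :: "(real, 'n) vec set" +
  fixes k :: nat and Rey Rem \<kappa> \<alpha>1 \<beta>1 \<beta>2 :: real
    and d w uh bh f g :: "(real, 'n) vec \<Rightarrow> (real, 'n) vec"
    and ph rh :: "(real, 'n) vec set \<Rightarrow> (real, 'n) vec \<Rightarrow> real"
  assumes k: "1 \<le> k" and pos: "0 < Rey" "0 < Rem" "0 < \<kappa>"
    and d: "d \<in> W1inf (interior K)" and w: "w \<in> W1inf (interior K)"
    and div_w: "weak_divergence (interior K) w (\<lambda>_. 0)"
    and \<alpha>1: "\<exists>c. (\<forall>x\<in>interior K. norm (w x) \<le> c) \<and> c < 2 * \<alpha>1"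
    and \<beta>: "\<And>F. F facet_of K \<Longrightarrow> positive_definite (penalty \<beta>1 \<beta>2 (normal K F))"
    and uh: "bcont (\<lambda>F. uh)" and bh: "bcont (\<lambda>F. bh)" and ph: "bcont ph" and rh: "bcont rh"
    and f: "integrable (lebesgue_on K) f" and g: "integrable (lebesgue_on K) g"
begin

abbreviation "td \<equiv> trace_from K d"
abbreviation "tw \<equiv> trace_from K w"
abbreviation "cv \<equiv> cross_v \<C>"
abbreviation "cs \<equiv> cross_s \<C>"
abbreviation "nu \<equiv> normal K"
abbreviation "pen F \<equiv> penalty \<beta>1 \<beta>2 (normal K F)"

lemma td: "continuous_on K td" and tw: "continuous_on K tw"
  using trace_W1inf(1) d w by auto

text \<open>\<open>volN\<close>, \<open>bdN\<close> and \<open>daN\<close> are the volume integrand, the boundary integrand and the data in equation (LN);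
  (L6) has the shape of (L3).  In (L2) the weak curl of \<open>v \<times> d\<close> is integrated by parts onto \<open>b\<close>, and its
  boundary term is part of \<open>bd2\<close>.\<close>

definition "vol1 L u G x = Rey * (L x \<bullet> G x) + u x \<bullet> dvm G x"
definition "vol2 L u p b v x = L x \<bullet> Dv v x - p x * dvg v x - outer (u x) (tw x) \<bullet> Dv v x
  + \<kappa> * (cv (v x) (td x) \<bullet> curl_v \<C> (Dv b x))"
definition "vol3 u q x = - (u x \<bullet> gr q x)"
definition "vol4 J b H x = Rem / \<kappa> * (J x \<bullet> H x) - b x \<bullet> curl_s \<C> (Dv H x)"
definition "vol5 u J r c x = J x \<bullet> curl_v \<C> (Dv c x) - r x * dvg c x - \<kappa> * (u x \<bullet> cs (td x) (curl_v \<C> (Dv c x)))"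

definition "bd2 L u b v F x = - (L x \<bullet> outer (v x) (nu F)) + (tw x \<bullet> nu F) * (u x \<bullet> v x)
  + \<kappa> * (cs (nu F) (cv (v x) (td x)) \<bullet> b x)
  + \<kappa> / 2 * (cs (td x) (cv (nu F) (b x)) \<bullet> v x) + \<alpha>1 * (u x \<bullet> v x)"
definition "bd3 u q F x = (u x \<bullet> nu F) * q x"
definition "bd5 u J b c F x = cs (nu F) (J x) \<bullet> c x - \<kappa> / 2 * (cs (nu F) (cv (u x) (td x)) \<bullet> c x)
  + (pen F *v b x) \<bullet> c x"

definition "da1 G F x = outer (uh x) (nu F) \<bullet> G x"
definition "da2 v F x = - (ph F x * (nu F \<bullet> v x) + \<kappa> / 2 * (cs (td x) (cv (nu F) (bh x)) \<bullet> v x) - \<alpha>1 * (uh x \<bullet> v x))"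
definition "da4 H F x = cv (nu F) (bh x) \<bullet> H x"
definition "da5 c F x = - (rh F x * (nu F \<bullet> c x) - \<kappa> / 2 * (cs (nu F) (cv (uh x) (td x)) \<bullet> c x) - (pen F *v bh x) \<bullet> c x)"

lemmas vconts = vpoly_continuous mpoly_continuous[OF Dv_mpoly] polys_continuous[OF dvg_polys]
lemmas mconts = mpoly_continuous vpoly_continuous[OF dvm_vpoly]
lemmas pconts = polys_continuous vpoly_continuous[OF gr_vpoly]

lemmas vpoly_conts = vpoly_continuous mpoly_continuous[OF Dv_mpoly] polys_continuous[OF dvg_polys]
  vpoly_continuous[OF gr_vpoly] vpoly_continuous[OF dvm_vpoly] mpoly_continuous polys_continuous

lemma continuous_vol:
  shows "mpoly k L \<Longrightarrow> vpoly k u \<Longrightarrow> mpoly k G \<Longrightarrow> continuous_on K (vol1 L u G)"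
    and "mpoly k L \<Longrightarrow> vpoly k u \<Longrightarrow> p \<in> polys j \<Longrightarrow> vpoly k b \<Longrightarrow> vpoly k v \<Longrightarrow> continuous_on K (vol2 L u p b v)"
    and "vpoly k u \<Longrightarrow> q \<in> polys j \<Longrightarrow> continuous_on K (vol3 u q)"
    and "vpoly k J \<Longrightarrow> vpoly k b \<Longrightarrow> vpoly k H \<Longrightarrow> continuous_on K (vol4 J b H)"
    and "vpoly k u \<Longrightarrow> vpoly k J \<Longrightarrow> r \<in> polys j \<Longrightarrow> vpoly k c \<Longrightarrow> continuous_on K (vol5 u J r c)"
  unfolding vol1_def vol2_def vol3_def vol4_def vol5_def
  by (intro continuous_intros td tw; (erule vpoly_conts)+)+

lemma continuous_pen: "continuous_on S b \<Longrightarrow> continuous_on S (\<lambda>x. pen F *v b x)"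
  by (rule bounded_linear.continuous_on[OF matrix_vector_mul_bounded_linear])

lemma continuous_facet: "continuous_on K h \<Longrightarrow> F facet_of K \<Longrightarrow> continuous_on F h"
  by (rule continuous_on_subset[OF _ facet_subset])

lemma bcont_bd:
  shows "mpoly k L \<Longrightarrow> vpoly k u \<Longrightarrow> vpoly k b \<Longrightarrow> vpoly k v \<Longrightarrow> bcont (bd2 L u b v)"
    and "vpoly k u \<Longrightarrow> q \<in> polys j \<Longrightarrow> bcont (bd3 u q)"
    and "vpoly k u \<Longrightarrow> vpoly k J \<Longrightarrow> vpoly k b \<Longrightarrow> vpoly k c \<Longrightarrow> bcont (bd5 u J b c)"
  unfolding bd2_def bd3_def bd5_def
  by (rule bcontI, intro continuous_intros continuous_pen continuous_facet[OF td] continuous_facet[OF tw]; (assumption | erule vpoly_conts))+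

lemma bcont_da:
  shows "mpoly k G \<Longrightarrow> bcont (da1 G)" and "vpoly k v \<Longrightarrow> bcont (da2 v)"
    and "vpoly k H \<Longrightarrow> bcont (da4 H)" and "vpoly k c \<Longrightarrow> bcont (da5 c)"
  unfolding da1_def da2_def da4_def da5_def
  by (rule bcontI, intro continuous_intros continuous_pen continuous_facet[OF td];
      (assumption | erule vpoly_conts | (rule uh[unfolded bcont_def, rule_format] bh[unfolded bcont_def, rule_format]
        ph[unfolded bcont_def, rule_format] rh[unfolded bcont_def, rule_format], assumption)))+

lemma integrable_inner_vpoly:
  assumes h: "integrable (lebesgue_on K) h" and v: "vpoly k v"
  shows "integrable (lebesgue_on K) (\<lambda>x. h x \<bullet> v x)"
proof -
  obtain B where B: "\<And>x. x \<in> K \<Longrightarrow> norm (v x) \<le> B"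
    using compact_imp_bounded[OF compact_continuous_image[OF vpoly_continuous[OF v] compact]] by (auto simp: bounded_iff)
  show ?thesis
  proof (rule Bochner_Integration.integrable_bound)
    show "integrable (lebesgue_on K) (\<lambda>x. B * norm (h x))" using h by simp
    have "v \<in> borel_measurable (lebesgue_on K)"
      by (rule continuous_imp_measurable_on_sets_lebesgue[OF vpoly_continuous[OF v]]) (use closed in simp)
    then show "(\<lambda>x. h x \<bullet> v x) \<in> borel_measurable (lebesgue_on K)"
      using borel_measurable_integrable[OF h] by simp
    show "AE x in lebesgue_on K. norm (h x \<bullet> v x) \<le> norm (B * norm (h x))"
    proof (rule AE_I2)
      fix x assume "x \<in> space (lebesgue_on K)"
      then have "norm (v x) \<le> B" using B by simp
      then have "norm (h x) * norm (v x) \<le> norm (h x) * \<bar>B\<bar>" by (intro mult_left_mono) auto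
      moreover have "norm (h x \<bullet> v x) \<le> norm (h x) * norm (v x)" by (simp add: Cauchy_Schwarz_ineq2)
      ultimately show "norm (h x \<bullet> v x) \<le> norm (B * norm (h x))" by (simp add: abs_mult mult.commute)
    qed
  qed
qed

end

section \<open>The local equations as integrals of explicit integrands\<close>

context local_solver
begin

abbreviation "rs u \<equiv> restrict u K"

lemma ip_IK: "(\<And>x. x \<in> interior K \<Longrightarrow> a x \<bullet> b x = h x) \<Longrightarrow> ip K a b = IK h"
  using IK_cong[of "\<lambda>x. a x \<bullet> b x" h] by (simp add: ip_def IK_def)

lemma bip_IB: "(\<And>F x. F facet_of K \<Longrightarrow> x \<in> F \<Longrightarrow> a F x \<bullet> b x = h F x) \<Longrightarrow> bip K a b = IB h"
  using IB_cong[of "\<lambda>F x. a F x \<bullet> b x" h] by (simp add: bip_def IB_def)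

lemma interior_in: "x \<in> interior K \<Longrightarrow> x \<in> K"
  using interior_subset by blast

lemma facet_in: "F facet_of K \<Longrightarrow> x \<in> F \<Longrightarrow> x \<in> K"
  using facet_subset by blast

lemma td_interior: "x \<in> interior K \<Longrightarrow> td x = d x" and tw_interior: "x \<in> interior K \<Longrightarrow> tw x = w x"
  using trace_W1inf(2) d w by auto

text \<open>The curl in (L2) comes from an arbitrarily chosen weak Jacobian, so it can be evaluated
  only under an integral. Each of its entries is paired with the polynomial
  \<open>cross_v \<C> (b x) (axis j 1) $ i\<close>, and the divergence theorem shifts the derivative
  onto b.\<close>

lemma weak_curl:
  assumes b: "vpoly k b" and v: "vpoly k v"
  shows "ip K (rs b) (\<lambda>x. curl_s \<C> (weak_jac (interior K) (\<lambda>y. cv (rs v y) (d y)) x))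
    = IK (\<lambda>x. cv (v x) (td x) \<bullet> curl_v \<C> (Dv b x)) + IB (\<lambda>F x. cs (nu F) (cv (v x) (td x)) \<bullet> b x)"
proof -
  let ?U = "interior K" and ?u = "\<lambda>x. cv (v x) (td x)"
  define W where "W = weak_jac ?U (\<lambda>y. cv (rs v y) (d y))"
  \<comment> \<open>d and its trace agree in the interior, so the choice picks the same weak
    Jacobian for both, and the trace is continuous up to the boundary.\<close>
  have W_eq: "W = weak_jac ?U ?u"
    unfolding W_def by (rule weak_jac_cong) (simp add: td_interior interior_in)
  obtain D where D: "D \<in> Linf ?U" "weak_jacobian ?U d D" using d by (auto simp: W1inf_def)
  have D': "weak_jacobian ?U td D"
    using D(2) weak_jacobian_cong[of ?U d td] td_interior by metis
  have comp: "cv a c $ i = (\<Sum>p\<in>UNIV. \<Sum>q\<in>UNIV. a $ p * c $ q * cv (axis p 1) (axis q 1) $ i)" for a c i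
    by (subst linear_component[OF linear_cross_left], subst linear_component[OF linear_cross_right])
      (simp add: sum_distrib_left sum_distrib_right mult_ac)
  obtain E where "E \<in> Linf ?U" "weak_jacobian ?U ?u E"
    using weak_jacobian_bilinear[OF comp td D(1) D' vpolyD[OF v]] by blast
  note W = weak_jac_works[OF this, folded W_eq]
  have uc: "continuous_on K ?u" by (intro continuous_intros td vpoly_continuous[OF v])
  let ?h = "\<lambda>i j x. cv (b x) (axis j 1) $ i"
  have hp: "?h i j \<in> polys k" for i j
    using linear_vpoly(1)[OF linear_cross_left b] by (rule vpolyD)
  have bU: "bounded ?U" "?U \<in> sets lebesgue"
    using compact_imp_bounded[OF compact] bounded_subset[OF _ interior_subset] by auto
  have Wint: "integrable (lebesgue_on ?U) (\<lambda>x. W x $ i $ j * ?h i j x)" for i j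
    by (rule Linf_integrable[OF Linf_mult_continuous[OF Linf_nth[OF Linf_nth[OF W(1)]] polys_continuous[OF hp] compact interior_subset bU(2)] bU])
  have part: "(LINT x|lebesgue_on ?U. W x $ i $ j * ?h i j x)
      = IB (\<lambda>F x. ?u x $ i * nu F $ j * ?h i j x) - IK (\<lambda>x. ?u x $ i * pd (?h i j) j x)" for i j
    using weak_jacobian_divergence[OF uc W hp[of j i], where i = i and j = j] by (simp add: IB_def IK_def)
  have c1: "bcont (\<lambda>F x. ?u x $ i * nu F $ j * ?h i j x)" for i j
    by (intro bcontI continuous_intros continuous_facet[OF uc] polys_continuous[OF hp])
  have c2: "continuous_on K (\<lambda>x. ?u x $ i * pd (?h i j) j x)" for i j
    by (intro continuous_intros uc polys_continuous[OF pd_polys[OF hp]])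
  have "ip K (rs b) (\<lambda>x. curl_s \<C> (W x)) = (LINT x|lebesgue_on ?U. (\<Sum>j\<in>UNIV. \<Sum>i\<in>UNIV. W x $ i $ j * ?h i j x))"
    unfolding ip_def lebesgue_on_interior(3)
    by (rule lebesgue_on_cong_integral) (simp add: inner_curl_s interior_in)
  also have "\<dots> = (\<Sum>j\<in>UNIV. \<Sum>i\<in>UNIV. IB (\<lambda>F x. ?u x $ i * nu F $ j * ?h i j x) - IK (\<lambda>x. ?u x $ i * pd (?h i j) j x))"
    using Wint by (simp add: part)
  also have "\<dots> = (\<Sum>j\<in>UNIV. \<Sum>i\<in>UNIV. IB (\<lambda>F x. ?u x $ i * nu F $ j * ?h i j x))
      - (\<Sum>j\<in>UNIV. \<Sum>i\<in>UNIV. IK (\<lambda>x. ?u x $ i * pd (?h i j) j x))"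
    by (simp add: sum_subtractf)
  also have "(\<Sum>j\<in>UNIV. \<Sum>i\<in>UNIV. IB (\<lambda>F x. ?u x $ i * nu F $ j * ?h i j x))
      = IB (\<lambda>F x. \<Sum>j\<in>UNIV. \<Sum>i\<in>UNIV. ?u x $ i * nu F $ j * ?h i j x)"
    by (simp add: IB_sum bcont_sum c1)
  also have "\<dots> = IB (\<lambda>F x. cs (nu F) (?u x) \<bullet> b x)"
  proof (rule IB_cong)
    fix F x
    have "cs (nu F) (?u x) \<bullet> b x = ?u x \<bullet> cv (b x) (nu F)" by (rule cross_s_inner)
    also have "\<dots> = (\<Sum>i\<in>UNIV. ?u x $ i * (\<Sum>j\<in>UNIV. cv (b x) (axis j 1) $ i * nu F $ j))"
      by (subst inner_vec_def, subst linear_component[OF linear_cross_right]) simp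
    also have "\<dots> = (\<Sum>j\<in>UNIV. \<Sum>i\<in>UNIV. ?u x $ i * nu F $ j * ?h i j x)"
      by (subst sum.swap) (simp add: sum_distrib_left mult_ac)
    finally show "(\<Sum>j\<in>UNIV. \<Sum>i\<in>UNIV. ?u x $ i * nu F $ j * ?h i j x) = cs (nu F) (?u x) \<bullet> b x" by simp
  qed
  also have "(\<Sum>j\<in>UNIV. \<Sum>i\<in>UNIV. IK (\<lambda>x. ?u x $ i * pd (?h i j) j x))
      = IK (\<lambda>x. \<Sum>j\<in>UNIV. \<Sum>i\<in>UNIV. ?u x $ i * pd (?h i j) j x)"
    by (simp add: IK_sum continuous_on_sum c2)
  also have "\<dots> = - IK (\<lambda>x. ?u x \<bullet> curl_v \<C> (Dv b x))"
    unfolding linear_vpoly(2)[OF linear_cross_left b] inner_curl_v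
    by (simp add: IK_minus[symmetric] inner_vec_def sum_negf)
  finally show ?thesis unfolding W_def by linarith
qed

text \<open>Here and in the four lemmas that follow, the left side of a local equation at polynomial
  arguments is split into a part bilinear in unknowns and test function and a part determined by the
  boundary data.\<close>

lemma equation1:
  assumes "mpoly k L" "vpoly k u" "mpoly k G"
  shows "Rey * ip K (rs L) (rs G) + ip K (rs u) (div_m K (rs G)) + bip K (flux1 K uh) (rs G)
    = IK (vol1 L u G) - IB (da1 G)"
proof -
  have 1: "ip K (rs L) (rs G) = IK (\<lambda>x. L x \<bullet> G x)"
    by (rule ip_IK) (simp add: interior_in)
  have 2: "ip K (rs u) (div_m K (rs G)) = IK (\<lambda>x. u x \<bullet> dvm G x)"
    by (rule ip_IK) (simp add: interior_in div_m_interior[OF assms(3)])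
  have 3: "bip K (flux1 K uh) (rs G) = IB (\<lambda>F x. - da1 G F x)"
    by (rule bip_IB) (simp add: flux1_def da1_def facet_in)
  have "IK (vol1 L u G) = Rey * IK (\<lambda>x. L x \<bullet> G x) + IK (\<lambda>x. u x \<bullet> dvm G x)"
    unfolding vol1_def[abs_def]
    by (subst IK_add; (intro continuous_intros mconts[OF assms(1)] vconts[OF assms(2)] mconts[OF assms(3)])?)
      (simp add: IK_cmult)
  then show ?thesis unfolding 1 2 3 by (simp add: IB_minus)
qed

lemma equation2:
  assumes L: "mpoly k L" and u: "vpoly k u" and p: "p \<in> polys j" and b: "vpoly k b" and v: "vpoly k v"
  shows "ip K (rs L) (jac K (rs v)) - ip K (rs p) (div_v K (rs v)) - ip K (\<lambda>x. outer (rs u x) (w x)) (jac K (rs v))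
        + \<kappa> * ip K (rs b) (\<lambda>x. curl_s \<C> (weak_jac (interior K) (\<lambda>y. cross_v \<C> (rs v y) (d y)) x))
        + bip K (flux2 \<C> \<kappa> d w \<alpha>1 K uh ph bh (rs L) (rs u) (rs b)) (rs v)
    = IK (vol2 L u p b v) + IB (bd2 L u b v) - IB (da2 v)"
proof -
  note conts = mconts[OF L] vconts[OF u] pconts[OF p] vconts[OF b] vconts[OF v]
  \<comment> \<open>The boundary term of \<open>weak_curl\<close>. It belongs to \<open>bd2\<close>
    but not to the flux, so it is subtracted here and returned at the end.\<close>
  let ?e = "\<lambda>F x. cs (nu F) (cv (v x) (td x)) \<bullet> b x"
  have 1: "ip K (rs L) (jac K (rs v)) = IK (\<lambda>x. L x \<bullet> Dv v x)"
    by (rule ip_IK) (simp add: interior_in jac_interior[OF v])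
  have 2: "ip K (rs p) (div_v K (rs v)) = IK (\<lambda>x. p x * dvg v x)"
    by (rule ip_IK) (simp add: interior_in div_v_interior[OF v])
  have 3: "ip K (\<lambda>x. outer (rs u x) (w x)) (jac K (rs v)) = IK (\<lambda>x. outer (u x) (tw x) \<bullet> Dv v x)"
    by (rule ip_IK) (simp add: interior_in jac_interior[OF v] tw_interior)
  have 4: "bip K (flux2 \<C> \<kappa> d w \<alpha>1 K uh ph bh (rs L) (rs u) (rs b)) (rs v)
      = IB (\<lambda>F x. bd2 L u b v F x - \<kappa> * ?e F x - da2 v F x)"
  proof (rule bip_IB)
    fix F x assume "F facet_of K" "x \<in> F"
    then have x: "x \<in> K" by (rule facet_in)
    show "flux2 \<C> \<kappa> d w \<alpha>1 K uh ph bh (rs L) (rs u) (rs b) F x \<bullet> rs v x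
        = bd2 L u b v F x - \<kappa> * ?e F x - da2 v F x"
      using x cross_lin(2)[of "nu F" "b x" 1 "bh x"] cross_lin(3)[of "td x" "cv (nu F) (b x)" 1 "cv (nu F) (bh x)"]
      by (simp add: flux2_def Let_def bd2_def da2_def inner_outer inner_add_left inner_diff_left distrib_left right_diff_distrib)
  qed
  have ec: "bcont ?e"
    by (intro bcontI continuous_intros continuous_facet[OF td] conts)
  have 5: "IB (\<lambda>F x. bd2 L u b v F x - \<kappa> * ?e F x - da2 v F x) = IB (bd2 L u b v) - \<kappa> * IB ?e - IB (da2 v)"
  proof -
    have kc: "bcont (\<lambda>F x. \<kappa> * ?e F x)" using ec by (auto simp: bcont_def intro!: continuous_on_mult_left)
    have "bcont (\<lambda>F x. bd2 L u b v F x - \<kappa> * ?e F x)"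
      using bcont_bd(1)[OF L u b v] kc by (auto simp: bcont_def intro!: continuous_on_diff)
    then show ?thesis
      by (simp add: IB_diff bcont_da(2)[OF v] bcont_bd(1)[OF L u b v] kc IB_cmult)
  qed
  have 6: "IK (vol2 L u p b v) = IK (\<lambda>x. L x \<bullet> Dv v x) - IK (\<lambda>x. p x * dvg v x)
      - IK (\<lambda>x. outer (u x) (tw x) \<bullet> Dv v x) + \<kappa> * IK (\<lambda>x. cv (v x) (td x) \<bullet> curl_v \<C> (Dv b x))"
  proof -
    have c: "continuous_on K (\<lambda>x. L x \<bullet> Dv v x)" "continuous_on K (\<lambda>x. p x * dvg v x)"
      "continuous_on K (\<lambda>x. outer (u x) (tw x) \<bullet> Dv v x)"
      "continuous_on K (\<lambda>x. cv (v x) (td x) \<bullet> curl_v \<C> (Dv b x))"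
      by (intro continuous_intros td tw conts)+
    show ?thesis
      unfolding vol2_def[abs_def]
      by (simp add: IK_add IK_diff IK_cmult continuous_on_add continuous_on_diff continuous_on_mult_left c)
  qed
  show ?thesis unfolding 1 2 3 4 5 6 weak_curl[OF b v] by (simp add: distrib_left)
qed

lemma equation3:
  assumes u: "vpoly k u" and q: "q \<in> polys j"
  shows "- ip K (rs u) (grad K (rs q)) + bip K (flux3 K (rs u)) (rs q) = IK (vol3 u q) + IB (bd3 u q)"
    and "- ip K (rs u) (grad K (rs q)) + bip K (flux6 K (rs u)) (rs q) = IK (vol3 u q) + IB (bd3 u q)"
proof -
  have 1: "ip K (rs u) (grad K (rs q)) = IK (\<lambda>x. u x \<bullet> gr q x)"
    by (rule ip_IK) (simp add: interior_in grad_interior[OF q])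
  have 2: "bip K (flux3 K (rs u)) (rs q) = IB (bd3 u q)" "bip K (flux6 K (rs u)) (rs q) = IB (bd3 u q)"
    by (rule bip_IB; simp add: flux3_def flux6_def bd3_def facet_in)+
  show "- ip K (rs u) (grad K (rs q)) + bip K (flux3 K (rs u)) (rs q) = IK (vol3 u q) + IB (bd3 u q)"
    and "- ip K (rs u) (grad K (rs q)) + bip K (flux6 K (rs u)) (rs q) = IK (vol3 u q) + IB (bd3 u q)"
    unfolding 1 2 vol3_def[abs_def] by (simp_all add: IK_minus)
qed

lemma equation4:
  assumes J: "vpoly k J" and b: "vpoly k b" and H: "vpoly k H"
  shows "Rem / \<kappa> * ip K (rs J) (rs H) - ip K (rs b) (\<lambda>x. curl_s \<C> (jac K (rs H) x))
        + bip K (flux4 \<C> K bh) (rs H) = IK (vol4 J b H) - IB (da4 H)"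
proof -
  note conts = vpoly_continuous[OF J] mpoly_continuous[OF Dv_mpoly[OF J]] vconts[OF b] vpoly_continuous[OF H] mpoly_continuous[OF Dv_mpoly[OF H]]
  have 1: "ip K (rs J) (rs H) = IK (\<lambda>x. J x \<bullet> H x)"
    by (rule ip_IK) (simp add: interior_in)
  have 2: "ip K (rs b) (\<lambda>x. curl_s \<C> (jac K (rs H) x)) = IK (\<lambda>x. b x \<bullet> curl_s \<C> (Dv H x))"
    by (rule ip_IK) (simp add: interior_in jac_interior[OF H])
  have 3: "bip K (flux4 \<C> K bh) (rs H) = IB (\<lambda>F x. - da4 H F x)"
    by (rule bip_IB) (simp add: flux4_def da4_def facet_in)
  have 4: "IK (vol4 J b H) = Rem / \<kappa> * IK (\<lambda>x. J x \<bullet> H x) - IK (\<lambda>x. b x \<bullet> curl_s \<C> (Dv H x))"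
  proof -
    have c: "continuous_on K (\<lambda>x. J x \<bullet> H x)" "continuous_on K (\<lambda>x. b x \<bullet> curl_s \<C> (Dv H x))"
      by (intro continuous_intros conts)+
    show ?thesis
      unfolding vol4_def[abs_def]
      by (simp only: IK_diff[OF continuous_on_mult_left[OF c(1)] c(2)] IK_cmult)
  qed
  show ?thesis unfolding 1 2 3 4 by (simp add: IB_minus)
qed

lemma equation5:
  assumes u: "vpoly k u" and J: "vpoly k J" and b: "vpoly k b" and r: "r \<in> polys j" and c: "vpoly k c"
  shows "ip K (rs J) (\<lambda>x. curl_v \<C> (jac K (rs c) x)) - ip K (rs r) (div_v K (rs c))
        - \<kappa> * ip K (rs u) (\<lambda>x. cross_s \<C> (d x) (curl_v \<C> (jac K (rs c) x)))
        + bip K (flux5 \<C> \<kappa> d \<beta>1 \<beta>2 K uh bh rh (rs u) (rs J) (rs b)) (rs c)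
    = IK (vol5 u J r c) + IB (bd5 u J b c) - IB (da5 c)"
proof -
  note conts = vconts[OF u] vpoly_continuous[OF J] mpoly_continuous[OF Dv_mpoly[OF J]] vconts[OF b] pconts[OF r] vconts[OF c]
  have 1: "ip K (rs J) (\<lambda>x. curl_v \<C> (jac K (rs c) x)) = IK (\<lambda>x. J x \<bullet> curl_v \<C> (Dv c x))"
    by (rule ip_IK) (simp add: interior_in jac_interior[OF c])
  have 2: "ip K (rs r) (div_v K (rs c)) = IK (\<lambda>x. r x * dvg c x)"
    by (rule ip_IK) (simp add: interior_in div_v_interior[OF c])
  have 3: "ip K (rs u) (\<lambda>x. cross_s \<C> (d x) (curl_v \<C> (jac K (rs c) x))) = IK (\<lambda>x. u x \<bullet> cs (td x) (curl_v \<C> (Dv c x)))"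
    by (rule ip_IK) (simp add: interior_in jac_interior[OF c] td_interior)
  have 4: "bip K (flux5 \<C> \<kappa> d \<beta>1 \<beta>2 K uh bh rh (rs u) (rs J) (rs b)) (rs c)
      = IB (\<lambda>F x. bd5 u J b c F x - da5 c F x)"
  proof (rule bip_IB)
    fix F x assume "F facet_of K" "x \<in> F"
    then have x: "x \<in> K" by (rule facet_in)
    show "flux5 \<C> \<kappa> d \<beta>1 \<beta>2 K uh bh rh (rs u) (rs J) (rs b) F x \<bullet> rs c x = bd5 u J b c F x - da5 c F x"
      using x cross_lin(1)[of "u x" 1 "uh x" "td x"] cross_lin(3)[of "nu F" "cv (u x) (td x)" 1 "cv (uh x) (td x)"]
      by (simp add: flux5_def Let_def bd5_def da5_def inner_add_left inner_diff_left matrix_vector_mult_diff_distrib distrib_left right_diff_distrib)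
  qed
  have 5: "IB (\<lambda>F x. bd5 u J b c F x - da5 c F x) = IB (bd5 u J b c) - IB (da5 c)"
    by (rule IB_diff[OF bcont_bd(3)[OF u J b c] bcont_da(4)[OF c]])
  have 6: "IK (vol5 u J r c) = IK (\<lambda>x. J x \<bullet> curl_v \<C> (Dv c x)) - IK (\<lambda>x. r x * dvg c x)
      - \<kappa> * IK (\<lambda>x. u x \<bullet> cs (td x) (curl_v \<C> (Dv c x)))"
  proof -
    have c: "continuous_on K (\<lambda>x. J x \<bullet> curl_v \<C> (Dv c x))" "continuous_on K (\<lambda>x. r x * dvg c x)"
      "continuous_on K (\<lambda>x. u x \<bullet> cs (td x) (curl_v \<C> (Dv c x)))"
      by (intro continuous_intros td conts)+
    show ?thesis
      unfolding vol5_def[abs_def]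
      by (simp add: IK_add IK_diff IK_cmult continuous_on_add continuous_on_diff continuous_on_mult_left c)
  qed
  show ?thesis unfolding 1 2 3 4 5 6 by simp
qed

end

text \<open>The unknowns travel as one function with values in a product space, so that a single
  Galerkin statement covers the coupled system; \<open>c1\<close> to \<open>c6\<close> extract
  them.\<close>

definition "c1 Z x = fst (Z x)"
definition "c2 Z x = fst (snd (Z x))"
definition "c3 Z x = fst (snd (snd (Z x)))"
definition "c4 Z x = fst (snd (snd (snd (Z x))))"
definition "c5 Z x = fst (snd (snd (snd (snd (Z x)))))"
definition "c6 Z x = snd (snd (snd (snd (snd (Z x)))))"

lemmas c_defs = c1_def c2_def c3_def c4_def c5_def c6_def

definition "tup L u p J b r x = (L x, u x, p x, J x, b x, r x)"

lemma c_tup [simp]: "c1 (tup L u p J b r) = L" "c2 (tup L u p J b r) = u" "c3 (tup L u p J b r) = p"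
  "c4 (tup L u p J b r) = J" "c5 (tup L u p J b r) = b" "c6 (tup L u p J b r) = r"
  by (simp_all add: c_defs tup_def fun_eq_iff)

lemma c_lin:
  "c1 (\<lambda>x. Z x + t *\<^sub>R Z' x) = (\<lambda>x. c1 Z x + t *\<^sub>R c1 Z' x)"
  "c2 (\<lambda>x. Z x + t *\<^sub>R Z' x) = (\<lambda>x. c2 Z x + t *\<^sub>R c2 Z' x)"
  "c3 (\<lambda>x. Z x + t *\<^sub>R Z' x) = (\<lambda>x. c3 Z x + t *\<^sub>R c3 Z' x)"
  "c4 (\<lambda>x. Z x + t *\<^sub>R Z' x) = (\<lambda>x. c4 Z x + t *\<^sub>R c4 Z' x)"
  "c5 (\<lambda>x. Z x + t *\<^sub>R Z' x) = (\<lambda>x. c5 Z x + t *\<^sub>R c5 Z' x)"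
  "c6 (\<lambda>x. Z x + t *\<^sub>R Z' x) = (\<lambda>x. c6 Z x + t *\<^sub>R c6 Z' x)"
  by (simp_all add: c_defs fun_eq_iff)

lemma ball_Basis_prod: "(\<forall>e\<in>Basis. P e) \<longleftrightarrow> (\<forall>e\<in>Basis. P (e, 0)) \<and> (\<forall>e\<in>Basis. P (0, e))"
  by (auto simp: Basis_prod_def)

lemma ball_Basis_vec: "(\<forall>e\<in>Basis. P (e :: 'a::euclidean_space^'n)) \<longleftrightarrow> (\<forall>i. \<forall>e\<in>Basis. P (axis i e))"
  by (auto simp: Basis_vec_def)

definition solution_space :: "nat \<Rightarrow> (real^'n \<Rightarrow> (real^'n^'n) \<times> (real^'n) \<times> real \<times> (real^'m) \<times> (real^'n) \<times> real) set" where
  "solution_space k = {Z. mpoly k (c1 Z) \<and> vpoly k (c2 Z) \<and> c3 Z \<in> polys (k - 1) \<and>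
     vpoly k (c4 Z) \<and> vpoly k (c5 Z) \<and> c6 Z \<in> polys (k - 1)}"

lemma solution_space_span:
  fixes k :: nat
  defines "X \<equiv> solution_space k :: (real^'n \<Rightarrow> (real^'n^'n) \<times> (real^'n) \<times> real \<times> (real^'m) \<times> (real^'n) \<times> real) set"
  shows "\<exists>(I :: (((real^'n^'n) \<times> (real^'n) \<times> real \<times> (real^'m) \<times> (real^'n) \<times> real) \<times> ('n \<Rightarrow> nat)) set) \<phi>.
    finite I \<and> X = range (\<lambda>c x. \<Sum>i\<in>I. c i *\<^sub>R \<phi> i x)"
proof -
  \<comment> \<open>A basis vector of the product has exactly one nonzero slot; slots three and six
    hold p and r, of degree k - 1.\<close>
  define dg :: "(real^'n^'n) \<times> (real^'n) \<times> real \<times> (real^'m) \<times> (real^'n) \<times> real \<Rightarrow> nat"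
    where "dg e = (if fst (snd (snd e)) = 0 \<and> snd (snd (snd (snd (snd e)))) = 0 then k else k - 1)" for e
  have "X = {Z. \<forall>e\<in>Basis. (\<lambda>x. Z x \<bullet> e) \<in> polys (dg e)}"
    unfolding X_def solution_space_def
    by (simp add: ball_Basis_prod ball_Basis_vec dg_def inner_prod_def inner_axis mpoly_def vpoly_def c_defs[abs_def] zero_prod_def
        del: One_nat_def)
  also have "\<dots> = range (\<lambda>c x. \<Sum>i\<in>(SIGMA e:Basis. {a. sum a UNIV \<le> dg e}). c i *\<^sub>R (mpow (snd i) x *\<^sub>R fst i))"
    by (rule polynomial_space_span)
  finally have "X = range (\<lambda>c x. \<Sum>i\<in>(SIGMA e:Basis. {a. sum a UNIV \<le> dg e}). c i *\<^sub>R (mpow (snd i) x *\<^sub>R fst i))" .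
  moreover have "finite (SIGMA e:Basis. {a :: 'n \<Rightarrow> nat. sum a UNIV \<le> dg e})"
    by (intro finite_SigmaI finite_Basis finite_multiindices)
  ultimately show ?thesis by (intro exI conjI)
qed

context local_solver
begin

definition "X = (solution_space k :: ((real, 'n) vec \<Rightarrow> _ \<times> _ \<times> _ \<times> (real, 'm) vec \<times> _ \<times> _) set)"

lemma XD: "Z \<in> X \<Longrightarrow> mpoly k (c1 Z)" "Z \<in> X \<Longrightarrow> vpoly k (c2 Z)" "Z \<in> X \<Longrightarrow> c3 Z \<in> polys (k - 1)"
  "Z \<in> X \<Longrightarrow> vpoly k (c4 Z)" "Z \<in> X \<Longrightarrow> vpoly k (c5 Z)" "Z \<in> X \<Longrightarrow> c6 Z \<in> polys (k - 1)"
  by (simp_all add: X_def solution_space_def)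

lemma XI: "mpoly k L \<Longrightarrow> vpoly k u \<Longrightarrow> p \<in> polys (k - 1) \<Longrightarrow> vpoly k J \<Longrightarrow> vpoly k b \<Longrightarrow> r \<in> polys (k - 1)
  \<Longrightarrow> tup L u p J b r \<in> X"
  by (simp add: X_def solution_space_def)

text \<open>Sum of the six equations. Their test functions vary independently, so one equation
  between B and \<open>rhs\<close> is equivalent to all six.\<close>

definition B where
  "B Z Y = IK (vol1 (c1 Z) (c2 Z) (c1 Y))
    + (IK (vol2 (c1 Z) (c2 Z) (c3 Z) (c5 Z) (c2 Y)) + IB (bd2 (c1 Z) (c2 Z) (c5 Z) (c2 Y)))
    + (IK (vol3 (c2 Z) (c3 Y)) + IB (bd3 (c2 Z) (c3 Y)))
    + IK (vol4 (c4 Z) (c5 Z) (c4 Y))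
    + (IK (vol5 (c2 Z) (c4 Z) (c6 Z) (c5 Y)) + IB (bd5 (c2 Z) (c4 Z) (c5 Z) (c5 Y)))
    + (IK (vol3 (c5 Z) (c6 Y)) + IB (bd3 (c5 Z) (c6 Y)))"

definition rhs where
  "rhs Y = IB (da1 (c1 Y)) + (IK (\<lambda>x. g x \<bullet> c2 Y x) + IB (da2 (c2 Y))) + IB (da4 (c4 Y))
    + (IK (\<lambda>x. f x \<bullet> c5 Y x) + IB (da5 (c5 Y)))"

lemma vol_trial_lin:
  "vol1 (\<lambda>x. L x + t *\<^sub>R L' x) (\<lambda>x. u x + t *\<^sub>R u' x) G = (\<lambda>x. vol1 L u G x + t * vol1 L' u' G x)"
  "vpoly k b \<Longrightarrow> vpoly k b' \<Longrightarrow> vol2 (\<lambda>x. L x + t *\<^sub>R L' x) (\<lambda>x. u x + t *\<^sub>R u' x) (\<lambda>x. p x + t *\<^sub>R p' x) (\<lambda>x. b x + t *\<^sub>R b' x) v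
    = (\<lambda>x. vol2 L u p b v x + t * vol2 L' u' p' b' v x)"
  "vol3 (\<lambda>x. u x + t *\<^sub>R u' x) q = (\<lambda>x. vol3 u q x + t * vol3 u' q x)"
  "vol4 (\<lambda>x. J x + t *\<^sub>R J' x) (\<lambda>x. b x + t *\<^sub>R b' x) H = (\<lambda>x. vol4 J b H x + t * vol4 J' b' H x)"
  "vol5 (\<lambda>x. u x + t *\<^sub>R u' x) (\<lambda>x. J x + t *\<^sub>R J' x) (\<lambda>x. r x + t *\<^sub>R r' x) c
    = (\<lambda>x. vol5 u J r c x + t * vol5 u' J' r' c x)"
  by (simp_all add: fun_eq_iff vol1_def vol2_def vol3_def vol4_def vol5_def inner_add_left inner_add_right Dv_lin curl_lin
      outer_lin algebra_simps)

lemma bd_trial_lin: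
  "bd2 (\<lambda>x. L x + t *\<^sub>R L' x) (\<lambda>x. u x + t *\<^sub>R u' x) (\<lambda>x. b x + t *\<^sub>R b' x) v
    = (\<lambda>F x. bd2 L u b v F x + t * bd2 L' u' b' v F x)"
  "bd3 (\<lambda>x. u x + t *\<^sub>R u' x) q = (\<lambda>F x. bd3 u q F x + t * bd3 u' q F x)"
  "bd5 (\<lambda>x. u x + t *\<^sub>R u' x) (\<lambda>x. J x + t *\<^sub>R J' x) (\<lambda>x. b x + t *\<^sub>R b' x) c
    = (\<lambda>F x. bd5 u J b c F x + t * bd5 u' J' b' c F x)"
  by (simp_all add: fun_eq_iff bd2_def bd3_def bd5_def inner_add_left inner_add_right cross_lin
      matrix_vector_right_distrib matrix_vector_mult_scaleR algebra_simps)

lemma vol_test_lin: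
  "mpoly k G \<Longrightarrow> mpoly k G' \<Longrightarrow> vol1 L u (\<lambda>x. G x + t *\<^sub>R G' x) = (\<lambda>x. vol1 L u G x + t * vol1 L u G' x)"
  "vpoly k v \<Longrightarrow> vpoly k v' \<Longrightarrow> vol2 L u p b (\<lambda>x. v x + t *\<^sub>R v' x) = (\<lambda>x. vol2 L u p b v x + t * vol2 L u p b v' x)"
  "q \<in> polys j \<Longrightarrow> q' \<in> polys j \<Longrightarrow> vol3 u (\<lambda>x. q x + t *\<^sub>R q' x) = (\<lambda>x. vol3 u q x + t * vol3 u q' x)"
  "vpoly k H \<Longrightarrow> vpoly k H' \<Longrightarrow> vol4 J b (\<lambda>x. H x + t *\<^sub>R H' x) = (\<lambda>x. vol4 J b H x + t * vol4 J b H' x)"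
  "vpoly k c \<Longrightarrow> vpoly k c' \<Longrightarrow> vol5 u J r (\<lambda>x. c x + t *\<^sub>R c' x) = (\<lambda>x. vol5 u J r c x + t * vol5 u J r c' x)"
  by (simp_all add: fun_eq_iff vol1_def vol2_def vol3_def vol4_def vol5_def inner_add_left inner_add_right Dv_lin dvm_lin
      dvg_lin gr_lin curl_lin cross_lin algebra_simps)

lemma bd_test_lin:
  "bd2 L u b (\<lambda>x. v x + t *\<^sub>R v' x) = (\<lambda>F x. bd2 L u b v F x + t * bd2 L u b v' F x)"
  "bd3 u (\<lambda>x. q x + t *\<^sub>R q' x) = (\<lambda>F x. bd3 u q F x + t * bd3 u q' F x)"
  "bd5 u J b (\<lambda>x. c x + t *\<^sub>R c' x) = (\<lambda>F x. bd5 u J b c F x + t * bd5 u J b c' F x)"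
  by (simp_all add: fun_eq_iff bd2_def bd3_def bd5_def inner_add_left inner_add_right cross_lin outer_lin algebra_simps)

lemma da_lin:
  "da1 (\<lambda>x. G x + t *\<^sub>R G' x) = (\<lambda>F x. da1 G F x + t * da1 G' F x)"
  "da2 (\<lambda>x. v x + t *\<^sub>R v' x) = (\<lambda>F x. da2 v F x + t * da2 v' F x)"
  "da4 (\<lambda>x. H x + t *\<^sub>R H' x) = (\<lambda>F x. da4 H F x + t * da4 H' F x)"
  "da5 (\<lambda>x. c x + t *\<^sub>R c' x) = (\<lambda>F x. da5 c F x + t * da5 c' F x)"
  by (simp_all add: fun_eq_iff da1_def da2_def da4_def da5_def inner_add_right algebra_simps)

lemmas IK_vol_lin = IK_lin[OF integrable_continuous integrable_continuous]

lemma B_trial_lin: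
  assumes "Z \<in> X" "Z' \<in> X" "Y \<in> X"
  shows "B (\<lambda>x. Z x + t *\<^sub>R Z' x) Y = B Z Y + t * B Z' Y"
  unfolding B_def c_lin vol_trial_lin(1,3,4,5) vol_trial_lin(2)[OF XD(5)[OF assms(1)] XD(5)[OF assms(2)]] bd_trial_lin
  by (simp add: IK_vol_lin IB_lin continuous_vol(1)[OF XD(1,2,1)] continuous_vol(2)[OF XD(1,2,3,5,2)]
      continuous_vol(3)[OF XD(2,3)] continuous_vol(3)[OF XD(5,6)] continuous_vol(4)[OF XD(4,5,4)]
      continuous_vol(5)[OF XD(2,4,6,5)] bcont_bd(1)[OF XD(1,2,5,2)] bcont_bd(2)[OF XD(2,3)] bcont_bd(2)[OF XD(5,6)]
      bcont_bd(3)[OF XD(2,4,5,5)] assms distrib_left)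

lemma B_test_lin:
  assumes "Z \<in> X" "Y \<in> X" "Y' \<in> X"
  shows "B Z (\<lambda>x. Y x + t *\<^sub>R Y' x) = B Z Y + t * B Z Y'"
  unfolding B_def c_lin vol_test_lin(1)[OF XD(1)[OF assms(2)] XD(1)[OF assms(3)]]
    vol_test_lin(2)[OF XD(2)[OF assms(2)] XD(2)[OF assms(3)]] vol_test_lin(3)[OF XD(3)[OF assms(2)] XD(3)[OF assms(3)]]
    vol_test_lin(3)[OF XD(6)[OF assms(2)] XD(6)[OF assms(3)]]
    vol_test_lin(4)[OF XD(4)[OF assms(2)] XD(4)[OF assms(3)]] vol_test_lin(5)[OF XD(5)[OF assms(2)] XD(5)[OF assms(3)]]
    bd_test_lin
  by (simp add: IK_vol_lin IB_lin continuous_vol(1)[OF XD(1,2,1)] continuous_vol(2)[OF XD(1,2,3,5,2)]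
      continuous_vol(3)[OF XD(2,3)] continuous_vol(3)[OF XD(5,6)] continuous_vol(4)[OF XD(4,5,4)]
      continuous_vol(5)[OF XD(2,4,6,5)] bcont_bd(1)[OF XD(1,2,5,2)] bcont_bd(2)[OF XD(2,3)] bcont_bd(2)[OF XD(5,6)]
      bcont_bd(3)[OF XD(2,4,5,5)] assms distrib_left)

lemma rhs_lin:
  assumes "Y \<in> X" "Y' \<in> X"
  shows "rhs (\<lambda>x. Y x + t *\<^sub>R Y' x) = rhs Y + t * rhs Y'"
proof -
  have ilin: "IK (\<lambda>x. h x \<bullet> (v x + t *\<^sub>R v' x)) = IK (\<lambda>x. h x \<bullet> v x) + t * IK (\<lambda>x. h x \<bullet> v' x)"
    if "integrable (lebesgue_on K) h" "vpoly k v" "vpoly k v'" for h v v'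
    using IK_lin[OF integrable_inner_vpoly[OF that(1,2)] integrable_inner_vpoly[OF that(1,3)], of t]
    by (simp add: inner_add_right)
  then show ?thesis
    unfolding rhs_def c_lin da_lin
      ilin[OF g XD(2)[OF assms(1)] XD(2)[OF assms(2)]] ilin[OF f XD(5)[OF assms(1)] XD(5)[OF assms(2)]]
    by (simp add: IB_lin bcont_da(1)[OF XD(1)] bcont_da(2)[OF XD(2)] bcont_da(3)[OF XD(4)] bcont_da(4)[OF XD(5)]
      assms distrib_left)
qed

lemma jets_cong:
  fixes G G' :: "(real, 'n) vec \<Rightarrow> ((real, 'n) vec, 'n) vec"
  shows "vpoly k u \<Longrightarrow> vpoly k u' \<Longrightarrow> (\<And>y. y \<in> K \<Longrightarrow> u y = u' y) \<Longrightarrow> x \<in> interior K \<Longrightarrow> Dv u x = Dv u' x"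
    and "vpoly k v \<Longrightarrow> vpoly k v' \<Longrightarrow> (\<And>y. y \<in> K \<Longrightarrow> v y = v' y) \<Longrightarrow> x \<in> interior K \<Longrightarrow> dvg v x = dvg v' x"
    and "mpoly k G \<Longrightarrow> mpoly k G' \<Longrightarrow> (\<And>y. y \<in> K \<Longrightarrow> G y = G' y) \<Longrightarrow> x \<in> interior K \<Longrightarrow> dvm G x = dvm G' x"
    and "q \<in> polys j \<Longrightarrow> q' \<in> polys j \<Longrightarrow> (\<And>y. y \<in> K \<Longrightarrow> q y = q' y) \<Longrightarrow> x \<in> interior K \<Longrightarrow> gr q x = gr q' x"
proof -
  show "Dv u x = Dv u' x" if "vpoly k u" "vpoly k u'" "\<And>y. y \<in> K \<Longrightarrow> u y = u' y" "x \<in> interior K"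
    using jac_interior[OF that(1) _ that(4), of u] jac_interior[OF that(2) that(3) that(4)] by simp
  show "dvg v x = dvg v' x" if "vpoly k v" "vpoly k v'" "\<And>y. y \<in> K \<Longrightarrow> v y = v' y" "x \<in> interior K"
    using div_v_interior[OF that(1) _ that(4), of v] div_v_interior[OF that(2) that(3) that(4)] by simp
  show "dvm G x = dvm G' x" if "mpoly k G" "mpoly k G'" "\<And>y. y \<in> K \<Longrightarrow> G y = G' y" "x \<in> interior K"
    using div_m_interior[OF that(1) _ that(4), of G] div_m_interior[OF that(2) that(3) that(4)] by simp
  show "gr q x = gr q' x" if "q \<in> polys j" "q' \<in> polys j" "\<And>y. y \<in> K \<Longrightarrow> q y = q' y" "x \<in> interior K"
    using grad_interior[OF that(1) _ that(4), of q] grad_interior[OF that(2) that(3) that(4)] by simp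
qed

text \<open>Boundary terms are pointwise on K, and volume terms involve derivatives only in the
  interior, where they are fixed by the values on K. This is the congruence on which pruning to K
  relies.\<close>

lemma B_rhs_cong:
  assumes "Y \<in> X" "Y' \<in> X" and eq: "\<And>x. x \<in> K \<Longrightarrow> Y x = Y' x"
  shows "B Z Y = B Z Y'" and "rhs Y = rhs Y'"
proof -
  note D = XD[OF assms(1)] XD[OF assms(2)]
  have c: "c1 Y x = c1 Y' x" "c2 Y x = c2 Y' x" "c3 Y x = c3 Y' x" "c4 Y x = c4 Y' x" "c5 Y x = c5 Y' x" "c6 Y x = c6 Y' x"
    if "x \<in> K" for x using eq[OF that] by (simp_all add: c_defs)
  have j: "dvm (c1 Y) x = dvm (c1 Y') x" "Dv (c2 Y) x = Dv (c2 Y') x" "dvg (c2 Y) x = dvg (c2 Y') x"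
    "gr (c3 Y) x = gr (c3 Y') x" "Dv (c4 Y) x = Dv (c4 Y') x" "Dv (c5 Y) x = Dv (c5 Y') x" "dvg (c5 Y) x = dvg (c5 Y') x"
    "gr (c6 Y) x = gr (c6 Y') x"
    if "x \<in> interior K" for x
    using jets_cong(3)[OF D(1,7) c(1) that] jets_cong(1)[OF D(2,8) c(2) that] jets_cong(2)[OF D(2,8) c(2) that]
      jets_cong(4)[OF D(3,9) c(3) that] jets_cong(1)[OF D(4,10) c(4) that] jets_cong(1)[OF D(5,11) c(5) that]
      jets_cong(2)[OF D(5,11) c(5) that] jets_cong(4)[OF D(6,12) c(6) that] by simp_all
  have v: "IK (vol1 L u (c1 Y)) = IK (vol1 L u (c1 Y'))" "IK (vol2 L u p b (c2 Y)) = IK (vol2 L u p b (c2 Y'))"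
    "IK (vol3 u (c3 Y)) = IK (vol3 u (c3 Y'))" "IK (vol4 J b (c4 Y)) = IK (vol4 J b (c4 Y'))"
    "IK (vol5 u J r (c5 Y)) = IK (vol5 u J r (c5 Y'))" "IK (vol3 u (c6 Y)) = IK (vol3 u (c6 Y'))"
    for L u p b J r
    by (rule IK_cong; simp add: vol1_def vol2_def vol3_def vol4_def vol5_def c j interior_in)+
  have b: "IB (bd2 L u b (c2 Y)) = IB (bd2 L u b (c2 Y'))" "IB (bd3 u (c3 Y)) = IB (bd3 u (c3 Y'))"
    "IB (bd5 u J b (c5 Y)) = IB (bd5 u J b (c5 Y'))" "IB (bd3 u (c6 Y)) = IB (bd3 u (c6 Y'))"
    for L u p b J r
    by (rule IB_cong; simp add: bd2_def bd3_def bd5_def c facet_in)+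
  show "B Z Y = B Z Y'" unfolding B_def v b ..
  have r: "IB (da1 (c1 Y)) = IB (da1 (c1 Y'))" "IB (da2 (c2 Y)) = IB (da2 (c2 Y'))"
    "IB (da4 (c4 Y)) = IB (da4 (c4 Y'))" "IB (da5 (c5 Y)) = IB (da5 (c5 Y'))"
    by (rule IB_cong; simp add: da1_def da2_def da4_def da5_def c facet_in)+
  have i: "IK (\<lambda>x. g x \<bullet> c2 Y x) = IK (\<lambda>x. g x \<bullet> c2 Y' x)" "IK (\<lambda>x. f x \<bullet> c5 Y x) = IK (\<lambda>x. f x \<bullet> c5 Y' x)"
    by (rule IK_cong; simp add: c interior_in)+
  show "rhs Y = rhs Y'" unfolding rhs_def r i ..
qed

lemma test_zero [simp]:
  "vol1 L u (\<lambda>x. 0) = (\<lambda>x. 0)" "vol2 L u p b (\<lambda>x. 0) = (\<lambda>x. 0)" "vol3 u (\<lambda>x. 0) = (\<lambda>x. 0)"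
  "vol4 J b (\<lambda>x. 0) = (\<lambda>x. 0)" "vol5 u J r (\<lambda>x. 0) = (\<lambda>x. 0)"
  "bd2 L u b (\<lambda>x. 0) = (\<lambda>F x. 0)" "bd3 u (\<lambda>x. 0) = (\<lambda>F x. 0)" "bd5 u J b (\<lambda>x. 0) = (\<lambda>F x. 0)"
  "da1 (\<lambda>x. 0) = (\<lambda>F x. 0)" "da2 (\<lambda>x. 0) = (\<lambda>F x. 0)" "da4 (\<lambda>x. 0) = (\<lambda>F x. 0)" "da5 (\<lambda>x. 0) = (\<lambda>F x. 0)"
  "IK (\<lambda>x. 0) = 0" "IB (\<lambda>F x. 0) = 0"
  by (simp_all add: fun_eq_iff vol1_def vol2_def vol3_def vol4_def vol5_def bd2_def bd3_def bd5_def
      da1_def da2_def da4_def da5_def IK_def IB_def outer_def vec_eq_iff[where 'a = "(real, 'n) vec"] inner_matrix)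

definition rtup where
  "rtup Z = (rs (c1 Z), rs (c2 Z), rs (c3 Z), rs (c4 Z), rs (c5 Z), rs (c6 Z))"

text \<open>Solutions are restrictions to K of elements of X. The single variational equation is the
  sum of the six, and these are recovered by testing with tuples that have one nonzero slot.\<close>

lemma local_solutions_iff:
  "z \<in> local_solutions \<C> k Rey Rem \<kappa> d w \<alpha>1 \<beta>1 \<beta>2 K uh ph bh rh f g
    \<longleftrightarrow> (\<exists>Z\<in>X. z = rtup Z \<and> (\<forall>Y\<in>X. B Z Y = rhs Y))"
proof -
  let ?E1 = "\<lambda>L u G. Rey * ip K L G + ip K u (div_m K G) + bip K (flux1 K uh) G = 0"
  let ?E2 = "\<lambda>L u p b v. ip K L (jac K v) - ip K p (div_v K v) - ip K (\<lambda>x. outer (u x) (w x)) (jac K v)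
        + \<kappa> * ip K b (\<lambda>x. curl_s \<C> (weak_jac (interior K) (\<lambda>y. cross_v \<C> (v y) (d y)) x))
        + bip K (flux2 \<C> \<kappa> d w \<alpha>1 K uh ph bh L u b) v = ip K g v"
  let ?E3 = "\<lambda>u q. - ip K u (grad K q) + bip K (flux3 K u) q = 0"
  let ?E4 = "\<lambda>J b H. Rem / \<kappa> * ip K J H - ip K b (\<lambda>x. curl_s \<C> (jac K H x))
        + bip K (flux4 \<C> K bh) H = 0"
  let ?E5 = "\<lambda>u J b r c. ip K J (\<lambda>x. curl_v \<C> (jac K c x)) - ip K r (div_v K c)
        - \<kappa> * ip K u (\<lambda>x. cross_s \<C> (d x) (curl_v \<C> (jac K c x)))
        + bip K (flux5 \<C> \<kappa> d \<beta>1 \<beta>2 K uh bh rh u J b) c = ip K f c"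
  let ?E6 = "\<lambda>b s. - ip K b (grad K s) + bip K (flux6 K b) s = 0"
  define S where "S L u p J b r \<longleftrightarrow> (\<forall>G. mpoly k G \<longrightarrow> ?E1 (rs L) (rs u) (rs G)) \<and>
    (\<forall>v. vpoly k v \<longrightarrow> ?E2 (rs L) (rs u) (rs p) (rs b) (rs v)) \<and> (\<forall>q\<in>polys (k - 1). ?E3 (rs u) (rs q)) \<and>
    (\<forall>H. vpoly k H \<longrightarrow> ?E4 (rs J) (rs b) (rs H)) \<and> (\<forall>c. vpoly k c \<longrightarrow> ?E5 (rs u) (rs J) (rs b) (rs r) (rs c)) \<and>
    (\<forall>s\<in>polys (k - 1). ?E6 (rs b) (rs s))" for L u p J b r
  have "z \<in> local_solutions \<C> k Rey Rem \<kappa> d w \<alpha>1 \<beta>1 \<beta>2 K uh ph bh rh f g \<longleftrightarrow>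
    (\<exists>L u p J b r. mpoly k L \<and> vpoly k u \<and> p \<in> polys (k - 1) \<and> vpoly k J \<and> vpoly k b \<and> r \<in> polys (k - 1) \<and>
      z = (rs L, rs u, rs p, rs J, rs b, rs r) \<and> S L u p J b r)"
    unfolding local_solutions_def poly_m_restrict poly_v_restrict poly_s_restrict S_def
    by (simp only: ball_simps mem_Collect_eq split_paired_all case_prod_conv) blast
  also have "\<dots> \<longleftrightarrow> (\<exists>Z\<in>X. z = rtup Z \<and> S (c1 Z) (c2 Z) (c3 Z) (c4 Z) (c5 Z) (c6 Z))"
  proof
    assume "\<exists>L u p J b r. mpoly k L \<and> vpoly k u \<and> p \<in> polys (k - 1) \<and> vpoly k J \<and> vpoly k b \<and> r \<in> polys (k - 1) \<and>
      z = (rs L, rs u, rs p, rs J, rs b, rs r) \<and> S L u p J b r"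
    then obtain L u p J b r where "mpoly k L" "vpoly k u" "p \<in> polys (k - 1)" "vpoly k J" "vpoly k b" "r \<in> polys (k - 1)"
      "z = (rs L, rs u, rs p, rs J, rs b, rs r)" "S L u p J b r" by blast
    then show "\<exists>Z\<in>X. z = rtup Z \<and> S (c1 Z) (c2 Z) (c3 Z) (c4 Z) (c5 Z) (c6 Z)"
      by (intro bexI[of _ "tup L u p J b r"] XI) (simp_all add: rtup_def)
  next
    assume "\<exists>Z\<in>X. z = rtup Z \<and> S (c1 Z) (c2 Z) (c3 Z) (c4 Z) (c5 Z) (c6 Z)"
    then obtain Z where "Z \<in> X" "z = rtup Z" "S (c1 Z) (c2 Z) (c3 Z) (c4 Z) (c5 Z) (c6 Z)" by blast
    then show "\<exists>L u p J b r. mpoly k L \<and> vpoly k u \<and> p \<in> polys (k - 1) \<and> vpoly k J \<and> vpoly k b \<and> r \<in> polys (k - 1) \<and>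
      z = (rs L, rs u, rs p, rs J, rs b, rs r) \<and> S L u p J b r"
      by (intro exI[of _ "c1 Z"] exI[of _ "c2 Z"] exI[of _ "c3 Z"] exI[of _ "c4 Z"] exI[of _ "c5 Z"] exI[of _ "c6 Z"])
        (simp only: XD rtup_def simp_thms)
  qed
  also have "\<dots> \<longleftrightarrow> (\<exists>Z\<in>X. z = rtup Z \<and> (\<forall>Y\<in>X. B Z Y = rhs Y))"
  proof (intro bex_cong refl conj_cong)
    fix Z assume Z: "Z \<in> X"
    note D = XD[OF Z]
    have gv: "ip K g (rs v) = IK (\<lambda>x. g x \<bullet> v x)" and fv: "ip K f (rs v) = IK (\<lambda>x. f x \<bullet> v x)" for v
      by (rule ip_IK; simp add: interior_in)+
    have S_eq: "S (c1 Z) (c2 Z) (c3 Z) (c4 Z) (c5 Z) (c6 Z) \<longleftrightarrow>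
      (\<forall>G. mpoly k G \<longrightarrow> IK (vol1 (c1 Z) (c2 Z) G) = IB (da1 G)) \<and>
      (\<forall>v. vpoly k v \<longrightarrow> IK (vol2 (c1 Z) (c2 Z) (c3 Z) (c5 Z) v) + IB (bd2 (c1 Z) (c2 Z) (c5 Z) v) = IK (\<lambda>x. g x \<bullet> v x) + IB (da2 v)) \<and>
      (\<forall>q\<in>polys (k - 1). IK (vol3 (c2 Z) q) + IB (bd3 (c2 Z) q) = 0) \<and>
      (\<forall>H. vpoly k H \<longrightarrow> IK (vol4 (c4 Z) (c5 Z) H) = IB (da4 H)) \<and>
      (\<forall>c. vpoly k c \<longrightarrow> IK (vol5 (c2 Z) (c4 Z) (c6 Z) c) + IB (bd5 (c2 Z) (c4 Z) (c5 Z) c) = IK (\<lambda>x. f x \<bullet> c x) + IB (da5 c)) \<and>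
      (\<forall>s\<in>polys (k - 1). IK (vol3 (c5 Z) s) + IB (bd3 (c5 Z) s) = 0)"
      unfolding S_def gv fv
      by (intro conj_cong all_cong1 imp_cong ball_cong refl)
        (simp_all only: equation1[OF D(1,2)] equation2[OF D(1,2,3,5)] equation3[OF D(2)] equation3[OF D(5)] equation4[OF D(4,5)]
          equation5[OF D(2,4,5,6)] diff_eq_eq add_0)
    show "S (c1 Z) (c2 Z) (c3 Z) (c4 Z) (c5 Z) (c6 Z) \<longleftrightarrow> (\<forall>Y\<in>X. B Z Y = rhs Y)"
    proof
      assume "S (c1 Z) (c2 Z) (c3 Z) (c4 Z) (c5 Z) (c6 Z)"
      then show "\<forall>Y\<in>X. B Z Y = rhs Y"
        unfolding S_eq B_def rhs_def using XD by simp
    next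
      assume *: "\<forall>Y\<in>X. B Z Y = rhs Y"
      note z = mpoly_zero vpoly_zero polys_zero
      have "B Z (tup G v q H c s) = rhs (tup G v q H c s)"
        if "mpoly k G" "vpoly k v" "q \<in> polys (k - 1)" "vpoly k H" "vpoly k c" "s \<in> polys (k - 1)" for G v q H c s
        using * XI that by blast
      note ** = this[unfolded B_def rhs_def c_tup]
      show "S (c1 Z) (c2 Z) (c3 Z) (c4 Z) (c5 Z) (c6 Z)"
        unfolding S_eq
      proof (intro conjI allI ballI impI)
        show "IK (vol1 (c1 Z) (c2 Z) G) = IB (da1 G)" if "mpoly k G" for G
          using **[OF that z(2) z(3) z(2) z(2) z(3)] by simp
        show "IK (vol2 (c1 Z) (c2 Z) (c3 Z) (c5 Z) v) + IB (bd2 (c1 Z) (c2 Z) (c5 Z) v) = IK (\<lambda>x. g x \<bullet> v x) + IB (da2 v)"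
          if "vpoly k v" for v
          using **[OF z(1) that z(3) z(2) z(2) z(3)] by simp
        show "IK (vol3 (c2 Z) q) + IB (bd3 (c2 Z) q) = 0" if "q \<in> polys (k - 1)" for q
          using **[OF z(1,2) that z(2) z(2) z(3)] by simp
        show "IK (vol4 (c4 Z) (c5 Z) H) = IB (da4 H)" if "vpoly k H" for H
          using **[OF z(1,2,3) that z(2) z(3)] by simp
        show "IK (vol5 (c2 Z) (c4 Z) (c6 Z) c) + IB (bd5 (c2 Z) (c4 Z) (c5 Z) c) = IK (\<lambda>x. f x \<bullet> c x) + IB (da5 c)"
          if "vpoly k c" for c
          using **[OF z(1,2,3,2) that z(3)] by simp
        show "IK (vol3 (c5 Z) s) + IB (bd3 (c5 Z) s) = 0" if "s \<in> polys (k - 1)" for s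
          using **[OF z(1,2,3,2,2) that] by simp
      qed
    qed
  qed
  finally show ?thesis .
qed

end

section \<open>Integration by parts and the energy identity\<close>

lemma vpoly_inner_polys:
  fixes u v :: "real^'n \<Rightarrow> real^'l"
  assumes "vpoly k u" "vpoly l v"
  shows "(\<lambda>x. u x \<bullet> v x) \<in> polys (k + l)"
    and "pd (\<lambda>x. u x \<bullet> v x) j x = (\<Sum>i\<in>UNIV. u x $ i * Dv v x $ i $ j + Dv u x $ i $ j * v x $ i)"
proof -
  have p: "(\<lambda>x. u x $ i * v x $ i) \<in> polys (k + l)" for i
    by (intro polys_mult vpolyD[OF assms(1)] vpolyD[OF assms(2)])
  show "(\<lambda>x. u x \<bullet> v x) \<in> polys (k + l)"
    unfolding inner_vec_def inner_real_def by (intro polys_sum p)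
  have "pd (\<lambda>x. u x \<bullet> v x) j x = (\<Sum>i\<in>UNIV. pd (\<lambda>x. u x $ i * v x $ i) j x)"
    unfolding inner_vec_def inner_real_def by (rule pd_sum) (rule p)
  then show "pd (\<lambda>x. u x \<bullet> v x) j x = (\<Sum>i\<in>UNIV. u x $ i * Dv v x $ i $ j + Dv u x $ i $ j * v x $ i)"
    by (simp add: pd_mult[OF vpolyD[OF assms(1)] vpolyD[OF assms(2)]] Dv_def)
qed


context local_solver
begin

lemma divergence_polys:
  assumes \<psi>: "\<And>j. \<psi> j \<in> polys m"
  shows "IK (\<lambda>x. \<Sum>j\<in>UNIV. pd (\<psi> j) j x) = IB (\<lambda>F x. \<Sum>j\<in>UNIV. nu F $ j * \<psi> j x)"
proof -
  have 1: "continuous_on K (\<lambda>x. pd (\<psi> j) j x)" for j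
    by (rule polys_continuous[OF pd_polys[OF \<psi>]])
  have 2: "bcont (\<lambda>F x. nu F $ j * \<psi> j x)" for j
    by (intro bcontI continuous_intros polys_continuous[OF \<psi>])
  have "IK (\<lambda>x. \<Sum>j\<in>UNIV. pd (\<psi> j) j x) = (\<Sum>j\<in>UNIV. IB (\<lambda>F x. nu F $ j * \<psi> j x))"
    using 1 polynomial_divergence[OF \<psi>] by (simp add: IK_sum) (simp add: IK_def IB_def)
  then show ?thesis using 2 by (simp add: IB_sum)
qed

text \<open>Gauss's formula for the transpose of L applied to u.\<close>

lemma parts_matrix:
  assumes L: "mpoly k L" and u: "vpoly k u"
  shows "IK (\<lambda>x. u x \<bullet> dvm L x) + IK (\<lambda>x. L x \<bullet> Dv u x) = IB (\<lambda>F x. L x \<bullet> outer (u x) (nu F))"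
proof -
  let ?\<psi> = "\<lambda>j x. \<Sum>i\<in>UNIV. L x $ i $ j * u x $ i"
  have p: "(\<lambda>x. L x $ i $ j * u x $ i) \<in> polys (k + k)" for i j
    by (intro polys_mult mpolyD[OF L] vpolyD[OF u])
  have "(\<Sum>j\<in>UNIV. pd (?\<psi> j) j x) = u x \<bullet> dvm L x + L x \<bullet> Dv u x" for x
  proof -
    have "(\<Sum>j\<in>UNIV. pd (?\<psi> j) j x)
        = (\<Sum>j\<in>UNIV. \<Sum>i\<in>UNIV. L x $ i $ j * Dv u x $ i $ j + pd (\<lambda>x. L x $ i $ j) j x * u x $ i)"
      by (simp add: pd_sum[OF p] pd_mult[OF mpolyD[OF L] vpolyD[OF u]] Dv_def)
    also have "\<dots> = (\<Sum>i\<in>UNIV. \<Sum>j\<in>UNIV. L x $ i $ j * Dv u x $ i $ j + pd (\<lambda>x. L x $ i $ j) j x * u x $ i)"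
      by (rule sum.swap)
    also have "\<dots> = u x \<bullet> dvm L x + L x \<bullet> Dv u x"
      by (simp add: inner_matrix inner_vec_def[of "u x"] dvm_def sum.distrib sum_distrib_left mult.commute add.commute)
    finally show ?thesis .
  qed
  then have "IK (\<lambda>x. u x \<bullet> dvm L x + L x \<bullet> Dv u x) = IB (\<lambda>F x. \<Sum>j\<in>UNIV. nu F $ j * ?\<psi> j x)"
    using divergence_polys[of ?\<psi> "k + k"] polys_sum[of UNIV "\<lambda>i x. L x $ i $ j * u x $ i" "k + k" for j] p by simp
  also have "(\<lambda>F x. \<Sum>j\<in>UNIV. nu F $ j * ?\<psi> j x) = (\<lambda>F x. L x \<bullet> outer (u x) (nu F))"
  proof (intro ext)
    fix F x
    have "L x \<bullet> outer (u x) (nu F) = (\<Sum>i\<in>UNIV. \<Sum>j\<in>UNIV. L x $ i $ j * u x $ i * nu F $ j)"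
      by (simp add: inner_matrix outer_def mult.assoc)
    also have "\<dots> = (\<Sum>j\<in>UNIV. \<Sum>i\<in>UNIV. L x $ i $ j * u x $ i * nu F $ j)" by (rule sum.swap)
    also have "\<dots> = (\<Sum>j\<in>UNIV. nu F $ j * ?\<psi> j x)" by (simp add: sum_distrib_left mult_ac)
    finally show "(\<Sum>j\<in>UNIV. nu F $ j * ?\<psi> j x) = L x \<bullet> outer (u x) (nu F)" by simp
  qed
  also have "IK (\<lambda>x. u x \<bullet> dvm L x + L x \<bullet> Dv u x) = IK (\<lambda>x. u x \<bullet> dvm L x) + IK (\<lambda>x. L x \<bullet> Dv u x)"
    by (intro IK_add continuous_intros mconts[OF L] vpoly_continuous[OF u] mpoly_continuous[OF Dv_mpoly[OF u]])
  finally show ?thesis .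
qed

lemma parts_scalar:
  assumes p: "p \<in> polys l" and u: "vpoly k u"
  shows "IK (\<lambda>x. p x * dvg u x) + IK (\<lambda>x. u x \<bullet> gr p x) = IB (\<lambda>F x. (u x \<bullet> nu F) * p x)"
proof -
  have q: "(\<lambda>x. p x * u x $ j) \<in> polys (l + k)" for j by (intro polys_mult p vpolyD[OF u])
  have "(\<Sum>j\<in>UNIV. pd (\<lambda>x. p x * u x $ j) j x) = p x * dvg u x + u x \<bullet> gr p x" for x
    by (simp add: pd_mult[OF p vpolyD[OF u]] dvg_def gr_def inner_vec_def sum.distrib sum_distrib_left mult.commute)
  then have "IK (\<lambda>x. p x * dvg u x + u x \<bullet> gr p x) = IB (\<lambda>F x. \<Sum>j\<in>UNIV. nu F $ j * (p x * u x $ j))"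
    using divergence_polys[of "\<lambda>j x. p x * u x $ j" "l + k"] q by simp
  also have "(\<lambda>F x. \<Sum>j\<in>UNIV. nu F $ j * (p x * u x $ j)) = (\<lambda>F x. (u x \<bullet> nu F) * p x)"
    by (simp add: fun_eq_iff inner_vec_def sum_distrib_left sum_distrib_right mult_ac)
  also have "IK (\<lambda>x. p x * dvg u x + u x \<bullet> gr p x) = IK (\<lambda>x. p x * dvg u x) + IK (\<lambda>x. u x \<bullet> gr p x)"
    by (intro IK_add continuous_intros pconts[OF p] vconts[OF u])
  finally show ?thesis .
qed

text \<open>Gauss's formula for the field \<open>cross_s \<C> b J\<close>, whose j-th component is J
  paired with the j-th axis crossed with b. Skewness of the cross product gives the minus
  sign.\<close>

lemma parts_curl:
  assumes J: "vpoly k J" and b: "vpoly k b"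
  shows "IK (\<lambda>x. J x \<bullet> curl_v \<C> (Dv b x)) - IK (\<lambda>x. b x \<bullet> curl_s \<C> (Dv J x)) = IB (\<lambda>F x. J x \<bullet> cv (nu F) (b x))"
proof -
  let ?\<psi> = "\<lambda>j x. J x \<bullet> cv (axis j 1) (b x)"
  note cb = linear_vpoly[OF linear_cross_right b]
  have "(\<Sum>j\<in>UNIV. pd (?\<psi> j) j x) = J x \<bullet> curl_v \<C> (Dv b x) - b x \<bullet> curl_s \<C> (Dv J x)" for x
  proof -
    have "(\<Sum>j\<in>UNIV. pd (?\<psi> j) j x)
        = (\<Sum>j\<in>UNIV. J x \<bullet> cv (axis j 1) (column j (Dv b x))) + (\<Sum>j\<in>UNIV. \<Sum>i\<in>UNIV. Dv J x $ i $ j * cv (axis j 1) (b x) $ i)"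
    proof -
      have "Dv (\<lambda>x. cv (axis j 1) (b x)) x $ i $ j = cv (axis j 1) (column j (Dv b x)) $ i" for i j
        unfolding Dv_def[of "\<lambda>x. cv (axis j 1) (b x)"] by (simp add: cb(2))
      then show ?thesis
        unfolding vpoly_inner_polys(2)[OF J cb(1)] sum.distrib by (simp add: inner_vec_def)
    qed
    also have "(\<Sum>j\<in>UNIV. J x \<bullet> cv (axis j 1) (column j (Dv b x))) = J x \<bullet> curl_v \<C> (Dv b x)"
      by (simp add: curl_v_columns inner_sum_right)
    also have "(\<Sum>j\<in>UNIV. \<Sum>i\<in>UNIV. Dv J x $ i $ j * cv (axis j 1) (b x) $ i) = - (b x \<bullet> curl_s \<C> (Dv J x))"
      by (simp add: inner_curl_s cross_v_skew[of "axis j 1" "b x" for j] sum_negf)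
    finally show ?thesis by simp
  qed
  then have "IK (\<lambda>x. J x \<bullet> curl_v \<C> (Dv b x) - b x \<bullet> curl_s \<C> (Dv J x)) = IB (\<lambda>F x. \<Sum>j\<in>UNIV. nu F $ j * ?\<psi> j x)"
    using divergence_polys[of ?\<psi> "k + k", OF vpoly_inner_polys(1)[OF J cb(1)]] by simp
  also have "(\<lambda>F x. \<Sum>j\<in>UNIV. nu F $ j * ?\<psi> j x) = (\<lambda>F x. J x \<bullet> cv (nu F) (b x))"
  proof (intro ext)
    fix F x
    have "J x \<bullet> cv (nu F) (b x) = (\<Sum>i\<in>UNIV. J x $ i * (\<Sum>j\<in>UNIV. cv (axis j 1) (b x) $ i * nu F $ j))"
      unfolding inner_vec_def by (subst linear_component[OF linear_cross_left]) simp
    also have "\<dots> = (\<Sum>j\<in>UNIV. nu F $ j * ?\<psi> j x)"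
      by (subst inner_vec_def, simp add: sum_distrib_left, subst sum.swap) (simp add: mult_ac)
    finally show "(\<Sum>j\<in>UNIV. nu F $ j * ?\<psi> j x) = J x \<bullet> cv (nu F) (b x)" by simp
  qed
  also have "IK (\<lambda>x. J x \<bullet> curl_v \<C> (Dv b x) - b x \<bullet> curl_s \<C> (Dv J x)) = IK (\<lambda>x. J x \<bullet> curl_v \<C> (Dv b x)) - IK (\<lambda>x. b x \<bullet> curl_s \<C> (Dv J x))"
    by (intro IK_diff continuous_intros vpoly_continuous[OF J] vpoly_continuous[OF b] mpoly_continuous[OF Dv_mpoly[OF b]]
        mpoly_continuous[OF Dv_mpoly[OF J]])
  finally show ?thesis .
qed

text \<open>The left integrand is one half of w . grad |u|^2 and w is divergence-free, whence the
  factor 1/2 in front of m.\<close>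

lemma parts_convection:
  assumes u: "vpoly k u"
  shows "IK (\<lambda>x. outer (u x) (tw x) \<bullet> Dv u x) = IB (\<lambda>F x. (tw x \<bullet> nu F) / 2 * (u x \<bullet> u x))"
proof -
  have p: "(\<lambda>x. u x \<bullet> u x) \<in> polys (k + k)" by (rule vpoly_inner_polys(1)[OF u u])
  have tw_div: "weak_divergence (interior K) tw (\<lambda>_. 0)"
    using div_w weak_divergence_cong[of "interior K" tw w] tw_interior by simp
  have "IK (\<lambda>x. tw x \<bullet> gr (\<lambda>x. u x \<bullet> u x) x) = IB (\<lambda>F x. (tw x \<bullet> nu F) * (u x \<bullet> u x))"
    using divergence_theorem[OF tw Linf_zero tw_div polys_gradient[OF p]] by (simp add: IK_def IB_def gr_def)
  moreover have "tw x \<bullet> gr (\<lambda>x. u x \<bullet> u x) x = 2 * (outer (u x) (tw x) \<bullet> Dv u x)" for x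
  proof -
    have "tw x \<bullet> gr (\<lambda>x. u x \<bullet> u x) x = (\<Sum>j\<in>UNIV. \<Sum>i\<in>UNIV. 2 * (u x $ i * tw x $ j * Dv u x $ i $ j))"
      by (simp add: inner_vec_def[of "tw x"] gr_def vpoly_inner_polys(2)[OF u u] sum_distrib_left mult_ac)
    also have "\<dots> = 2 * (outer (u x) (tw x) \<bullet> Dv u x)"
      by (subst sum.swap) (simp add: inner_matrix outer_def sum_distrib_left mult_ac)
    finally show ?thesis .
  qed
  ultimately have "2 * IK (\<lambda>x. outer (u x) (tw x) \<bullet> Dv u x) = IB (\<lambda>F x. (tw x \<bullet> nu F) * (u x \<bullet> u x))"
    by (simp add: IK_cmult)
  moreover have "IB (\<lambda>F x. (tw x \<bullet> nu F) / 2 * (u x \<bullet> u x)) = 1 / 2 * IB (\<lambda>F x. (tw x \<bullet> nu F) * (u x \<bullet> u x))"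
    by (subst IB_cmult[symmetric]) simp
  ultimately show ?thesis by simp
qed

text \<open>The indefinite volume products turn into boundary terms by the parts lemmas and cancel
  those of (L2), (L3), (L5) and (L6), while the volume coupling of u and b cancels pointwise. Of
  convection m - m/2 remains.\<close>

lemma energy_identity:
  assumes "Z \<in> X"
  shows "B Z Z = IK (\<lambda>x. Rey * (c1 Z x \<bullet> c1 Z x) + Rem / \<kappa> * (c4 Z x \<bullet> c4 Z x))
    + IB (\<lambda>F x. (\<alpha>1 + (tw x \<bullet> nu F) / 2) * (c2 Z x \<bullet> c2 Z x) + (pen F *v c5 Z x) \<bullet> c5 Z x)"
proof -
  define L u p J b r where defs: "L = c1 Z" "u = c2 Z" "p = c3 Z" "J = c4 Z" "b = c5 Z" "r = c6 Z"
  have L: "mpoly k L" and u: "vpoly k u" and p: "p \<in> polys (k - 1)" and J: "vpoly k J" and b: "vpoly k b"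
    and r: "r \<in> polys (k - 1)" using XD[OF assms] by (simp_all add: defs)
  note conts = mconts[OF L] vconts[OF u] pconts[OF p] vpoly_continuous[OF J] mpoly_continuous[OF Dv_mpoly[OF J]]
    vconts[OF b] pconts[OF r] td tw
  \<comment> \<open>On the diagonal the coupling of (L2), already integrated by parts, is the
    negative of the one in (L5).\<close>
  have "\<kappa> * (cv (u x) (td x) \<bullet> curl_v \<C> (Dv b x)) = \<kappa> * (u x \<bullet> cs (td x) (curl_v \<C> (Dv b x)))" for x
    using cross_s_inner[of "td x" "curl_v \<C> (Dv b x)" "u x"] by (simp add: inner_commute)
  then have vol: "vol1 L u L x + vol2 L u p b u x + vol3 u p x + vol4 J b J x + vol5 u J r b x + vol3 b r x
    = (Rey * (L x \<bullet> L x) + Rem / \<kappa> * (J x \<bullet> J x)) + (u x \<bullet> dvm L x + L x \<bullet> Dv u x)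
      - (p x * dvg u x + u x \<bullet> gr p x) - (r x * dvg b x + b x \<bullet> gr r x)
      + (J x \<bullet> curl_v \<C> (Dv b x) - b x \<bullet> curl_s \<C> (Dv J x)) - outer (u x) (tw x) \<bullet> Dv u x" for x
    by (simp add: vol1_def vol2_def vol3_def vol4_def vol5_def)
  have c: "continuous_on K (\<lambda>x. Rey * (L x \<bullet> L x) + Rem / \<kappa> * (J x \<bullet> J x))"
    "continuous_on K (\<lambda>x. u x \<bullet> dvm L x)" "continuous_on K (\<lambda>x. L x \<bullet> Dv u x)"
    "continuous_on K (\<lambda>x. p x * dvg u x)" "continuous_on K (\<lambda>x. u x \<bullet> gr p x)"
    "continuous_on K (\<lambda>x. r x * dvg b x)" "continuous_on K (\<lambda>x. b x \<bullet> gr r x)"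
    "continuous_on K (\<lambda>x. J x \<bullet> curl_v \<C> (Dv b x))" "continuous_on K (\<lambda>x. b x \<bullet> curl_s \<C> (Dv J x))"
    "continuous_on K (\<lambda>x. outer (u x) (tw x) \<bullet> Dv u x)"
    by (intro continuous_intros conts)+
  note vc = continuous_vol(1)[OF L u L] continuous_vol(2)[OF L u p b u] continuous_vol(3)[OF u p]
    continuous_vol(4)[OF J b J] continuous_vol(5)[OF u J r b] continuous_vol(3)[OF b r]
  have "IK (vol1 L u L) + IK (vol2 L u p b u) + IK (vol3 u p) + IK (vol4 J b J) + IK (vol5 u J r b) + IK (vol3 b r)
    = IK (\<lambda>x. vol1 L u L x + vol2 L u p b u x + vol3 u p x + vol4 J b J x + vol5 u J r b x + vol3 b r x)"
    by (simp add: IK_add continuous_on_add vc)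
  also have "\<dots> = IK (\<lambda>x. Rey * (L x \<bullet> L x) + Rem / \<kappa> * (J x \<bullet> J x)) + (IK (\<lambda>x. u x \<bullet> dvm L x) + IK (\<lambda>x. L x \<bullet> Dv u x))
      - (IK (\<lambda>x. p x * dvg u x) + IK (\<lambda>x. u x \<bullet> gr p x)) - (IK (\<lambda>x. r x * dvg b x) + IK (\<lambda>x. b x \<bullet> gr r x))
      + (IK (\<lambda>x. J x \<bullet> curl_v \<C> (Dv b x)) - IK (\<lambda>x. b x \<bullet> curl_s \<C> (Dv J x))) - IK (\<lambda>x. outer (u x) (tw x) \<bullet> Dv u x)"
    unfolding vol by (simp only: IK_add IK_diff continuous_on_add continuous_on_diff c)
  also have "\<dots> = IK (\<lambda>x. Rey * (L x \<bullet> L x) + Rem / \<kappa> * (J x \<bullet> J x)) + IB (\<lambda>F x. L x \<bullet> outer (u x) (nu F))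
      - IB (\<lambda>F x. (u x \<bullet> nu F) * p x) - IB (\<lambda>F x. (b x \<bullet> nu F) * r x) + IB (\<lambda>F x. J x \<bullet> cv (nu F) (b x))
      - IB (\<lambda>F x. (tw x \<bullet> nu F) / 2 * (u x \<bullet> u x))"
    unfolding parts_matrix[OF L u] parts_scalar[OF p u] parts_scalar[OF r b] parts_curl[OF J b] parts_convection[OF u] ..
  finally have vols: "IK (vol1 L u L) + IK (vol2 L u p b u) + IK (vol3 u p) + IK (vol4 J b J) + IK (vol5 u J r b) + IK (vol3 b r)
    = IK (\<lambda>x. Rey * (L x \<bullet> L x) + Rem / \<kappa> * (J x \<bullet> J x)) + IB (\<lambda>F x. L x \<bullet> outer (u x) (nu F))
      - IB (\<lambda>F x. (u x \<bullet> nu F) * p x) - IB (\<lambda>F x. (b x \<bullet> nu F) * r x) + IB (\<lambda>F x. J x \<bullet> cv (nu F) (b x))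
      - IB (\<lambda>F x. (tw x \<bullet> nu F) / 2 * (u x \<bullet> u x))" .
  have kc: "bcont (\<lambda>F x. L x \<bullet> outer (u x) (nu F))" "bcont (\<lambda>F x. (u x \<bullet> nu F) * p x)" "bcont (\<lambda>F x. (b x \<bullet> nu F) * r x)"
    "bcont (\<lambda>F x. J x \<bullet> cv (nu F) (b x))" "bcont (\<lambda>F x. (tw x \<bullet> nu F) / 2 * (u x \<bullet> u x))"
    by (intro bcontI continuous_intros continuous_facet[OF tw] conts; simp)+
  note bc = bcont_bd(1)[OF L u b u] bcont_bd(2)[OF u p] bcont_bd(3)[OF u J b b] bcont_bd(2)[OF b r]
  have badd: "bcont (\<lambda>F x. h F x + h' F x)" "bcont (\<lambda>F x. h F x - h' F x)" if "bcont h" "bcont h'" for h h' :: "_ \<Rightarrow> _ \<Rightarrow> real"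
    using that by (auto simp: bcont_def intro: continuous_on_add continuous_on_diff)
  have "IB (bd2 L u b u) + IB (bd3 u p) + IB (bd5 u J b b) + IB (bd3 b r)
      + IB (\<lambda>F x. L x \<bullet> outer (u x) (nu F)) - IB (\<lambda>F x. (u x \<bullet> nu F) * p x) - IB (\<lambda>F x. (b x \<bullet> nu F) * r x)
      + IB (\<lambda>F x. J x \<bullet> cv (nu F) (b x)) - IB (\<lambda>F x. (tw x \<bullet> nu F) / 2 * (u x \<bullet> u x))
    = IB (\<lambda>F x. bd2 L u b u F x + bd3 u p F x + bd5 u J b b F x + bd3 b r F x
      + L x \<bullet> outer (u x) (nu F) - (u x \<bullet> nu F) * p x - (b x \<bullet> nu F) * r x
      + J x \<bullet> cv (nu F) (b x) - (tw x \<bullet> nu F) / 2 * (u x \<bullet> u x))"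
    by (simp only: IB_add IB_diff badd kc bc)
  also have "\<dots> = IB (\<lambda>F x. (\<alpha>1 + (tw x \<bullet> nu F) / 2) * (u x \<bullet> u x) + (pen F *v b x) \<bullet> b x)"
  proof (rule IB_cong)
    fix F x
    \<comment> \<open>All three magnetic boundary terms are multiples of one product, u x d against
      b x n: the weak curl contributes \<kappa>, and the fluxes of (L2), by skewness, and of (L5),
      by its sign, contribute -\<kappa>/2 each.\<close>
    have 1: "cs (nu F) (cv (u x) (td x)) \<bullet> b x = cv (u x) (td x) \<bullet> cv (b x) (nu F)" by (rule cross_s_inner)
    have "cs (td x) (cv (nu F) (b x)) \<bullet> u x = cv (nu F) (b x) \<bullet> cv (u x) (td x)" by (rule cross_s_inner)
    then have 2: "cs (td x) (cv (nu F) (b x)) \<bullet> u x = - (cv (u x) (td x) \<bullet> cv (b x) (nu F))"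
      by (simp add: cross_v_skew[of "nu F" "b x"] inner_commute)
    have 3: "cs (nu F) (J x) \<bullet> b x = - (J x \<bullet> cv (nu F) (b x))"
      by (simp add: cross_s_inner cross_v_skew[of "b x" "nu F"])
    show "bd2 L u b u F x + bd3 u p F x + bd5 u J b b F x + bd3 b r F x
      + L x \<bullet> outer (u x) (nu F) - (u x \<bullet> nu F) * p x - (b x \<bullet> nu F) * r x
      + J x \<bullet> cv (nu F) (b x) - (tw x \<bullet> nu F) / 2 * (u x \<bullet> u x)
      = (\<alpha>1 + (tw x \<bullet> nu F) / 2) * (u x \<bullet> u x) + (pen F *v b x) \<bullet> b x"
      unfolding bd2_def bd3_def bd5_def 1 2 3 by (simp add: algebra_simps)
  qed
  finally show ?thesis
    unfolding B_def defs[symmetric] using vols by linarith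
qed

section \<open>Uniqueness\<close>

text \<open>The bound on w passes to the trace, so |m| stays strictly below 2 \<alpha>1 on the whole
  facet.\<close>

lemma convective_coefficient_pos:
  assumes F: "F facet_of K" and x: "x \<in> F"
  shows "0 < \<alpha>1 + (tw x \<bullet> nu F) / 2"
proof -
  obtain c where c: "\<And>x. x \<in> interior K \<Longrightarrow> norm (w x) \<le> c" "c < 2 * \<alpha>1" using \<alpha>1 by blast
  have "norm (tw x) \<le> c" by (rule trace_bound[OF w c(1) facet_in[OF F x]])
  moreover have "\<bar>tw x \<bullet> nu F\<bar> \<le> norm (tw x) * norm (nu F)" by (rule Cauchy_Schwarz_ineq2)
  ultimately have "\<bar>tw x \<bullet> nu F\<bar> \<le> c" using norm_normal[OF F] by simp
  then show ?thesis using c(2) by linarith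
qed

lemma pen_nonneg: "F facet_of K \<Longrightarrow> 0 \<le> (pen F *v a) \<bullet> a"
  and pen_eq_0: "F facet_of K \<Longrightarrow> (pen F *v a) \<bullet> a = 0 \<Longrightarrow> a = 0"
  using \<beta>[of F] unfolding positive_definite_def by (metis inner_commute inner_zero_right less_eq_real_def order_less_irrefl)+

text \<open>Apply the divergence theorem to \<open>|u|\<^sup>2 x\<close>, whose divergence is \<open>d |u|\<^sup>2\<close> for locally constant \<open>u\<close>.\<close>

lemma vanish_if_gradient_zero:
  assumes u: "vpoly k u" and D: "\<And>x. x \<in> K \<Longrightarrow> Dv u x = 0"
    and bd: "\<And>F. F facet_of K \<Longrightarrow> AE x in facet_measure (nu F) F. u x = (0 :: (real, 'n) vec)"
    and x: "x \<in> K"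
  shows "u x = 0"
proof -
  have q: "(\<lambda>x. u x \<bullet> u x) \<in> polys (k + k)" by (rule vpoly_inner_polys(1)[OF u u])
  have p: "(\<lambda>x. x $ j * (u x \<bullet> u x)) \<in> polys (1 + (k + k))" for j
    by (intro polys_mult polys_nth q)
  have pn: "pd (\<lambda>x. x $ j) j x = 1" for j :: 'n and x
  proof -
    have "(\<lambda>h :: (real, 'n) vec. \<Sum>i\<in>UNIV. h $ i * (if i = j then 1 else 0)) = (\<lambda>h. h $ j)"
      by (simp add: fun_eq_iff if_distrib[of "\<lambda>c. _ * c"] cong: if_cong)
    then have "((\<lambda>x. x $ j) has_derivative (\<lambda>h. \<Sum>i\<in>UNIV. h $ i * (if i = j then 1 else 0))) (at x)"
      using bounded_linear.has_derivative[OF bounded_linear_vec_nth has_derivative_ident] by simp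
    from pd_eqI[OF this, of j] show ?thesis by simp
  qed
  have "IK (\<lambda>x. real CARD('n) * (u x \<bullet> u x)) = IK (\<lambda>x. \<Sum>j\<in>UNIV. pd (\<lambda>x. x $ j * (u x \<bullet> u x)) j x)"
  proof (rule IK_cong)
    fix x assume "x \<in> interior K"
    then have "pd (\<lambda>x. u x \<bullet> u x) j x = 0" for j
      using D[OF interior_in] by (simp add: vpoly_inner_polys(2)[OF u u])
    then show "real CARD('n) * (u x \<bullet> u x) = (\<Sum>j\<in>UNIV. pd (\<lambda>x. x $ j * (u x \<bullet> u x)) j x)"
      by (simp add: pd_mult[OF polys_nth q] pn)
  qed
  also have "\<dots> = IB (\<lambda>F x. \<Sum>j\<in>UNIV. nu F $ j * (x $ j * (u x \<bullet> u x)))"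
    by (rule divergence_polys[OF p])
  also have "\<dots> = IB (\<lambda>F x. 0)"
  proof (rule IB_cong_AE)
    show "bcont (\<lambda>F x. \<Sum>j\<in>UNIV. nu F $ j * (x $ j * (u x \<bullet> u x)))"
      by (intro bcontI continuous_intros vpoly_continuous[OF u])
    show "bcont (\<lambda>F x. 0 :: real)" by (intro bcontI continuous_intros)
    show "AE x in facet_measure (nu F) F. (\<Sum>j\<in>UNIV. nu F $ j * (x $ j * (u x \<bullet> u x))) = 0" if "F facet_of K" for F
      using bd[OF that] by eventually_elim simp
  qed
  finally have "IK (\<lambda>x. real CARD('n) * (u x \<bullet> u x)) = 0" by simp
  then have "real CARD('n) * (u x \<bullet> u x) = 0"
    by (intro IK_eq_0_imp[where f = "\<lambda>x. real CARD('n) * (u x \<bullet> u x)", OF _ _ _ x] continuous_intros vpoly_continuous[OF u])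
      simp_all
  then show ?thesis by simp
qed

lemma IB_zero_AE:
  assumes "bcont h" "\<And>F. F facet_of K \<Longrightarrow> AE x in facet_measure (nu F) F. h F x = 0"
  shows "IB h = 0"
  using IB_cong_AE[OF assms(1), of "\<lambda>F x. 0"] assms(2) by (simp add: bcont_def)

text \<open>Every conclusion comes from one test function made from the solution: the solution
  itself for the energy, grad u in (L1), curl b in (L4), div b in (L6), and fields with divergence p
  and r in (L2) and (L5), the other slots being zero.\<close>

lemma kernel_trivial:
  assumes Z: "Z \<in> X" and B0: "\<And>Y. Y \<in> X \<Longrightarrow> B Z Y = 0" and x: "x \<in> K"
  shows "Z x = 0"
proof -
  define L u p J b r where defs: "L = c1 Z" "u = c2 Z" "p = c3 Z" "J = c4 Z" "b = c5 Z" "r = c6 Z"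
  have L: "mpoly k L" and u: "vpoly k u" and p: "p \<in> polys (k - 1)" and J: "vpoly k J" and b: "vpoly k b"
    and r: "r \<in> polys (k - 1)" using XD[OF Z] by (simp_all add: defs)
  note conts = mconts[OF L] vconts[OF u] pconts[OF p] vpoly_continuous[OF J] mpoly_continuous[OF Dv_mpoly[OF J]]
    vconts[OF b] pconts[OF r] td tw
  have Bt: "IK (vol1 L u G) + (IK (vol2 L u p b v) + IB (bd2 L u b v)) + (IK (vol3 u q) + IB (bd3 u q))
      + IK (vol4 J b H) + (IK (vol5 u J r c) + IB (bd5 u J b c)) + (IK (vol3 b s) + IB (bd3 b s)) = 0"
    if "mpoly k G" "vpoly k v" "q \<in> polys (k - 1)" "vpoly k H" "vpoly k c" "s \<in> polys (k - 1)" for G v q H c s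
    using B0[OF XI[OF that]] unfolding B_def c_tup defs .
  note z = mpoly_zero vpoly_zero polys_zero
  let ?e = "\<lambda>x. Rey * (L x \<bullet> L x) + Rem / \<kappa> * (J x \<bullet> J x)"
  let ?h = "\<lambda>F x. (\<alpha>1 + (tw x \<bullet> nu F) / 2) * (u x \<bullet> u x) + (pen F *v b x) \<bullet> b x"
  have energy: "IK ?e + IB ?h = 0"
    using energy_identity[OF Z] B0[OF Z] by (simp add: defs)
  have e_nn: "0 \<le> ?e y" for y using pos by simp
  have h_nn: "0 \<le> ?h F y" if "F facet_of K" "y \<in> F" for F y
    using convective_coefficient_pos[OF that] pen_nonneg[OF that(1), of "b y"] by simp
  have ec: "continuous_on K ?e" by (intro continuous_intros conts)
  have hc: "bcont ?h"
    by (intro bcontI continuous_intros continuous_pen continuous_facet[OF tw] conts) simp_all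
  have "IK ?e = 0" "IB ?h = 0"
    using energy IK_nonneg[of ?e] IB_nonneg[of ?h] e_nn h_nn by (smt (verit))+
  have LJ: "L y = 0 \<and> J y = 0" if "y \<in> K" for y
  proof -
    have "?e y = 0" by (rule IK_eq_0_imp[OF ec e_nn \<open>IK ?e = 0\<close> that])
    moreover have "0 \<le> Rey * (L y \<bullet> L y)" "0 \<le> Rem / \<kappa> * (J y \<bullet> J y)" using pos by simp_all
    ultimately have "Rey * (L y \<bullet> L y) = 0" "Rem / \<kappa> * (J y \<bullet> J y) = 0" by linarith+
    then show ?thesis using pos by simp
  qed
  have ub: "AE y in facet_measure (nu F) F. u y = 0 \<and> b y = 0" if F: "F facet_of K" for F
  proof -
    have "AE y in facet_measure (nu F) F. ?h F y = 0"
      by (rule IB_eq_0_imp[OF hc _ \<open>IB ?h = 0\<close> F]) (rule h_nn)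
    then show ?thesis using AE_space
  proof eventually_elim
    case (elim y)
    then have y: "y \<in> F" using space_facet_measure[OF F] by simp
    have a: "0 < \<alpha>1 + (tw y \<bullet> nu F) / 2" by (rule convective_coefficient_pos[OF F y])
    have "0 \<le> (\<alpha>1 + (tw y \<bullet> nu F) / 2) * (u y \<bullet> u y)" using a by simp
    then have "(\<alpha>1 + (tw y \<bullet> nu F) / 2) * (u y \<bullet> u y) = 0" "(pen F *v b y) \<bullet> b y = 0"
      using elim(1) pen_nonneg[OF F, of "b y"] by linarith+
    then show ?case using a pen_eq_0[OF F] by auto
  qed
  qed
  have uAE: "AE y in facet_measure (nu F) F. u y = 0" and bAE: "AE y in facet_measure (nu F) F. b y = 0"
    if "F facet_of K" for F
    using ub[OF that] by (auto elim: eventually_mono)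
  have u0: "u y = 0" if "y \<in> K" for y
  proof (rule vanish_if_gradient_zero[OF u _ uAE that])
    \<comment> \<open>The gradient has degree at most k - 1, so it is admissible. With L = 0, (L1)
      reads (u, div grad u) = 0, and since u vanishes on the boundary the left side is minus the
      squared norm of grad u.\<close>
    have G: "mpoly k (Dv u)" using mpoly_mono[OF Dv_mpoly[OF u]] by simp
    have "IK (vol1 L u (Dv u)) = 0" using Bt[OF G z(2,3,2,2,3)] by simp
    moreover have "IK (vol1 L u (Dv u)) = IK (\<lambda>x. u x \<bullet> dvm (Dv u) x)"
      by (rule IK_cong) (simp add: vol1_def LJ interior_in)
    moreover have "IB (\<lambda>F x. Dv u x \<bullet> outer (u x) (nu F)) = 0"
    proof (rule IB_zero_AE)
      show "bcont (\<lambda>F x. Dv u x \<bullet> outer (u x) (nu F))" by (intro bcontI continuous_intros conts)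
      show "AE x in facet_measure (nu F) F. Dv u x \<bullet> outer (u x) (nu F) = 0" if "F facet_of K" for F
        using uAE[OF that] by eventually_elim (simp add: inner_outer)
    qed
    ultimately have "IK (\<lambda>x. Dv u x \<bullet> Dv u x) = 0" using parts_matrix[OF G u] by simp
    then have "Dv u x \<bullet> Dv u x = 0" if "x \<in> K" for x
      by (intro IK_eq_0_imp[where f = "\<lambda>x. Dv u x \<bullet> Dv u x", OF _ _ _ that] continuous_intros conts) simp_all
    then show "Dv u x = 0" if "x \<in> K" for x using that by simp
  qed
  have curlb: "curl_v \<C> (Dv b y) = 0" if "y \<in> K" for y
  proof -
    \<comment> \<open>With J = 0, (L4) says (b, curl curl b) = 0; the boundary term vanishes with b,
      leaving the squared norm of curl b.\<close>
    let ?H = "\<lambda>x. curl_v \<C> (Dv b x)"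
    have H: "vpoly k ?H"
      unfolding vpoly_def
    proof
      fix i
      have "(\<lambda>x. cv (axis j 1) (column j (Dv b x)) $ i) \<in> polys k" for j
      proof -
        have "vpoly k (\<lambda>x. column j (Dv b x))"
          using mpolyD[OF mpoly_mono[OF Dv_mpoly[OF b]]] by (simp add: vpoly_def column_def)
        from linear_vpoly(1)[OF linear_cross_right this] show ?thesis by (rule vpolyD)
      qed
      then show "(\<lambda>x. ?H x $ i) \<in> polys k" unfolding curl_v_columns sum_component by (intro polys_sum)
    qed
    have "IK (vol4 J b ?H) = 0" using Bt[OF z(1,2,3) H z(2,3)] by simp
    moreover have "IK (vol4 J b ?H) = - IK (\<lambda>x. b x \<bullet> curl_s \<C> (Dv ?H x))"
      unfolding IK_minus[symmetric] by (rule IK_cong) (simp add: vol4_def LJ interior_in)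
    moreover have "IB (\<lambda>F x. ?H x \<bullet> cv (nu F) (b x)) = 0"
    proof (rule IB_zero_AE)
      show "bcont (\<lambda>F x. ?H x \<bullet> cv (nu F) (b x))" by (intro bcontI continuous_intros conts)
      show "AE x in facet_measure (nu F) F. ?H x \<bullet> cv (nu F) (b x) = 0" if "F facet_of K" for F
        using bAE[OF that] by eventually_elim simp
    qed
    ultimately have "IK (\<lambda>x. ?H x \<bullet> ?H x) = 0" using parts_curl[OF H b] by simp
    then have "?H y \<bullet> ?H y = 0"
      by (intro IK_eq_0_imp[where f = "\<lambda>x. curl_v \<C> (Dv b x) \<bullet> curl_v \<C> (Dv b x)", OF _ _ _ that] continuous_intros conts) simp_all
    then show ?thesis by simp
  qed
  have b0: "b y = 0" if "y \<in> K" for y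
  proof (rule vanish_if_gradient_zero[OF b _ bAE that])
    have s: "dvg b \<in> polys (k - 1)" by (rule dvg_polys[OF b])
    have "IB (bd3 b (dvg b)) = 0"
    proof (rule IB_zero_AE)
      show "bcont (bd3 b (dvg b))" by (rule bcont_bd(2)[OF b s])
      show "AE x in facet_measure (nu F) F. bd3 b (dvg b) F x = 0" if "F facet_of K" for F
        using bAE[OF that] by eventually_elim (simp add: bd3_def)
    qed
    then have "IK (vol3 b (dvg b)) = 0" using Bt[OF z(1,2,3,2,2) s] by simp
    then have grad_div: "IK (\<lambda>x. b x \<bullet> gr (dvg b) x) = 0" by (simp add: vol3_def[abs_def] IK_minus)
    let ?\<psi> = "\<lambda>j x. \<Sum>i\<in>UNIV. b x $ i * pd (\<lambda>x. b x $ j) i x"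
    have \<psi>p: "(\<lambda>x. b x $ i * pd (\<lambda>x. b x $ j) i x) \<in> polys (k + (k - 1))" for i j
      by (intro polys_mult vpolyD[OF b] pd_polys)
    \<comment> \<open>\<open>\<nabla>b : (\<nabla>b)\<^sup>T\<close> equals \<open>\<nabla>\<cdot>((\<nabla>b) b) - b \<cdot> \<nabla>(\<nabla>\<cdot>b)\<close>, and (L6) with \<open>s = \<nabla>\<cdot>b\<close> removes the last term.\<close>
    have "(\<Sum>j\<in>UNIV. pd (?\<psi> j) j x) = Dv b x \<bullet> transpose (Dv b x) + b x \<bullet> gr (dvg b) x" for x
    proof -
      have comm: "pd (pd (\<lambda>x. b x $ j) i) j x = pd (pd (\<lambda>x. b x $ j) j) i x" for i j
        by (simp add: pd_commute[OF vpolyD[OF b], of j i j])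
      have gd: "(\<Sum>j\<in>UNIV. pd (pd (\<lambda>x. b x $ j) j) i x) = gr (dvg b) x $ i" for i
        unfolding gr_def dvg_def[abs_def] by (simp add: pd_sum[OF pd_polys[OF vpolyD[OF b]]])
      have "(\<Sum>j\<in>UNIV. pd (?\<psi> j) j x)
          = (\<Sum>j\<in>UNIV. \<Sum>i\<in>UNIV. b x $ i * pd (pd (\<lambda>x. b x $ j) j) i x + Dv b x $ i $ j * Dv b x $ j $ i)"
        by (simp add: pd_sum[OF \<psi>p] pd_mult[OF vpolyD[OF b] pd_polys[OF vpolyD[OF b]]] comm Dv_def)
      also have "\<dots> = (\<Sum>i\<in>UNIV. \<Sum>j\<in>UNIV. b x $ i * pd (pd (\<lambda>x. b x $ j) j) i x + Dv b x $ i $ j * Dv b x $ j $ i)"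
        by (rule sum.swap)
      also have "\<dots> = (\<Sum>i\<in>UNIV. b x $ i * (\<Sum>j\<in>UNIV. pd (pd (\<lambda>x. b x $ j) j) i x)) + Dv b x \<bullet> transpose (Dv b x)"
        by (simp add: sum.distrib sum_distrib_left inner_matrix transpose_def)
      finally show ?thesis unfolding gd by (simp add: inner_vec_def[of "b x"])
    qed
    then have "IK (\<lambda>x. Dv b x \<bullet> transpose (Dv b x) + b x \<bullet> gr (dvg b) x) = IB (\<lambda>F x. \<Sum>j\<in>UNIV. nu F $ j * ?\<psi> j x)"
      using divergence_polys[of ?\<psi> "k + (k - 1)", OF polys_sum[OF \<psi>p]] by simp
    also have "\<dots> = 0"
    proof (rule IB_zero_AE)
      show "bcont (\<lambda>F x. \<Sum>j\<in>UNIV. nu F $ j * ?\<psi> j x)"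
        by (intro bcontI continuous_intros polys_continuous[OF polys_sum[OF \<psi>p]])
      show "AE x in facet_measure (nu F) F. (\<Sum>j\<in>UNIV. nu F $ j * ?\<psi> j x) = 0" if "F facet_of K" for F
        using bAE[OF that] by eventually_elim simp
    qed
    finally have 0: "IK (\<lambda>x. Dv b x \<bullet> transpose (Dv b x) + b x \<bullet> gr (dvg b) x) = 0" .
    have tc: "continuous_on K (\<lambda>x. Dv b x \<bullet> transpose (Dv b x))"
      unfolding inner_matrix transpose_def vec_lambda_beta
      by (intro continuous_intros conts)
    have gc: "continuous_on K (\<lambda>x. b x \<bullet> gr (dvg b) x)"
      by (intro continuous_intros conts pconts[OF s])
    \<comment> \<open>For a curl-free field \<open>curl_v_square\<close> equates |grad b|^2 with
      grad b : (grad b)^T, whose integral has just been reduced to vanishing terms.\<close>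
    have "IK (\<lambda>x. Dv b x \<bullet> Dv b x) = IK (\<lambda>x. Dv b x \<bullet> transpose (Dv b x))"
    proof (rule IK_cong)
      fix x assume "x \<in> interior K"
      then show "Dv b x \<bullet> Dv b x = Dv b x \<bullet> transpose (Dv b x)"
        using curl_v_square[of "Dv b x"] curlb[OF interior_in] by simp
    qed
    also have "\<dots> = 0" using 0 IK_add[OF tc gc] grad_div by simp
    finally have "IK (\<lambda>x. Dv b x \<bullet> Dv b x) = 0" .
    then have "Dv b x \<bullet> Dv b x = 0" if "x \<in> K" for x
      by (intro IK_eq_0_imp[where f = "\<lambda>x. Dv b x \<bullet> Dv b x", OF _ _ _ that] continuous_intros conts) simp_all
    then show "Dv b x = 0" if "x \<in> K" for x using that by simp
  qed
  \<comment> \<open>(L2) contains the curl of b, so the Jacobian has to be known to vanish along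
    with b.\<close>
  have Db0: "Dv b y = 0" if "y \<in> interior K" for y
    using jets_cong(1)[OF b vpoly_zero b0 that] by simp
  have antideriv: "\<exists>v. vpoly k v \<and> dvg v = q" if q: "q \<in> polys (k - 1)" for q :: "(real, 'n) vec \<Rightarrow> real"
  proof -
    fix j0 :: 'n
    \<comment> \<open>An antiderivative along one coordinate, placed in that component of the field.
      As k \<ge> 1, \<open>Suc (k - 1)\<close> equals k and the field is admissible.\<close>
    obtain a where a: "a \<in> polys (Suc (k - 1))" "pd a j0 = q" using polys_antiderivative[OF q] by blast
    let ?v = "\<lambda>x. a x *\<^sub>R axis j0 1 :: (real, 'n) vec"
    have comp: "(\<lambda>x. ?v x $ j) = (if j = j0 then a else (\<lambda>x. 0))" for j by (auto simp: axis_def)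
    have "vpoly k ?v" unfolding vpoly_def comp using a(1) k by (auto simp: polys_zero)
    moreover have "dvg ?v = q"
    proof
      fix x
      have "dvg ?v x = (\<Sum>j\<in>UNIV. if j = j0 then q x else 0)"
        unfolding dvg_def comp by (intro sum.cong) (auto simp: a(2))
      then show "dvg ?v x = q x" by simp
    qed
    ultimately show ?thesis by blast
  qed
  have p0: "p y = 0" if "y \<in> K" for y
  proof -
    obtain v where v: "vpoly k v" "dvg v = p" using antideriv[OF p] by blast
    \<comment> \<open>With L, u and b zero only the pressure term of (L2) survives; the argument for
      r in (L5) is the same.\<close>
    have "IB (bd2 L u b v) = IB (\<lambda>F x. 0)"
      by (rule IB_cong) (simp add: bd2_def LJ u0 b0 facet_in)
    moreover have "IK (vol2 L u p b v) = - IK (\<lambda>x. p x * p x)"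
      unfolding IK_minus[symmetric]
      by (rule IK_cong) (simp add: vol2_def LJ u0 Db0 v(2) interior_in inner_matrix outer_def)
    moreover have "IK (vol2 L u p b v) + IB (bd2 L u b v) = 0" using Bt[OF z(1) v(1) z(3,2,2,3)] by simp
    ultimately have "IK (\<lambda>x. p x * p x) = 0" by simp
    then have "p y * p y = 0" by (intro IK_eq_0_imp[where f = "\<lambda>x. p x * p x", OF _ _ _ that] continuous_intros conts) simp_all
    then show ?thesis by simp
  qed
  have r0: "r y = 0" if "y \<in> K" for y
  proof -
    obtain c where c: "vpoly k c" "dvg c = r" using antideriv[OF r] by blast
    have "IB (bd5 u J b c) = IB (\<lambda>F x. 0)"
      by (rule IB_cong) (simp add: bd5_def LJ u0 b0 facet_in)
    moreover have "IK (vol5 u J r c) = - IK (\<lambda>x. r x * r x)"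
      unfolding IK_minus[symmetric] by (rule IK_cong) (simp add: vol5_def LJ u0 c(2) interior_in)
    moreover have "IK (vol5 u J r c) + IB (bd5 u J b c) = 0" using Bt[OF z(1,2,3,2) c(1) z(3)] by simp
    ultimately have "IK (\<lambda>x. r x * r x) = 0" by simp
    then have "r y * r y = 0" by (intro IK_eq_0_imp[where f = "\<lambda>x. r x * r x", OF _ _ _ that] continuous_intros conts) simp_all
    then show ?thesis by simp
  qed
  show ?thesis
    using LJ[OF x] u0[OF x] p0[OF x] b0[OF x] r0[OF x]
    by (simp add: defs c_defs prod_eq_iff)
qed

theorem local_solver_well_posed:
  "\<exists>!z. z \<in> local_solutions \<C> k Rey Rem \<kappa> d w \<alpha>1 \<beta>1 \<beta>2 K uh ph bh rh f g"
proof (rule ex_ex1I)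
  have "\<exists>(I :: ((((real, 'n) vec, 'n) vec \<times> (real, 'n) vec \<times> real \<times> (real, 'm) vec \<times> (real, 'n) vec \<times> real) \<times> ('n \<Rightarrow> nat)) set) \<phi>.
    finite I \<and> X = range (\<lambda>c x. \<Sum>i\<in>I. c i *\<^sub>R \<phi> i x)"
    unfolding X_def by (rule solution_space_span)
  then obtain I :: "((((real, 'n) vec, 'n) vec \<times> (real, 'n) vec \<times> real \<times> (real, 'm) vec \<times> (real, 'n) vec \<times> real) \<times> ('n \<Rightarrow> nat)) set" and \<phi>
    where I: "finite I" "X = range (\<lambda>c x. \<Sum>i\<in>I. c i *\<^sub>R \<phi> i x)"
    by (elim exE conjE) (rule that)
  have "\<exists>Z\<in>X. \<forall>Y\<in>X. B Z Y = rhs Y"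
  \<comment> \<open>The relevant set is K, because a kernel element is known to vanish only
    there.\<close>
  proof (rule galerkin_solvable[OF I, where S = K])
    show "B Z Y = B Z Y'" if "Z \<in> X" "Y \<in> X" "Y' \<in> X" "\<And>x. x \<in> K \<Longrightarrow> Y x = Y' x" for Z Y Y'
      using B_rhs_cong(1)[OF that(2-4)] .
    show "rhs Y = rhs Y'" if "Y \<in> X" "Y' \<in> X" "\<And>x. x \<in> K \<Longrightarrow> Y x = Y' x" for Y Y'
      using B_rhs_cong(2)[OF that] .
  qed (rule B_trial_lin B_test_lin rhs_lin kernel_trivial; assumption)+
  then show "\<exists>z. z \<in> local_solutions \<C> k Rey Rem \<kappa> d w \<alpha>1 \<beta>1 \<beta>2 K uh ph bh rh f g"
    unfolding local_solutions_iff by blast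
next
  fix z z' assume "z \<in> local_solutions \<C> k Rey Rem \<kappa> d w \<alpha>1 \<beta>1 \<beta>2 K uh ph bh rh f g"
    and "z' \<in> local_solutions \<C> k Rey Rem \<kappa> d w \<alpha>1 \<beta>1 \<beta>2 K uh ph bh rh f g"
  then obtain Z Z' where Z: "Z \<in> X" "z = rtup Z" "\<And>Y. Y \<in> X \<Longrightarrow> B Z Y = rhs Y"
    and Z': "Z' \<in> X" "z' = rtup Z'" "\<And>Y. Y \<in> X \<Longrightarrow> B Z' Y = rhs Y"
    unfolding local_solutions_iff by blast
  let ?W = "\<lambda>x. Z x + (- 1) *\<^sub>R Z' x"
  have "mpoly k (c1 ?W)"
    unfolding c_lin by (rule mpoly_lin[OF XD(1)[OF Z(1)] XD(1)[OF Z'(1)]])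
  moreover have "vpoly k (c2 ?W)"
    unfolding c_lin by (rule vpoly_lin[OF XD(2)[OF Z(1)] XD(2)[OF Z'(1)]])
  moreover have "c3 ?W \<in> polys (k - 1)"
    unfolding c_lin real_scaleR_def by (rule polys_lin[OF XD(3)[OF Z(1)] XD(3)[OF Z'(1)]])
  moreover have "vpoly k (c4 ?W)"
    unfolding c_lin by (rule vpoly_lin[OF XD(4)[OF Z(1)] XD(4)[OF Z'(1)]])
  moreover have "vpoly k (c5 ?W)"
    unfolding c_lin by (rule vpoly_lin[OF XD(5)[OF Z(1)] XD(5)[OF Z'(1)]])
  moreover have "c6 ?W \<in> polys (k - 1)"
    unfolding c_lin real_scaleR_def by (rule polys_lin[OF XD(6)[OF Z(1)] XD(6)[OF Z'(1)]])
  ultimately have W: "?W \<in> X" by (simp add: X_def solution_space_def)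
  have "B ?W Y = 0" if "Y \<in> X" for Y
    using B_trial_lin[OF Z(1) Z'(1) that, of "- 1"] Z(3)[OF that] Z'(3)[OF that] by simp
  then have "?W x = 0" if "x \<in> K" for x using kernel_trivial[OF W _ that] by blast
  then have "Z x = Z' x" if "x \<in> K" for x using that by simp
  \<comment> \<open>Solutions are restrictions to K, so agreement on K is equality.\<close>
  then show "z = z'"
    by (auto simp: Z(2) Z'(2) rtup_def c_defs intro!: restrict_ext)
qed

end

section \<open>The calculi of two and three dimensions\<close>

lemmas calculus_simps = bilinear_conv_bounded_bilinear[symmetric] bilinear_def linear_iff vec_eq_iff
  forall_1 forall_2 forall_3 sum_2 sum_3 UNIV_1 inner_vec_def outer_def transpose_def algebra_simps

lemma mhd_calculus2: "mhd_calculus calculus2"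
  by (rule mhd_calculus.intro) (simp_all add: calculus2_def calculus_simps)

lemma mhd_calculus3: "mhd_calculus calculus3"
  by (rule mhd_calculus.intro) (simp_all add: calculus3_def cross3_def curl3_def calculus_simps)

section \<open>Well-posedness on the elements of a mesh\<close>

text \<open>The mesh covers the closure of the domain, while d, w and the sources are given on the
  domain itself. That element interiors lie inside it rests on the one-sided graph condition, which
  excludes slits.\<close>

lemma lipschitz_domain_interior_closure:
  assumes "lipschitz_domain \<Omega>" shows "interior (closure \<Omega>) \<subseteq> \<Omega>"
proof
  fix x assume x: "x \<in> interior (closure \<Omega>)"
  show "x \<in> \<Omega>"
  proof (rule ccontr)
    assume nx: "x \<notin> \<Omega>"
    have "open \<Omega>" using assms by (simp add: lipschitz_domain_def)
    then have "x \<in> frontier \<Omega>"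
      using x nx interior_subset by (auto simp: frontier_def interior_open)
    then have "\<exists>U e C \<phi>. open U \<and> x \<in> U \<and> norm e = 1 \<and> C-lipschitz_on UNIV (\<phi> :: real^'a \<Rightarrow> real) \<and>
        \<Omega> \<inter> U = {y\<in>U. \<phi> (y - (y \<bullet> e) *\<^sub>R e) < y \<bullet> e}"
      using assms by (simp add: lipschitz_domain_def)
    then obtain U e C \<phi> where U: "open U" "x \<in> U" "norm e = 1" "C-lipschitz_on UNIV (\<phi> :: real^'a \<Rightarrow> real)"
      "\<Omega> \<inter> U = {y\<in>U. \<phi> (y - (y \<bullet> e) *\<^sub>R e) < y \<bullet> e}"
      by (elim exE conjE) (rule that)
    have \<phi>: "continuous_on UNIV \<phi>" using U(4) by (rule lipschitz_on_continuous_on)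
    have ee: "e \<bullet> e = 1" using U(3) by (simp add: dot_square_norm)
    have above: "\<not> \<phi> (x - (x \<bullet> e) *\<^sub>R e) < x \<bullet> e" using nx U(2,5) by blast
    let ?V = "U \<inter> interior (closure \<Omega>)"
    have "open ?V" "x \<in> ?V" using U x by auto
    then obtain r where r: "0 < r" "cball x r \<subseteq> ?V" using open_contains_cball by blast
    \<comment> \<open>Close to \<open>x\<close> the domain lies above the graph of \<open>\<phi>\<close>, so moving down leaves its closure.\<close>
    define y where "y = x - r *\<^sub>R e"
    have y: "y \<in> ?V" using r U(3) by (auto simp: y_def dist_norm subset_iff)
    have "y - (y \<bullet> e) *\<^sub>R e = x - (x \<bullet> e) *\<^sub>R e" "y \<bullet> e = x \<bullet> e - r"
      by (simp_all add: y_def inner_diff_left ee algebra_simps)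
    with above r have "y \<bullet> e < \<phi> (y - (y \<bullet> e) *\<^sub>R e)" by simp
    moreover define W where "W = U \<inter> {y. y \<bullet> e < \<phi> (y - (y \<bullet> e) *\<^sub>R e)}"
    ultimately have yW: "y \<in> W" using y by simp
    have "open {y. y \<bullet> e < \<phi> (y - (y \<bullet> e) *\<^sub>R e)}"
      by (intro open_Collect_less continuous_intros continuous_on_compose2[OF \<phi>]) auto
    then have "open W" using U(1) by (simp add: W_def open_Int)
    moreover have "z \<notin> W" if "z \<in> \<Omega>" for z
    proof
      assume z: "z \<in> W"
      with that have "z \<in> {y\<in>U. \<phi> (y - (y \<bullet> e) *\<^sub>R e) < y \<bullet> e}"
        unfolding U(5)[symmetric] by (simp add: W_def)
      with z show False by (simp add: W_def)
    qed
    then have "W \<inter> \<Omega> = {}" by blast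
    ultimately have "W \<inter> closure \<Omega> = {}" by (simp add: open_Int_closure_eq_empty)
    then show False using yW y interior_subset by blast
  qed
qed

lemma full_simplex:
  fixes K :: "(real^'n) set"
  assumes "int CARD('n) simplex K" shows "full_polytope K"
proof
  show K: "polytope K" using assms by (rule simplex_imp_polytope)
  have dim: "aff_dim K = int DIM(real^'n)" using aff_dim_simplex[OF assms] by simp
  then have "K \<noteq> {}" using aff_dim_empty[of K] by auto
  then show "interior K \<noteq> {}"
    using dim K by (simp add: interior_rel_interior_gen rel_interior_eq_empty polytope_imp_convex)
qed

text \<open>On a set of finite measure square integrability implies integrability, by t \<le> 1 +
  t^2.\<close>

lemma (in full_polytope) L2_integrable:
  assumes "f \<in> L2 \<Omega>" "interior K \<subseteq> \<Omega>" "open \<Omega>" shows "integrable (lebesgue_on K) f"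
  unfolding lebesgue_on_interior(2)
proof (rule Bochner_Integration.integrable_bound)
  have sub: "interior K \<in> sets lebesgue" "\<Omega> \<in> sets lebesgue" using assms(3) by auto
  have f: "f \<in> borel_measurable (lebesgue_on \<Omega>)" "integrable (lebesgue_on \<Omega>) (\<lambda>x. (norm (f x))\<^sup>2)"
    using assms(1) by (auto simp: L2_def)
  show "f \<in> borel_measurable (lebesgue_on (interior K))"
    by (rule measurable_restrict_mono[OF f(1) assms(2)])
  have "integrable (lebesgue_on (interior K)) (\<lambda>x. (norm (f x))\<^sup>2)"
    using set_integrable_subset[of lebesgue \<Omega> "\<lambda>x. (norm (f x))\<^sup>2" "interior K"] f(2) assms(2) sub
    by (simp add: set_integrable_def integrable_restrict_space)
  moreover have "integrable (lebesgue_on (interior K)) (\<lambda>x. 1 :: real)"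
    using lebesgue_on_interior(2)[of "\<lambda>x. 1 :: real"] compact by (simp add: integrable_continuous)
  ultimately show "integrable (lebesgue_on (interior K)) (\<lambda>x. 1 + (norm (f x))\<^sup>2)" by simp
  have "norm (f x) \<le> 1 + (norm (f x))\<^sup>2" for x
  proof -
    have "0 \<le> (norm (f x) - 1)\<^sup>2 + norm (f x)" by simp
    then show ?thesis by (simp add: power2_diff)
  qed
  then show "AE x in lebesgue_on (interior K). norm (f x) \<le> norm (1 + (norm (f x))\<^sup>2)" by (auto intro!: AE_I2)
qed

lemma (in full_polytope) skeleton_bcont:
  assumes "K \<in> \<T>"
  shows "\<mu> \<in> M_space k \<T> \<Longrightarrow> bcont (\<lambda>F. \<mu>)" and "\<pi> \<in> P_space k \<T> \<Longrightarrow> bcont \<pi>"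
proof -
  have F: "F \<in> facets \<T>" if "F facet_of K" for F using that assms by (auto simp: facets_def)
  show "bcont (\<lambda>F. \<mu>)" if "\<mu> \<in> M_space k \<T>"
    unfolding bcont_def
  proof (intro allI impI)
    fix F assume "F facet_of K"
    then have "F \<subseteq> \<Union>(facets \<T>)" using F by blast
    then show "continuous_on F \<mu>" using that continuous_on_subset by (auto simp: M_space_def)
  qed
  show "bcont \<pi>" if "\<pi> \<in> P_space k \<T>"
    unfolding bcont_def
  proof (intro allI impI)
    fix F assume "F facet_of K"
    then have "\<pi> F \<in> poly_s k F" using F that by (auto simp: P_space_def)
    then obtain q where q: "q \<in> polys k" "\<pi> F = restrict q F" by (auto simp: poly_s_restrict)
    show "continuous_on F (\<pi> F)"
      by (rule continuous_on_cong[THEN iffD1, OF refl _ polys_continuous[OF q(1)]]) (simp add: q(2))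
  qed
qed

text \<open>The essential supremum bounds the norm almost everywhere; continuity on U makes the
  bound hold at every point of U.\<close>

lemma Linf_norm_bound:
  assumes f: "continuous_on U f" "open U" "U \<subseteq> V" "open V" and c: "Linf_norm V f < ereal c" and x: "x \<in> U"
  shows "norm (f x) \<le> c"
proof (rule continuous_AE_bound[OF f(2,1) _ x])
  have "AE x in lebesgue_on V. norm (f x) \<le> c"
    using esssup_AE[of "\<lambda>x. ereal (norm (f x))" "lebesgue_on V"]
  proof eventually_elim
    case (elim x)
    then have "ereal (norm (f x)) \<le> ereal c" using c unfolding Linf_norm_def by order
    then show ?case by simp
  qed
  then have "AE x in lebesgue. x \<in> V \<longrightarrow> norm (f x) \<le> c"
    using f(4) by (subst (asm) AE_restrict_space_iff) auto
  then have "AE x in lebesgue. x \<in> U \<longrightarrow> norm (f x) \<le> c"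
    by (rule AE_mp) (use f(3) in auto)
  then show "AE x in lebesgue_on U. norm (f x) \<le> c"
    using f(2) by (subst AE_restrict_space_iff) auto
qed

lemma well_posed:
  fixes \<C> :: "('n::{finite,wellorder}, 'm::finite) vector_calculus" and K :: "(real, 'n) vec set"
  assumes \<C>: "mhd_calculus \<C>" and std: "standing_assumptions \<Omega> \<sigma> \<T> k Rey Rem \<kappa> d w"
    and \<alpha>1: "ereal (1/2) * Linf_norm \<Omega> w < ereal \<alpha>1"
    and \<beta>: "\<And>F. F facet_of K \<Longrightarrow> positive_definite (penalty \<beta>1 \<beta>2 (normal K F))"
    and K: "K \<in> \<T>" and data: "uh \<in> M_space k \<T>" "ph \<in> P_space k \<T>" "bh \<in> M_space k \<T>" "rh \<in> P_space k \<T>"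
      "f \<in> L2 \<Omega>" "g \<in> L2 \<Omega>"
  shows "\<exists>!z. z \<in> local_solutions \<C> k Rey Rem \<kappa> d w \<alpha>1 \<beta>1 \<beta>2 K uh ph bh rh f g"
proof -
  have \<Omega>: "lipschitz_domain \<Omega>" "open \<Omega>" and mesh: "\<Union>\<T> = closure \<Omega>" "int CARD('n) simplex K"
    and pos: "1 \<le> k" "0 < Rey" "0 < Rem" "0 < \<kappa>"
    and d: "d \<in> W1inf \<Omega>" and w: "w \<in> W1inf (interior K)" "weak_divergence \<Omega> w (\<lambda>_. 0)"
    using std K by (auto simp: standing_assumptions_def simplicial_mesh_def lipschitz_domain_def)
  interpret full_polytope K using mesh(2) by (rule full_simplex)
  have "interior K \<subseteq> interior (closure \<Omega>)" using K mesh(1) by (intro interior_mono) blast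
  then have sub: "interior K \<subseteq> \<Omega>" using lipschitz_domain_interior_closure[OF \<Omega>(1)] by blast
  \<comment> \<open>The hypothesis on \<alpha>1 also excludes an infinite norm. A real c strictly
    between the norm and 2 \<alpha>1 then serves as the pointwise bound.\<close>
  have "Linf_norm \<Omega> w < ereal (2 * \<alpha>1)"
    using \<alpha>1 by (cases "Linf_norm \<Omega> w") auto
  then obtain c where c: "Linf_norm \<Omega> w < ereal c" "c < 2 * \<alpha>1"
    using ereal_dense2 by fastforce
  have "norm (w x) \<le> c" if "x \<in> interior K" for x
    using Linf_norm_bound[OF _ open_interior sub \<Omega>(2) c(1) that] w(1) by (simp add: W1inf_def)
  then have bound: "\<exists>c. (\<forall>x\<in>interior K. norm (w x) \<le> c) \<and> c < 2 * \<alpha>1" using c(2) by blast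
  have "local_solver \<C> K k Rey Rem \<kappa> \<alpha>1 \<beta>1 \<beta>2 d w uh bh f g ph rh"
    by (intro local_solver.intro \<C> lebesgue_polytope.intro full_polytope_axioms local_solver_axioms.intro
        pos W1inf_subset[OF d sub open_interior \<Omega>(2)] w(1) weak_divergence_subset[OF w(2) sub open_interior \<Omega>(2)]
        bound \<beta> skeleton_bcont[OF K, where k = k] data L2_integrable[OF _ sub \<Omega>(2)])
  then show ?thesis by (rule local_solver.local_solver_well_posed)
qed

theorem theorem3p2:
  shows
    "(\<forall>\<Omega> \<sigma> \<T> k Rey Rem \<kappa> d w \<alpha>1 \<beta>1 \<beta>2.
        standing_assumptions (\<Omega> :: (real^2) set) \<sigma> \<T> k Rey Rem \<kappa> d w \<and>
        ereal \<alpha>1 > ereal (1/2) * Linf_norm \<Omega> w \<and>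
        (\<forall>K\<in>\<T>. \<forall>F. F facet_of K \<longrightarrow> positive_definite (penalty \<beta>1 \<beta>2 (normal K F)))
      \<longrightarrow> (\<forall>K\<in>\<T>. \<forall>uh\<in>M_space k \<T>. \<forall>ph\<in>P_space k \<T>. \<forall>bh\<in>M_space k \<T>. \<forall>rh\<in>P_space k \<T>.
             \<forall>f\<in>L2 \<Omega>. \<forall>g\<in>L2 \<Omega>.
             \<exists>!z. z \<in> local_solutions calculus2 k Rey Rem \<kappa> d w \<alpha>1 \<beta>1 \<beta>2 K uh ph bh rh f g)) \<and>
     (\<forall>\<Omega> \<sigma> \<T> k Rey Rem \<kappa> d w \<alpha>1 \<beta>1 \<beta>2.
        standing_assumptions (\<Omega> :: (real^3) set) \<sigma> \<T> k Rey Rem \<kappa> d w \<and>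
        ereal \<alpha>1 > ereal (1/2) * Linf_norm \<Omega> w \<and>
        (\<forall>K\<in>\<T>. \<forall>F. F facet_of K \<longrightarrow> positive_definite (penalty \<beta>1 \<beta>2 (normal K F)))
      \<longrightarrow> (\<forall>K\<in>\<T>. \<forall>uh\<in>M_space k \<T>. \<forall>ph\<in>P_space k \<T>. \<forall>bh\<in>M_space k \<T>. \<forall>rh\<in>P_space k \<T>.
             \<forall>f\<in>L2 \<Omega>. \<forall>g\<in>L2 \<Omega>.
             \<exists>!z. z \<in> local_solutions calculus3 k Rey Rem \<kappa> d w \<alpha>1 \<beta>1 \<beta>2 K uh ph bh rh f g))"
  by (intro conjI allI impI ballI; elim conjE)
    (rule well_posed[OF mhd_calculus2] well_posed[OF mhd_calculus3]; simp)+

end
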